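(* Let $N=2$, $p\in[1,\infty)$, and for $i=1,2$ let $\mu_i\in\mathcal P(X_i)$ satisfy $\int\exp(\alpha\,d_{X_i}(\hat x_i,x_i)^p)\,\mu_i(dx_i)<\infty$ for some $\alpha>0$ and $\hat x_i\in X_i$. Let $\pi^*$ be the optimizer of $S_{\rm ent}(\mu_1,\mu_2,c)$ and $(\pi^n)_{n\ge0}$ the Sinkhorn iterates. (i) If $c:X\to[0,\infty)$ is continuous with growth of order $p$, then $\mathcal F(\pi^n)\to\mathcal F(\pi^* )$ and $\pi^n\to\pi^*$ in $W_p$ as $n\to\infty$. (ii) Let $1\le q\le p$ and $c=fg\ge0$ where $f,g:X\to\mathbb R$ are Lipschitz with growth of order $p-1$ (i.e. $|f(x)|,|g(x)|\le C(1+d_{X,p}(x,\hat x)^{p-1})$). Then there is a constant $c_0$ (independent of $n$) such that for all $n\ge2$, $$|\mathcal F(\pi^* )-\mathcal F(\pi^n)|\le c_0n^{-\frac1{2p}},\qquad W_q(\pi^*,\pi^n)\le c_0n^{-\frac1{4pq}}.$$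
   Context: $(X_1,d_{X_1}),(X_2,d_{X_2})$ Polish, $X=X_1\times X_2$, $d_{X,r}(x,y)=(d_{X_1}(x_1,y_1)^r+d_{X_2}(x_2,y_2)^r)^{1/r}$, $W_r$ on $X$ w.r.t. $d_{X,r}$. Growth of order $p$: $|c(x)|\le C(1+d_{X,p}(x,\hat x)^p)$. $S_{\rm ent}(\mu_1,\mu_2,c)=\inf_{\pi\in\Pi(\mu_1,\mu_2)}\int c\,d\pi+D_{\rm KL}(\pi,\mu_1\otimes\mu_2)$, $\Pi$ = couplings. $\mathcal F(\pi):=\int c\,d\pi+D_{\rm KL}(\pi,\mu_1\otimes\mu_2)$ for $\pi\in\mathcal P(X)$. Sinkhorn iterates: $\pi^0=P_c$ with $\frac{dP_c}{d(\mu_1\otimes\mu_2)}=e^{-c}/\int e^{-c}\,d(\mu_1\otimes\mu_2)$; for $n\ge1$, $\frac{d\pi^n}{d\pi^{n-1}}(x)=\frac{d\mu_1}{d\pi^{n-1}_1}(x_1)$ for $n$ odd and $\frac{d\pi^n}{d\pi^{n-1}}(x)=\frac{d\mu_2}{d\pi^{n-1}_2}(x_2)$ for $n$ even, where $\pi^{n-1}_i$ is the $i$-th marginal of $\pi^{n-1}$. *)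

theory Defs
  imports "HOL-Probability.Probability"
begin

definition dXr :: "real \<Rightarrow> ('a::metric_space \<times> 'b::metric_space) \<Rightarrow> ('a \<times> 'b) \<Rightarrow> real" where
  "dXr r x y = (dist (fst x) (fst y) powr r + dist (snd x) (snd y) powr r) powr (1 / r)"

definition couplings :: "'a::topological_space measure \<Rightarrow> 'b::topological_space measure \<Rightarrow> ('a \<times> 'b) measure set" where
  "couplings M N = {P. prob_space P \<and> sets P = sets (borel :: ('a \<times> 'b) measure)
      \<and> distr P borel fst = M \<and> distr P borel snd = N}"

definition Wass :: "real \<Rightarrow> ('a::metric_space \<times> 'b::metric_space) measure \<Rightarrow> ('a \<times> 'b) measure \<Rightarrow> ennreal" where
  "Wass r P Q = (let I = (INF \<gamma>\<in>couplings P Q. \<integral>\<^sup>+ z. ennreal (dXr r (fst z) (snd z) powr r) \<partial>\<gamma>)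
     in if I = \<infinity> then \<infinity> else ennreal (enn2real I powr (1 / r)))"

definition ext_integral :: "'a measure \<Rightarrow> ('a \<Rightarrow> real) \<Rightarrow> ereal" where
  "ext_integral M f = enn2ereal (\<integral>\<^sup>+ x. ennreal (max 0 (f x)) \<partial>M) - enn2ereal (\<integral>\<^sup>+ x. ennreal (max 0 (- f x)) \<partial>M)"

definition KL :: "'a measure \<Rightarrow> 'a measure \<Rightarrow> ereal" where
  "KL P N = (if sets P = sets N \<and> absolutely_continuous N P
     then ext_integral P (\<lambda>x. ln (enn2real (RN_deriv N P x))) else \<infinity>)"

definition Fent :: "('a::topological_space \<times> 'b::topological_space \<Rightarrow> real) \<Rightarrow> 'a measure \<Rightarrow> 'b measure \<Rightarrow> ('a \<times> 'b) measure \<Rightarrow> ereal" where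
  "Fent c \<mu>1 \<mu>2 \<pi> = ext_integral \<pi> c + KL \<pi> (\<mu>1 \<Otimes>\<^sub>M \<mu>2)"

definition S_ent :: "('a::topological_space \<times> 'b::topological_space \<Rightarrow> real) \<Rightarrow> 'a measure \<Rightarrow> 'b measure \<Rightarrow> ereal" where
  "S_ent c \<mu>1 \<mu>2 = (INF \<pi>\<in>couplings \<mu>1 \<mu>2. Fent c \<mu>1 \<mu>2 \<pi>)"

primrec sinkhorn :: "('a::topological_space \<times> 'b::topological_space \<Rightarrow> real) \<Rightarrow> 'a measure \<Rightarrow> 'b measure \<Rightarrow> nat \<Rightarrow> ('a \<times> 'b) measure" where
  "sinkhorn c \<mu>1 \<mu>2 0 = density (\<mu>1 \<Otimes>\<^sub>M \<mu>2)
      (\<lambda>x. ennreal (exp (- c x)) / (\<integral>\<^sup>+ y. ennreal (exp (- c y)) \<partial>(\<mu>1 \<Otimes>\<^sub>M \<mu>2)))"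
| "sinkhorn c \<mu>1 \<mu>2 (Suc n) =
     (if even n
      then density (sinkhorn c \<mu>1 \<mu>2 n) (\<lambda>x. RN_deriv (distr (sinkhorn c \<mu>1 \<mu>2 n) borel fst) \<mu>1 (fst x))
      else density (sinkhorn c \<mu>1 \<mu>2 n) (\<lambda>x. RN_deriv (distr (sinkhorn c \<mu>1 \<mu>2 n) borel snd) \<mu>2 (snd x)))"

definition growth :: "real \<Rightarrow> real \<Rightarrow> ('a::metric_space \<times> 'b::metric_space \<Rightarrow> real) \<Rightarrow> bool" where
  "growth p r h = (\<exists>C xh. \<forall>x. \<bar>h x\<bar> \<le> C * (1 + dXr p x xh powr r))"

definition lipschitzX :: "real \<Rightarrow> ('a::metric_space \<times> 'b::metric_space \<Rightarrow> real) \<Rightarrow> bool" where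
  "lipschitzX p h = (\<exists>L. \<forall>x y. \<bar>h x - h y\<bar> \<le> L * dXr p x y)"

end

theory Submission
  imports Defs
begin

text \<open>
  Write the iterates as \<open>\<pi>\<^sup>n = exp (a + b - c) (\<mu>\<^sub>1 \<otimes> \<mu>\<^sub>2)\<close>. Each half step increases the dual value
  \<open>\<integral>a d\<mu>\<^sub>1 + \<integral>b d\<mu>\<^sub>2 \<le> \<integral>c d(\<mu>\<^sub>1 \<otimes> \<mu>\<^sub>2)\<close> by the relative entropy of the prescribed marginal with respect
  to the current one, and by data processing these entropies, in either direction, are monotone along
  the iteration; hence the entropy of the unmatched marginal \<open>\<nu>\<close> of \<open>\<pi>\<^sup>n\<close> is \<open>O(1/n)\<close>. The exponential
  moments turn this into \<open>O(n\<^sup>-\<^sup>1\<^sup>/\<^sup>2)\<close> in total variation weighted by \<open>1 + d\<^sup>p\<close>.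

  The stability argument pushes a coupling through the total variation optimal kernel between \<open>\<mu>\<close> and
  \<open>\<nu>\<close>. This does not increase the entropy relative to the product of the marginals, and changes the
  transport cost by \<open>\<delta> = O(n\<^sup>-\<^sup>1\<^sup>/\<^sup>2 log n)\<close>, without the logarithm if \<open>c\<close> is bounded. Applied to \<open>\<pi>\<^sup>n\<close> it
  gives \<open>F(\<pi>\<^sup>*) \<le> F(\<pi>\<^sup>n) + \<delta>\<close>; applied to \<open>\<pi>\<^sup>*\<close> it gives a competitor \<open>s\<close> with the marginals of \<open>\<pi>\<^sup>n\<close>, for
  which the relative entropy of \<open>s\<close> with respect to \<open>\<pi>\<^sup>n\<close> equals \<open>F(s) - F(\<pi>\<^sup>n)\<close> and is therefore
  \<open>O(\<delta>)\<close>. A weighted Pinsker inequality and the total variation coupling then bound \<open>W\<^sub>q\<^sup>q\<close> by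
  \<open>O(\<delta>\<^sup>1\<^sup>/\<^sup>2)\<close>. In (ii), \<open>c = f g\<close> has growth of order \<open>p\<close>, and is bounded if \<open>p = 1\<close>;
  if \<open>p > 1\<close>, then \<open>\<delta> = O(n\<^sup>-\<^sup>1\<^sup>/\<^sup>2\<^sup>p)\<close> in spite of the logarithm.
\<close>

section \<open>Pointwise inequalities and marginals\<close>

text \<open>Exponential moments are known only for \<open>\<mu>1\<close> and \<open>\<mu>2\<close>,
  and a weighted Pinsker inequality needs them for its reference measure. The entropies gained by
  the dual value have the current marginal as reference, so they are summable but of the wrong kind;
  data processing over one half step turns them into entropies relative to the prescribed marginal.
  For the same reason the final comparison, whose reference is the iterate, has to cut off the part
  of its unmatched marginal that exceeds the prescribed one. The logarithm arises because mass of
  order t = n^(-1/2) is displaced in the unmatched coordinate, while the weight of the other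
  coordinate on this mass is controlled only by exponential moments, hence by truncation at a level
  of order ln (1/t). The competitor is needed because comparing the optimizer with the iterate
  directly would leave the integral of a potential against the difference of two marginals, and no
  bound on the potentials uniform in n is at hand. Among plans with the marginals of the iterate
  this term is constant.\<close>

lemma xlnx_tangent:
  fixes s t :: real
  assumes "0 < t" "0 \<le> s"
  shows "t * ln t + (1 + ln t) * (s - t) \<le> s * ln s"
proof (cases "s = 0")
  case False
  with assms have s: "0 < s" by simp
  have "ln (t / s) \<le> t / s - 1" using s assms by (intro ln_le_minus_one) simp
  then have "s * (ln t - ln s) \<le> s * (t / s - 1)"
    using s assms by (intro mult_left_mono) (simp_all add: ln_div)
  also have "\<dots> = t - s" using s by (simp add: field_simps)
  finally show ?thesis by (simp add: algebra_simps)
qed (use assms in \<open>simp add: algebra_simps\<close>)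

lemma xlnx_ge: "0 \<le> s \<Longrightarrow> s - 1 \<le> s * ln (s::real)"
  using xlnx_tangent[of 1 s] by simp

lemma xlnx_convex:
  fixes s t w :: real
  assumes "0 \<le> w" "w \<le> 1" "0 \<le> s" "0 \<le> t"
  shows "(w * s + (1 - w) * t) * ln (w * s + (1 - w) * t) \<le> w * (s * ln s) + (1 - w) * (t * ln t)"
proof -
  let ?u = "w * s + (1 - w) * t"
  have nn: "0 \<le> w * s" "0 \<le> (1 - w) * t" using assms by auto
  show ?thesis
  proof (cases "?u = 0")
    case True
    then have "w * s = 0" "(1 - w) * t = 0" using nn by linarith+
    then have "w * (s * ln s) = 0" "(1 - w) * (t * ln t) = 0" by auto
    then have "w * (s * ln s) + (1 - w) * (t * ln t) = 0" by linarith
    then show ?thesis unfolding True by simp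
  next
    case False
    then have u: "0 < ?u" using nn by linarith
    have "w * (?u * ln ?u + (1 + ln ?u) * (s - ?u)) \<le> w * (s * ln s)"
      using xlnx_tangent[OF u assms(3)] assms by (intro mult_left_mono) auto
    moreover have "(1 - w) * (?u * ln ?u + (1 + ln ?u) * (t - ?u)) \<le> (1 - w) * (t * ln t)"
      using xlnx_tangent[OF u assms(4)] assms by (intro mult_left_mono) auto
    moreover have "w * (?u * ln ?u + (1 + ln ?u) * (s - ?u)) + (1 - w) * (?u * ln ?u + (1 + ln ?u) * (t - ?u)) = ?u * ln ?u"
      (is "?l = ?r")
    proof -
      have "w * (?u * l + (1 + l) * (s - ?u)) + (1 - w) * (?u * l + (1 + l) * (t - ?u)) = ?u * l" for l
        by (simp add: algebra_simps)
      then show ?thesis .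
    qed
    ultimately show ?thesis by linarith
  qed
qed

text \<open>Fenchel-Young duality between \<open>t * ln t - t\<close> and \<open>exp\<close>: the
  tangent inequality at the point \<open>exp u\<close>.\<close>

lemma young_xlnx:
  fixes u t :: real
  assumes "0 \<le> t"
  shows "u * t \<le> t * ln t - t + exp u"
  using xlnx_tangent[of "exp u" t] assms by (simp add: algebra_simps)

text \<open>Both signs get the same majorant, so that an excess and a deficit of a density can be
  treated together.\<close>

lemma exp_taylor_bound:
  fixes u :: real
  assumes "0 \<le> u"
  shows "exp u - 1 - u \<le> u\<^sup>2 * exp u" "exp (-u) - 1 + u \<le> u\<^sup>2 * exp u"
proof -
  have 1: "u * exp (-u) \<le> 1 - exp (-u)"
    using exp_ge_add_one_self[of u] by (simp add: exp_minus field_simps)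
  have 2: "1 - exp (-u) \<le> u" using exp_ge_add_one_self[of "-u"] by simp
  have e: "exp u - 1 \<le> u * exp u"
    using mult_left_mono[OF 2, of "exp u"] by (simp add: algebra_simps exp_minus)
  have "exp u - 1 - u \<le> u * exp u - u" using e by simp
  also have "\<dots> = u * (exp u - 1)" by (simp add: algebra_simps)
  also have "\<dots> \<le> u * (u * exp u)" using e assms by (intro mult_left_mono)
  finally show "exp u - 1 - u \<le> u\<^sup>2 * exp u" by (simp add: power2_eq_square algebra_simps)
  have "exp (-u) - 1 + u \<le> u - u * exp (-u)" using 1 by simp
  also have "\<dots> = u * (1 - exp (-u))" by (simp add: algebra_simps)
  also have "\<dots> \<le> u * u" using 2 assms by (intro mult_left_mono)
  also have "\<dots> \<le> u\<^sup>2 * exp u" using assms by (simp add: power2_eq_square mult_le_cancel_left1)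
  finally show "exp (-u) - 1 + u \<le> u\<^sup>2 * exp u" .
qed

lemma sq_le_2exp: "0 \<le> x \<Longrightarrow> x\<^sup>2 \<le> 2 * exp (x::real)"
  using exp_lower_Taylor_quadratic[of x] by simp

text \<open>Integrating and then choosing \<open>l\<close> of the order of the square root of the relative entropy
  yields the weighted Pinsker inequality.\<close>

lemma weighted_pinsker_pointwise:
  fixes l \<alpha> \<phi> s q :: real
  assumes l: "0 < l" "l \<le> \<alpha> / 2" and "0 \<le> \<phi>" "0 \<le> s" "0 < q"
  shows "\<phi> * \<bar>s - q\<bar> \<le> (s * ln (s / q) - s + q) / l + l * (8 / \<alpha>\<^sup>2) * (q * exp (\<alpha> * \<phi>))"
proof -
  define t where "t = s / q"
  have t: "0 \<le> t" "s = q * t" using assms by (auto simp: t_def)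
  have \<alpha>: "0 < \<alpha>" using l by simp
  let ?u = "l * \<phi>"
  have u: "0 \<le> ?u" using assms by simp
  \<comment> \<open>Young's inequality at \<open>?u\<close> controls the excess
    \<open>t - 1\<close>, at \<open>- ?u\<close> the deficit \<open>1 - t\<close>.\<close>
  have "?u * (t - 1) \<le> (t * ln t - t + 1) + ?u\<^sup>2 * exp ?u"
    using young_xlnx[OF t(1), of ?u] exp_taylor_bound(1)[OF u] by (simp add: algebra_simps)
  moreover have "?u * (1 - t) \<le> (t * ln t - t + 1) + ?u\<^sup>2 * exp ?u"
    using young_xlnx[OF t(1), of "-?u"] exp_taylor_bound(2)[OF u] by (simp add: algebra_simps)
  ultimately have A: "?u * \<bar>t - 1\<bar> \<le> (t * ln t - t + 1) + ?u\<^sup>2 * exp ?u" by (simp add: abs_if)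
  have "\<phi>\<^sup>2 = (4 / \<alpha>\<^sup>2) * (\<alpha> * \<phi> / 2)\<^sup>2" using \<alpha> by (simp add: power2_eq_square)
  also have "\<dots> \<le> (4 / \<alpha>\<^sup>2) * (2 * exp (\<alpha> * \<phi> / 2))"
    using assms \<alpha> by (intro mult_left_mono sq_le_2exp) auto
  finally have p2: "\<phi>\<^sup>2 \<le> (8 / \<alpha>\<^sup>2) * exp (\<alpha> * \<phi> / 2)" by simp
  \<comment> \<open>Half of the exponential moment pays for \<open>exp ?u\<close>, the other half
    for the square of \<open>\<phi>\<close>; hence the restriction
    \<open>l \<le> \<alpha> / 2\<close>.\<close>
  have eu: "exp ?u \<le> exp (\<alpha> * \<phi> / 2)" using mult_right_mono[OF l(2) \<open>0 \<le> \<phi>\<close>] by simp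
  have "\<phi>\<^sup>2 * exp ?u \<le> ((8 / \<alpha>\<^sup>2) * exp (\<alpha> * \<phi> / 2)) * exp (\<alpha> * \<phi> / 2)"
    by (intro mult_mono p2 eu) auto
  also have "\<dots> = (8 / \<alpha>\<^sup>2) * exp (\<alpha> * \<phi>)" by (simp flip: exp_add)
  finally have "l\<^sup>2 * (\<phi>\<^sup>2 * exp ?u) \<le> l\<^sup>2 * ((8 / \<alpha>\<^sup>2) * exp (\<alpha> * \<phi>))"
    by (intro mult_left_mono) auto
  then have "l * (\<phi> * \<bar>t - 1\<bar>) \<le> (t * ln t - t + 1) + l\<^sup>2 * ((8 / \<alpha>\<^sup>2) * exp (\<alpha> * \<phi>))"
    using A by (simp add: power_mult_distrib algebra_simps)
  then have "\<phi> * \<bar>t - 1\<bar> \<le> (t * ln t - t + 1) / l + l * ((8 / \<alpha>\<^sup>2) * exp (\<alpha> * \<phi>))"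
    using l by (simp add: field_simps power2_eq_square)
  then have "q * (\<phi> * \<bar>t - 1\<bar>) \<le> q * ((t * ln t - t + 1) / l + l * ((8 / \<alpha>\<^sup>2) * exp (\<alpha> * \<phi>)))"
    using \<open>0 < q\<close> by (intro mult_left_mono) auto
  moreover have "\<bar>s - q\<bar> = q * \<bar>t - 1\<bar>"
  proof -
    have "s - q = q * (t - 1)" using t by (simp add: algebra_simps)
    then show ?thesis using \<open>0 < q\<close> by (simp add: abs_mult)
  qed
  moreover have "q * ((t * ln t - t + 1) / l) = (s * ln (s / q) - s + q) / l"
    using t by (simp add: t_def[symmetric] algebra_simps)
  moreover have "q * ((t * ln t - t + 1) / l + l * ((8 / \<alpha>\<^sup>2) * exp (\<alpha> * \<phi>)))
      = q * ((t * ln t - t + 1) / l) + l * (8 / \<alpha>\<^sup>2) * (q * exp (\<alpha> * \<phi>))"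
    by (simp add: algebra_simps)
  moreover have "\<phi> * (q * \<bar>t - 1\<bar>) = q * (\<phi> * \<bar>t - 1\<bar>)" by simp
  ultimately show ?thesis by metis
qed

text \<open>Truncation at level \<open>R\<close>: beyond it, half of the exponential moment bounds
  \<open>\<phi>\<close> and the other half decays in \<open>R\<close>. This is where the logarithm
  will come from.\<close>

lemma exp_tail_bound:
  fixes \<alpha> \<phi> R :: real
  assumes "0 < \<alpha>" "0 \<le> \<phi>" "0 \<le> R"
  shows "\<phi> \<le> R + (2 / \<alpha>) * exp (- \<alpha> * R / 2) * exp (\<alpha> * \<phi>)"
proof (cases "\<phi> \<le> R")
  case True
  then show ?thesis using assms by (simp add: add_increasing2)
next
  case False
  have "\<phi> \<le> (2 / \<alpha>) * exp (\<alpha> * \<phi> / 2)"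
    using exp_ge_add_one_self[of "\<alpha> * \<phi> / 2"] assms by (simp add: field_simps)
  also have "\<dots> \<le> (2 / \<alpha>) * exp (\<alpha> * \<phi> - \<alpha> * R / 2)"
    using False assms by (intro mult_left_mono) (auto simp: field_simps)
  also have "\<dots> = (2 / \<alpha>) * exp (- \<alpha> * R / 2) * exp (\<alpha> * \<phi>)" by (simp flip: exp_add)
  finally show ?thesis using assms by simp
qed

text \<open>The tangent to \<open>s * ln s\<close> at the mean integrates to the claim. A zero mean
  is separate since there is no tangent at 0; then \<open>w x * g x\<close> vanishes almost
  everywhere.\<close>

lemma jensen_xlnx:
  fixes w g :: "'a \<Rightarrow> real"
  assumes w: "\<And>x. 0 \<le> w x" "integrable N w" "(\<integral>x. w x \<partial>N) = 1"
    and g: "\<And>x. 0 \<le> g x" "integrable N (\<lambda>x. w x * g x)" "integrable N (\<lambda>x. w x * (g x * ln (g x)))"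
  shows "(\<integral>x. w x * g x \<partial>N) * ln (\<integral>x. w x * g x \<partial>N) \<le> (\<integral>x. w x * (g x * ln (g x)) \<partial>N)"
proof -
  let ?t = "\<integral>x. w x * g x \<partial>N"
  have t: "0 \<le> ?t" using w g by (intro integral_nonneg_AE) auto
  show ?thesis
  proof (cases "?t = 0")
    case True
    then have "AE x in N. w x * g x = 0"
      using g w by (subst (asm) integral_nonneg_eq_0_iff_AE) auto
    then have "AE x in N. w x * (g x * ln (g x)) = 0" by eventually_elim auto
    then show ?thesis using True by (simp add: integral_eq_zero_AE)
  next
    case False
    then have t: "0 < ?t" using t by simp
    have "w x * (?t * ln ?t + (1 + ln ?t) * (g x - ?t)) \<le> w x * (g x * ln (g x))" for x
      using xlnx_tangent[OF t g(1)] w(1) by (intro mult_left_mono) auto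
    then have le: "w x * (?t * ln ?t - (1 + ln ?t) * ?t) + (1 + ln ?t) * (w x * g x) \<le> w x * (g x * ln (g x))" for x
      by (simp add: algebra_simps)
    have "(\<integral>x. w x * (?t * ln ?t - (1 + ln ?t) * ?t) + (1 + ln ?t) * (w x * g x) \<partial>N)
        \<le> (\<integral>x. w x * (g x * ln (g x)) \<partial>N)"
      using w g le by (intro integral_mono) auto
    also have "(\<integral>x. w x * (?t * ln ?t - (1 + ln ?t) * ?t) + (1 + ln ?t) * (w x * g x) \<partial>N)
        = (?t * ln ?t - (1 + ln ?t) * ?t) + (1 + ln ?t) * ?t"
      using w g by simp
    finally show ?thesis by simp
  qed
qed

lemma jensen_ln:
  fixes w g :: "'a \<Rightarrow> real"
  assumes w: "\<And>x. 0 \<le> w x" "integrable N w" "(\<integral>x. w x \<partial>N) = 1"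
    and g: "AE x in N. 0 < g x" "integrable N (\<lambda>x. w x * g x)" "integrable N (\<lambda>x. w x * ln (g x))"
  shows "0 < (\<integral>x. w x * g x \<partial>N)"
    and "(\<integral>x. w x * ln (g x) \<partial>N) \<le> ln (\<integral>x. w x * g x \<partial>N)"
proof -
  let ?t = "\<integral>x. w x * g x \<partial>N"
  have nn: "AE x in N. 0 \<le> w x * g x" using g(1) by eventually_elim (use w in auto)
  have "?t \<noteq> 0"
  proof
    assume "?t = 0"
    then have "AE x in N. w x * g x = 0"
      using g nn by (subst (asm) integral_nonneg_eq_0_iff_AE) auto
    then have "AE x in N. w x = 0" using g(1) by eventually_elim auto
    then have "(\<integral>x. w x \<partial>N) = 0" by (rule integral_eq_zero_AE)
    then show False using w by simp
  qed
  moreover have "0 \<le> ?t" using nn by (rule integral_nonneg_AE)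
  ultimately show t: "0 < ?t" by simp
  have "AE x in N. w x * ln (g x) \<le> w x * (ln ?t - 1) + w x * g x / ?t"
    using g(1)
  proof eventually_elim
    case (elim x)
    have "ln (g x / ?t) \<le> g x / ?t - 1" using elim t by (intro ln_le_minus_one) simp
    then have "ln (g x) \<le> (ln ?t - 1) + g x / ?t" using elim t by (simp add: ln_div)
    from mult_left_mono[OF this w(1)[of x]] show ?case by (simp add: algebra_simps)
  qed
  then have "(\<integral>x. w x * ln (g x) \<partial>N) \<le> (\<integral>x. w x * (ln ?t - 1) + w x * g x / ?t \<partial>N)"
    using w g by (intro integral_mono_AE) auto
  also have "\<dots> = (ln ?t - 1) + ?t / ?t" using w g by simp
  finally show "(\<integral>x. w x * ln (g x) \<partial>N) \<le> ln ?t" using t by simp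
qed

section \<open>Marginals of densities on a product\<close>

abbreviation (in pair_sigma_finite) "MM \<equiv> M1 \<Otimes>\<^sub>M M2"
abbreviation (in pair_sigma_finite) "margin1 s x \<equiv> \<integral>\<^sup>+y. ennreal (s x y) \<partial>M2"
abbreviation (in pair_sigma_finite) "margin2 s y \<equiv> \<integral>\<^sup>+x. ennreal (s x y) \<partial>M1"

text \<open>Tonelli: a function of one coordinate sees only the marginal of \<open>s\<close>. Since
  \<open>g\<close> is signed, the absolute value is integrated first.\<close>

lemma (in pair_sigma_finite)
  fixes s :: "'a \<Rightarrow> 'b \<Rightarrow> real" and F g :: "'a \<Rightarrow> real"
  assumes [measurable]: "case_prod s \<in> borel_measurable MM" "g \<in> borel_measurable M1"
    and s: "\<And>x y. 0 \<le> s x y" and F: "\<And>x. 0 \<le> F x"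
    and marg: "AE x in M1. margin1 s x = ennreal (F x)"
    and int: "integrable M1 (\<lambda>x. F x * g x)"
  shows integrable_marginal_fst: "integrable MM (\<lambda>(x, y). s x y * g x)"
    and integral_marginal_fst: "(\<integral>(x, y). s x y * g x \<partial>MM) = (\<integral>x. F x * g x \<partial>M1)"
proof -
  have "(\<integral>\<^sup>+z. ennreal (norm (case z of (x, y) \<Rightarrow> s x y * g x)) \<partial>MM)
      = (\<integral>\<^sup>+x. \<integral>\<^sup>+y. ennreal (s x y * \<bar>g x\<bar>) \<partial>M2 \<partial>M1)"
    by (subst M2.nn_integral_fst[symmetric]) (auto simp: abs_mult s)
  also have "\<dots> = (\<integral>\<^sup>+x. ennreal (norm (F x * g x)) \<partial>M1)"
  proof (rule nn_integral_cong_AE)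
    show "AE x in M1. (\<integral>\<^sup>+y. ennreal (s x y * \<bar>g x\<bar>) \<partial>M2) = ennreal (norm (F x * g x))"
      using marg AE_space
    proof eventually_elim
      case (elim x)
      then have "(\<integral>\<^sup>+y. ennreal (s x y * \<bar>g x\<bar>) \<partial>M2) = margin1 s x * ennreal \<bar>g x\<bar>"
        by (subst nn_integral_multc[symmetric]) (auto simp: ennreal_mult s)
      then show ?case using elim by (simp add: ennreal_mult[symmetric] F abs_mult)
    qed
  qed
  also have "\<dots> < \<infinity>" using int by (simp add: integrable_iff_bounded)
  finally show I: "integrable MM (\<lambda>(x, y). s x y * g x)"
    by (simp add: integrable_iff_bounded)
  have "(\<integral>(x, y). s x y * g x \<partial>MM) = (\<integral>x. \<integral>y. s x y * g x \<partial>M2 \<partial>M1)"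
    using integral_fst[OF I] by simp
  also have "\<dots> = (\<integral>x. F x * g x \<partial>M1)"
  proof (rule integral_cong_AE)
    show "AE x in M1. (\<integral>y. s x y * g x \<partial>M2) = F x * g x"
      using marg AE_space
    proof eventually_elim
      case (elim x)
      then have "(\<integral>y. s x y \<partial>M2) = F x"
        by (subst integral_eq_nn_integral) (auto simp: s F)
      then show ?case by simp
    qed
  qed (use int in auto)
  finally show "(\<integral>(x, y). s x y * g x \<partial>MM) = (\<integral>x. F x * g x \<partial>M1)" .
qed


lemma (in pair_sigma_finite)
  fixes s :: "'a \<Rightarrow> 'b \<Rightarrow> real" and F g :: "'b \<Rightarrow> real"
  assumes s[measurable]: "case_prod s \<in> borel_measurable MM" and g[measurable]: "g \<in> borel_measurable M2"
    and s0: "\<And>x y. 0 \<le> s x y" and F: "\<And>y. 0 \<le> F y"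
    and marg: "AE y in M2. margin2 s y = ennreal (F y)"
    and int: "integrable M2 (\<lambda>y. F y * g y)"
  shows integrable_marginal_snd: "integrable MM (\<lambda>(x, y). s x y * g y)"
    and integral_marginal_snd: "(\<integral>(x, y). s x y * g y \<partial>MM) = (\<integral>y. F y * g y \<partial>M2)"
proof -
  interpret Q: pair_sigma_finite M2 M1 ..
  have m: "case_prod (\<lambda>y x. s x y) \<in> borel_measurable (M2 \<Otimes>\<^sub>M M1)"
    using measurable_pair_swap[OF s] by (simp add: case_prod_beta')
  note * = Q.integrable_marginal_fst[OF m g s0 F marg int] Q.integral_marginal_fst[OF m g s0 F marg int]
  show I: "integrable MM (\<lambda>(x, y). s x y * g y)"
    using Q.integrable_product_swap[OF *(1)] by simp
  show "(\<integral>(x, y). s x y * g y \<partial>MM) = (\<integral>y. F y * g y \<partial>M2)"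
    using Q.integral_product_swap[of "\<lambda>(y, x). s x y * g y"] *(2) m by simp
qed

section \<open>Total variation shadows\<close>

text \<open>Here \<open>k\<close> is a density with respect to \<open>M1 \<otimes> f1 M2\<close>, and \<open>k'\<close> the density with respect to \<open>M1 \<otimes> f2 M2\<close>
  of its image under the kernel that keeps \<open>y\<close> with probability \<open>min 1 (f2 / f1)\<close> and otherwise redraws
  it from the normalised positive part of \<open>f2 - f1\<close>. Read backwards, \<open>k' x y\<close> is an average of values
  of \<open>k x\<close>, so the entropy bound is Jensen's inequality.\<close>

lemma (in pair_prob_space) shadow:
  fixes k :: "'a \<Rightarrow> 'b \<Rightarrow> real" and f1 f2 :: "'b \<Rightarrow> real"
  assumes k[measurable]: "case_prod k \<in> borel_measurable MM"
    and f1[measurable]: "f1 \<in> borel_measurable M2" and f2[measurable]: "f2 \<in> borel_measurable M2"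
    and k0: "\<And>x y. 0 \<le> k x y" and f10: "\<And>y. 0 < f1 y" and f20: "\<And>y. 0 < f2 y"
    and i1: "integrable M2 f1" "(\<integral>y. f1 y \<partial>M2) = 1"
    and i2: "integrable M2 f2" "(\<integral>y. f2 y \<partial>M2) = 1"
    and mx: "AE x in M1. (\<integral>\<^sup>+y. ennreal (k x y * f1 y) \<partial>M2) = 1"
    and my: "AE y in M2. margin2 k y = 1"
    and ent: "integrable MM (\<lambda>(x, y). f1 y * (k x y * ln (k x y)))"
  obtains k' where "case_prod k' \<in> borel_measurable MM" "\<And>x y. 0 \<le> k' x y"
    "AE x in M1. (\<integral>\<^sup>+y. ennreal (k' x y * f2 y) \<partial>M2) = 1"
    "AE y in M2. margin2 k' y = 1"
    "integrable MM (\<lambda>(x, y). f2 y * (k' x y * ln (k' x y)))"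
    "(\<integral>(x, y). f2 y * (k' x y * ln (k' x y)) \<partial>MM)
      \<le> (\<integral>(x, y). f1 y * (k x y * ln (k x y)) \<partial>MM)"
    "\<And>\<psi>1 \<psi>2. \<psi>1 \<in> borel_measurable M1 \<Longrightarrow> \<psi>2 \<in> borel_measurable M2 \<Longrightarrow>
      (\<integral>\<^sup>+(x, y). (\<psi>1 x + \<psi>2 y) * ennreal \<bar>k' x y * f2 y - k x y * f1 y\<bar> \<partial>MM)
      \<le> 2 * (\<integral>\<^sup>+(x, y). \<psi>1 x * ennreal (k x y * max 0 (f1 y - f2 y)) \<partial>MM)
        + (\<integral>\<^sup>+y. \<psi>2 y * ennreal \<bar>f1 y - f2 y\<bar> \<partial>M2)"
proof -
  define P where "P y = max 0 (f1 y - f2 y)" for y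
  define Q where "Q y = max 0 (f2 y - f1 y)" for y
  define m where "m = (\<integral>y. P y \<partial>M2)"
  have PQ[measurable]: "P \<in> borel_measurable M2" "Q \<in> borel_measurable M2"
    unfolding P_def[abs_def] Q_def[abs_def] by measurable
  have P0: "0 \<le> P y" and Q0: "0 \<le> Q y" for y by (auto simp: P_def Q_def)
  have Pf: "P y \<le> f1 y" and Qf: "Q y \<le> f2 y" for y
    using f10[of y] f20[of y] by (auto simp: P_def Q_def)
  have PQd: "P y - Q y = f1 y - f2 y" "P y + Q y = \<bar>f1 y - f2 y\<bar>" for y by (auto simp: P_def Q_def)
  have iP: "integrable M2 P"
    by (rule Bochner_Integration.integrable_bound[OF i1(1)]) (use P0 Pf f10 in \<open>auto simp: less_imp_le\<close>)
  have iQ: "integrable M2 Q"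
    by (rule Bochner_Integration.integrable_bound[OF i2(1)]) (use Q0 Qf f20 in \<open>auto simp: less_imp_le\<close>)
  have m0: "0 \<le> m" unfolding m_def by (intro integral_nonneg_AE) (simp add: P0)
  have mQ: "m = (\<integral>y. Q y \<partial>M2)"
  proof -
    have "(\<integral>y. P y - Q y \<partial>M2) = (\<integral>y. f1 y - f2 y \<partial>M2)" by (simp add: PQd)
    then show ?thesis using iP iQ i1 i2 by (simp add: m_def)
  qed
  have nP: "(\<integral>\<^sup>+y. ennreal (P y) \<partial>M2) = ennreal m" and nQ: "(\<integral>\<^sup>+y. ennreal (Q y) \<partial>M2) = ennreal m"
    using nn_integral_eq_integral[OF iP] nn_integral_eq_integral[OF iQ] P0 Q0 by (auto simp: m_def mQ[symmetric])
  show thesis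
  \<comment> \<open>For \<open>m = 0\<close> the two laws agree, the redraw law is undefined, and
    \<open>k\<close> itself serves as \<open>k'\<close>.\<close>
  proof (cases "m = 0")
    case True
    have "AE y in M2. P y = 0"
      using True P0 iP by (simp add: m_def integral_nonneg_eq_0_iff_AE)
    moreover have "AE y in M2. Q y = 0"
      using True mQ Q0 iQ by (simp add: integral_nonneg_eq_0_iff_AE)
    ultimately have eq: "AE y in M2. f1 y = f2 y"
    proof eventually_elim
      case (elim y)
      then show ?case using PQd(1)[of y] by simp
    qed
    then have eqM: "AE z in MM. f1 (snd z) = f2 (snd z)"
      by (intro AE_pair_measure) auto
    show thesis
    proof (rule that[OF k k0 _ my])
      show "AE x in M1. (\<integral>\<^sup>+y. ennreal (k x y * f2 y) \<partial>M2) = 1"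
        using mx
      proof eventually_elim
        case (elim x)
        have "(\<integral>\<^sup>+y. ennreal (k x y * f2 y) \<partial>M2) = (\<integral>\<^sup>+y. ennreal (k x y * f1 y) \<partial>M2)"
          by (rule nn_integral_cong_AE) (use eq in eventually_elim, auto)
        then show ?case using elim by simp
      qed
      have *: "AE z in MM. (case z of (x, y) \<Rightarrow> f1 y * (k x y * ln (k x y))) = (case z of (x, y) \<Rightarrow> f2 y * (k x y * ln (k x y)))"
        using eqM by eventually_elim auto
      show "integrable MM (\<lambda>(x, y). f2 y * (k x y * ln (k x y)))"
        by (rule integrable_cong_AE_imp[OF ent]) (use * in auto)
      show "(\<integral>(x, y). f2 y * (k x y * ln (k x y)) \<partial>MM)
          \<le> (\<integral>(x, y). f1 y * (k x y * ln (k x y)) \<partial>MM)"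
        by (rule eq_refl, rule integral_cong_AE) (use * in auto)
      show "(\<integral>\<^sup>+(x, y). (\<psi>1 x + \<psi>2 y) * ennreal \<bar>k x y * f2 y - k x y * f1 y\<bar> \<partial>MM)
      \<le> 2 * (\<integral>\<^sup>+(x, y). \<psi>1 x * ennreal (k x y * max 0 (f1 y - f2 y)) \<partial>MM)
        + (\<integral>\<^sup>+y. \<psi>2 y * ennreal \<bar>f1 y - f2 y\<bar> \<partial>M2)" for \<psi>1 \<psi>2
      proof -
        have "(\<integral>\<^sup>+(x, y). (\<psi>1 x + \<psi>2 y) * ennreal \<bar>k x y * f2 y - k x y * f1 y\<bar> \<partial>MM)
            = (\<integral>\<^sup>+z. 0 \<partial>MM)"
          by (rule nn_integral_cong_AE) (use eqM in eventually_elim, auto)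
        then show ?thesis by simp
      qed
    qed
  next
    case False
    then have m: "0 < m" using m0 by simp
    \<comment> \<open>\<open>\<kappa> x\<close> averages \<open>k x\<close> over the removed mass
      \<open>P / m\<close>; it is the value that redrawn points carry. The share of
      \<open>f2 y\<close> that was kept is \<open>w y\<close>, so \<open>w y * f2 y\<close> is the
      minimum of \<open>f1 y\<close> and \<open>f2 y\<close>.\<close>
    define \<kappa> where "\<kappa> x = (\<integral>z. k x z * P z \<partial>M2) / m" for x
    define J where "J x = (\<integral>z. P z * (k x z * ln (k x z)) \<partial>M2) / m" for x
    define w where "w y = min (f1 y) (f2 y) / f2 y" for y
    define k' where "k' x y = w y * k x y + (1 - w y) * \<kappa> x" for x y
    have [measurable]: "\<kappa> \<in> borel_measurable M1" "J \<in> borel_measurable M1" "w \<in> borel_measurable M2"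
      unfolding \<kappa>_def[abs_def] J_def[abs_def] w_def[abs_def] by measurable
    have k'm[measurable]: "case_prod k' \<in> borel_measurable MM"
      unfolding k'_def[abs_def] by measurable
    have \<kappa>0: "0 \<le> \<kappa> x" for x
      unfolding \<kappa>_def using m k0 P0 by (intro divide_nonneg_pos integral_nonneg_AE) auto
    have w01: "0 \<le> w y" "w y \<le> 1" for y using f10[of y] f20[of y] by (auto simp: w_def min_def)
    have wf: "w y * f2 y = f1 y - P y" "(1 - w y) * f2 y = Q y" for y
      using f20[of y] by (auto simp: w_def P_def Q_def min_def max_def field_simps)
    have k'f: "k' x y * f2 y = (f1 y - P y) * k x y + Q y * \<kappa> x" for x y
    proof -
      have "k' x y * f2 y = (w y * f2 y) * k x y + ((1 - w y) * f2 y) * \<kappa> x"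
        by (simp add: k'_def algebra_simps)
      then show ?thesis by (simp only: wf)
    qed
    have k'0: "0 \<le> k' x y" for x y using w01 k0 \<kappa>0 by (simp add: k'_def)
    have kf1: "AE x in M1. integrable M2 (\<lambda>y. k x y * f1 y) \<and> (\<integral>y. k x y * f1 y \<partial>M2) = 1"
      using mx AE_space
    proof eventually_elim
      case (elim x)
      have "integrable M2 (\<lambda>y. k x y * f1 y)"
        using elim k0 f10 by (intro integrableI_bounded) (auto simp: abs_mult less_imp_le)
      moreover have "(\<integral>y. k x y * f1 y \<partial>M2) = 1"
        using elim k0 f10 by (subst integral_eq_nn_integral) (auto simp: less_imp_le)
      ultimately show ?case by simp
    qed
    have kP: "AE x in M1. integrable M2 (\<lambda>y. k x y * P y)"
      using kf1 AE_space
    proof eventually_elim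
      case (elim x)
      then have [measurable]: "k x \<in> borel_measurable M2" by simp
      show ?case
      proof (rule Bochner_Integration.integrable_bound)
        show "integrable M2 (\<lambda>y. k x y * f1 y)" using elim by simp
        show "AE y in M2. norm (k x y * P y) \<le> norm (k x y * f1 y)"
        proof (rule AE_I2)
          fix y show "norm (k x y * P y) \<le> norm (k x y * f1 y)"
            using k0[of x y] P0[of y] Pf[of y] f10[of y] by (auto simp: abs_mult intro!: mult_left_mono)
        qed
      qed measurable
    qed
    have n\<kappa>: "AE x in M1. (\<integral>\<^sup>+z. ennreal (k x z * P z) \<partial>M2) = ennreal (m * \<kappa> x)"
      using kP
    proof eventually_elim
      case (elim x)
      then show ?case
        using m by (subst nn_integral_eq_integral) (auto simp: k0 P0 \<kappa>_def)
    qed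
    have mx': "AE x in M1. (\<integral>\<^sup>+y. ennreal (k' x y * f2 y) \<partial>M2) = 1"
      using mx n\<kappa> AE_space
    proof eventually_elim
      case (elim x)
      then have [measurable]: "k x \<in> borel_measurable M2" by simp
      have "(\<integral>\<^sup>+y. ennreal (k' x y * f2 y) \<partial>M2) = (\<integral>\<^sup>+y. ennreal ((f1 y - P y) * k x y) + ennreal (Q y) * ennreal (\<kappa> x) \<partial>M2)"
        unfolding k'f using Pf k0 Q0 \<kappa>0
        by (intro nn_integral_cong) (simp add: ennreal_plus ennreal_mult)
      also have "\<dots> = (\<integral>\<^sup>+y. ennreal ((f1 y - P y) * k x y) \<partial>M2) + ennreal (m * \<kappa> x)"
        by (subst nn_integral_add) (auto simp: nn_integral_multc nQ ennreal_mult m0 \<kappa>0)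
      also have "\<dots> = (\<integral>\<^sup>+y. ennreal ((f1 y - P y) * k x y) + ennreal (k x y * P y) \<partial>M2)"
        using elim by (subst nn_integral_add) auto
      also have "\<dots> = (\<integral>\<^sup>+y. ennreal (k x y * f1 y) \<partial>M2)"
        by (intro nn_integral_cong, subst ennreal_plus[symmetric]) (auto simp: Pf k0 P0 algebra_simps mult_right_mono)
      finally show ?case using elim by simp
    qed
    have my\<kappa>: "(\<integral>\<^sup>+x. ennreal (\<kappa> x) \<partial>M1) = 1"
    proof -
      have "ennreal m * (\<integral>\<^sup>+x. ennreal (\<kappa> x) \<partial>M1) = (\<integral>\<^sup>+x. \<integral>\<^sup>+z. ennreal (k x z * P z) \<partial>M2 \<partial>M1)"
        by (subst nn_integral_cmult[symmetric], simp, rule nn_integral_cong_AE)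
           (use n\<kappa> in eventually_elim, auto simp: ennreal_mult m0 \<kappa>0)
      also have "\<dots> = (\<integral>\<^sup>+z. \<integral>\<^sup>+x. ennreal (k x z) * ennreal (P z) \<partial>M1 \<partial>M2)"
        by (subst Fubini') (auto simp: ennreal_mult k0 P0)
      also have "\<dots> = (\<integral>\<^sup>+z. ennreal (P z) \<partial>M2)"
      proof (rule nn_integral_cong_AE)
        show "AE z in M2. (\<integral>\<^sup>+x. ennreal (k x z) * ennreal (P z) \<partial>M1) = ennreal (P z)"
          using my AE_space by eventually_elim (simp add: nn_integral_multc)
      qed
      finally have "ennreal m * (\<integral>\<^sup>+x. ennreal (\<kappa> x) \<partial>M1) = ennreal m * 1" by (simp add: nP)
      then show ?thesis using m by (subst (asm) ennreal_mult_cancel_left) auto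
    qed
    have my': "AE y in M2. margin2 k' y = 1"
      using my AE_space
    proof eventually_elim
      case (elim y)
      then have [measurable]: "(\<lambda>x. k x y) \<in> borel_measurable M1" by simp
      have "margin2 k' y = (\<integral>\<^sup>+x. ennreal (w y) * ennreal (k x y) + ennreal (1 - w y) * ennreal (\<kappa> x) \<partial>M1)"
        unfolding k'_def using w01 k0 \<kappa>0 by (intro nn_integral_cong) (simp add: ennreal_plus ennreal_mult)
      also have "\<dots> = ennreal (w y) + ennreal (1 - w y)"
        by (subst nn_integral_add) (auto simp: nn_integral_cmult elim my\<kappa>)
      also have "\<dots> = 1" using w01 by (simp flip: ennreal_plus)
      finally show ?case .
    qed
    have iPk: "integrable MM (\<lambda>(x, y). P y * (k x y * ln (k x y)))"
      by (rule Bochner_Integration.integrable_bound[OF ent], measurable, rule AE_I2)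
         (use P0 Pf f10 in \<open>auto simp: abs_mult less_imp_le intro!: mult_right_mono\<close>)
    have iJ: "integrable M1 J" and J: "m * (\<integral>x. J x \<partial>M1) = (\<integral>(x, y). P y * (k x y * ln (k x y)) \<partial>MM)"
      using integrable_fst[OF iPk] integral_fst[OF iPk] m by (simp_all add: J_def[abs_def])
    have \<kappa>J: "AE x in M1. \<kappa> x * ln (\<kappa> x) \<le> J x"
      using kP AE_integrable_fst[OF iPk]
    proof eventually_elim
      case (elim x)
      have "(\<integral>y. P y / m * k x y \<partial>M2) * ln (\<integral>y. P y / m * k x y \<partial>M2) \<le> (\<integral>y. P y / m * (k x y * ln (k x y)) \<partial>M2)"
      proof (rule jensen_xlnx)
        show "integrable M2 (\<lambda>y. P y / m * k x y)"
          using elim(1) by (simp add: mult.commute)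
        show "integrable M2 (\<lambda>y. P y / m * (k x y * ln (k x y)))"
          using elim(2) by simp
      qed (use m P0 k0 iP in \<open>auto simp: m_def[symmetric]\<close>)
      then show ?case by (simp add: \<kappa>_def J_def mult.commute)
    qed
    have \<kappa>JM: "AE z in MM. \<kappa> (fst z) * ln (\<kappa> (fst z)) \<le> J (fst z)"
      by (rule AE_pair_measure) (use \<kappa>J in auto)
    \<comment> \<open>\<open>U\<close> replaces the entropy of \<open>\<kappa> x\<close> by its
      Jensen bound \<open>J x\<close>. As the removed mass \<open>P\<close> and the added mass
      \<open>Q\<close> are equal, its integral is exactly the old entropy.\<close>
    define U where "U = (\<lambda>(x, y). (f1 y - P y) * (k x y * ln (k x y)) + Q y * J x)"
    have i1': "integrable MM (\<lambda>(x, y). (f1 y - P y) * (k x y * ln (k x y)))"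
      using Bochner_Integration.integrable_diff[OF ent iPk] by (simp add: case_prod_beta' algebra_simps)
    have QJ: "AE x in M1. (\<integral>\<^sup>+y. ennreal (Q y) \<partial>M2) = ennreal m" by (simp add: nQ)
    note QJ' = integrable_marginal_fst[of "\<lambda>_ y. Q y", OF _ _ Q0 m0 QJ] integral_marginal_fst[of "\<lambda>_ y. Q y", OF _ _ Q0 m0 QJ]
    have i2': "integrable MM (\<lambda>(x, y). Q y * J x)"
      and I2': "(\<integral>(x, y). Q y * J x \<partial>MM) = m * (\<integral>x. J x \<partial>M1)"
      using QJ'[of J] iJ by auto
    have iU: "integrable MM U"
      using Bochner_Integration.integrable_add[OF i1' i2'] by (simp add: U_def case_prod_beta')
    have UI: "integral\<^sup>L MM U = (\<integral>(x, y). f1 y * (k x y * ln (k x y)) \<partial>MM)"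
    proof -
      have "integral\<^sup>L MM U = (\<integral>(x, y). (f1 y - P y) * (k x y * ln (k x y)) \<partial>MM)
         + (\<integral>(x, y). Q y * J x \<partial>MM)"
        using Bochner_Integration.integral_add[OF i1' i2'] by (simp add: U_def case_prod_beta')
      also have "\<dots> = (\<integral>(x, y). (f1 y - P y) * (k x y * ln (k x y)) \<partial>MM)
         + (\<integral>(x, y). P y * (k x y * ln (k x y)) \<partial>MM)"
        by (simp only: I2' J)
      also have "\<dots> = (\<integral>(x, y). f1 y * (k x y * ln (k x y)) \<partial>MM)"
        using Bochner_Integration.integral_add[OF i1' iPk] by (simp add: case_prod_beta' algebra_simps)
      finally show ?thesis .
    qed
    have leU: "AE z in MM. (case z of (x, y) \<Rightarrow> f2 y * (k' x y * ln (k' x y))) \<le> U z"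
      using \<kappa>JM
    proof eventually_elim
      case (elim z)
      obtain x y where z: "z = (x, y)" by (cases z)
      have "f2 y * (k' x y * ln (k' x y)) \<le> f2 y * (w y * (k x y * ln (k x y)) + (1 - w y) * (\<kappa> x * ln (\<kappa> x)))"
        unfolding k'_def using f20[of y] by (intro mult_left_mono xlnx_convex w01 k0 \<kappa>0) auto
      also have "\<dots> = (w y * f2 y) * (k x y * ln (k x y)) + ((1 - w y) * f2 y) * (\<kappa> x * ln (\<kappa> x))"
        by (simp add: algebra_simps)
      also have "\<dots> \<le> (f1 y - P y) * (k x y * ln (k x y)) + Q y * J x"
        unfolding wf using elim Q0 z by (intro add_left_mono mult_left_mono) auto
      finally show ?case by (simp add: z U_def)
    qed
    \<comment> \<open>Jensen bounds the new entropy integrand from above only;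
      \<open>s * ln s \<ge> -1\<close> supplies the lower bound needed for integrability.\<close>
    have geU: "AE z in MM. - f2 (snd z) \<le> (case z of (x, y) \<Rightarrow> f2 y * (k' x y * ln (k' x y)))"
    proof (rule AE_I2)
      fix z :: "'a \<times> 'b"
      obtain x y where z: "z = (x, y)" by (cases z)
      have "-1 \<le> k' x y * ln (k' x y)" using xlnx_ge[OF k'0[of x y]] k'0[of x y] by linarith
      from mult_left_mono[OF this less_imp_le[OF f20[of y]]]
      show "- f2 (snd z) \<le> (case z of (x, y) \<Rightarrow> f2 y * (k' x y * ln (k' x y)))" by (simp add: z)
    qed
    have if2: "integrable MM (\<lambda>z. f2 (snd z))"
      using integrable_marginal_snd[of "\<lambda>_ _. 1" f2 "\<lambda>_. 1"] i2(1)
      by (simp add: M1.emeasure_space_1 case_prod_beta')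
    have ent': "integrable MM (\<lambda>(x, y). f2 y * (k' x y * ln (k' x y)))"
    proof (rule Bochner_Integration.integrable_bound)
      show "integrable MM (\<lambda>z. \<bar>U z\<bar> + \<bar>f2 (snd z)\<bar>)" using iU if2 by auto
      show "AE z in MM. norm (case z of (x, y) \<Rightarrow> f2 y * (k' x y * ln (k' x y))) \<le> norm (\<bar>U z\<bar> + \<bar>f2 (snd z)\<bar>)"
        using leU geU by eventually_elim (auto simp del: abs_mult)
    qed measurable
    show thesis
    proof (rule that[OF k'm k'0 mx' my' ent'])
      show "(\<integral>(x, y). f2 y * (k' x y * ln (k' x y)) \<partial>MM)
          \<le> (\<integral>(x, y). f1 y * (k x y * ln (k x y)) \<partial>MM)"
        unfolding UI[symmetric] by (rule integral_mono_AE[OF ent' iU leU])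
    next
      fix \<psi>1 :: "'a \<Rightarrow> ennreal" and \<psi>2 :: "'b \<Rightarrow> ennreal"
      assume [measurable]: "\<psi>1 \<in> borel_measurable M1" "\<psi>2 \<in> borel_measurable M2"
      have le: "(\<psi>1 x + \<psi>2 y) * ennreal \<bar>k' x y * f2 y - k x y * f1 y\<bar>
         \<le> \<psi>1 x * ennreal (Q y) * ennreal (\<kappa> x) + \<psi>1 x * ennreal (k x y * P y)
           + \<psi>2 y * ennreal (Q y) * ennreal (\<kappa> x) + \<psi>2 y * ennreal (P y) * ennreal (k x y)" for x y
      proof -
        have "\<bar>k' x y * f2 y - k x y * f1 y\<bar> = \<bar>Q y * \<kappa> x - k x y * P y\<bar>"
          unfolding k'f by (simp add: algebra_simps)
        also have "\<dots> \<le> Q y * \<kappa> x + k x y * P y"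
          using Q0[of y] \<kappa>0[of x] k0[of x y] P0[of y] by (auto simp: abs_le_iff add_increasing)
        finally have "ennreal \<bar>k' x y * f2 y - k x y * f1 y\<bar> \<le> ennreal (Q y) * ennreal (\<kappa> x) + ennreal (k x y) * ennreal (P y)"
          using Q0[of y] \<kappa>0[of x] k0[of x y] P0[of y] by (simp add: ennreal_leI flip: ennreal_mult ennreal_plus)
        then have "(\<psi>1 x + \<psi>2 y) * ennreal \<bar>k' x y * f2 y - k x y * f1 y\<bar>
          \<le> (\<psi>1 x + \<psi>2 y) * (ennreal (Q y) * ennreal (\<kappa> x) + ennreal (k x y) * ennreal (P y))"
          by (rule mult_left_mono) simp
        also have "\<dots> = \<psi>1 x * ennreal (Q y) * ennreal (\<kappa> x) + \<psi>1 x * ennreal (k x y * P y)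
           + \<psi>2 y * ennreal (Q y) * ennreal (\<kappa> x) + \<psi>2 y * ennreal (P y) * ennreal (k x y)"
          using k0[of x y] P0[of y] by (simp add: algebra_simps ennreal_mult)
        finally show ?thesis .
      qed
      let ?I1 = "\<integral>\<^sup>+(x, y). \<psi>1 x * ennreal (k x y * P y) \<partial>MM"
      \<comment> \<open>Redrawing \<open>y\<close> leaves \<open>x\<close> in place, so removed and
        added mass have the same first marginal. This gives the factor 2 in front of the
        \<open>\<psi>1\<close> term.\<close>
      have a: "(\<integral>\<^sup>+(x, y). \<psi>1 x * ennreal (Q y) * ennreal (\<kappa> x) \<partial>MM) = ?I1"
      proof -
        have "(\<integral>\<^sup>+(x, y). \<psi>1 x * ennreal (Q y) * ennreal (\<kappa> x) \<partial>MM)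
          = (\<integral>\<^sup>+x. \<integral>\<^sup>+y. (\<psi>1 x * ennreal (\<kappa> x)) * ennreal (Q y) \<partial>M2 \<partial>M1)"
          by (subst M2.nn_integral_fst[symmetric]) (auto simp: algebra_simps)
        also have "\<dots> = (\<integral>\<^sup>+x. \<psi>1 x * ennreal (m * \<kappa> x) \<partial>M1)"
          by (subst nn_integral_cmult) (auto simp: nQ ennreal_mult m0 \<kappa>0 algebra_simps)
        also have "\<dots> = (\<integral>\<^sup>+x. \<integral>\<^sup>+y. \<psi>1 x * ennreal (k x y * P y) \<partial>M2 \<partial>M1)"
        proof (rule nn_integral_cong_AE)
          show "AE x in M1. \<psi>1 x * ennreal (m * \<kappa> x) = (\<integral>\<^sup>+y. \<psi>1 x * ennreal (k x y * P y) \<partial>M2)"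
            using n\<kappa> AE_space by eventually_elim (simp add: nn_integral_cmult)
        qed
        also have "\<dots> = ?I1" by (subst M2.nn_integral_fst[symmetric]) auto
        finally show ?thesis .
      qed
      have b: "(\<integral>\<^sup>+(x, y). \<psi>2 y * ennreal (Q y) * ennreal (\<kappa> x) \<partial>MM) = (\<integral>\<^sup>+y. \<psi>2 y * ennreal (Q y) \<partial>M2)"
        by (subst nn_integral_snd[symmetric]) (auto simp: nn_integral_cmult my\<kappa>)
      have c: "(\<integral>\<^sup>+(x, y). \<psi>2 y * ennreal (P y) * ennreal (k x y) \<partial>MM) = (\<integral>\<^sup>+y. \<psi>2 y * ennreal (P y) \<partial>M2)"
      proof -
        have "(\<integral>\<^sup>+(x, y). \<psi>2 y * ennreal (P y) * ennreal (k x y) \<partial>MM)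
          = (\<integral>\<^sup>+y. \<integral>\<^sup>+x. \<psi>2 y * ennreal (P y) * ennreal (k x y) \<partial>M1 \<partial>M2)"
          by (subst nn_integral_snd[symmetric]) auto
        also have "\<dots> = (\<integral>\<^sup>+y. \<psi>2 y * ennreal (P y) \<partial>M2)"
        proof (rule nn_integral_cong_AE)
          show "AE y in M2. (\<integral>\<^sup>+x. \<psi>2 y * ennreal (P y) * ennreal (k x y) \<partial>M1) = \<psi>2 y * ennreal (P y)"
            using my AE_space by eventually_elim (simp add: nn_integral_cmult)
        qed
        finally show ?thesis .
      qed
      have d: "(\<integral>\<^sup>+y. \<psi>2 y * ennreal (Q y) \<partial>M2) + (\<integral>\<^sup>+y. \<psi>2 y * ennreal (P y) \<partial>M2) = (\<integral>\<^sup>+y. \<psi>2 y * ennreal \<bar>f1 y - f2 y\<bar> \<partial>M2)"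
        by (subst nn_integral_add[symmetric])
           (auto simp: PQd(2)[symmetric] ennreal_plus P0 Q0 distrib_left add.commute intro!: nn_integral_cong)
      have "(\<integral>\<^sup>+(x, y). (\<psi>1 x + \<psi>2 y) * ennreal \<bar>k' x y * f2 y - k x y * f1 y\<bar> \<partial>MM)
        \<le> (\<integral>\<^sup>+z. (case z of (x, y) \<Rightarrow> \<psi>1 x * ennreal (Q y) * ennreal (\<kappa> x)) + (case z of (x, y) \<Rightarrow> \<psi>1 x * ennreal (k x y * P y))
           + (case z of (x, y) \<Rightarrow> \<psi>2 y * ennreal (Q y) * ennreal (\<kappa> x)) + (case z of (x, y) \<Rightarrow> \<psi>2 y * ennreal (P y) * ennreal (k x y)) \<partial>MM)"
        by (rule nn_integral_mono) (use le in auto)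
      also have "\<dots> = ?I1 + ?I1 + (\<integral>\<^sup>+y. \<psi>2 y * ennreal (Q y) \<partial>M2) + (\<integral>\<^sup>+y. \<psi>2 y * ennreal (P y) \<partial>M2)"
        by (simp add: nn_integral_add a b c)
      also have "\<dots> = 2 * ?I1 + (\<integral>\<^sup>+y. \<psi>2 y * ennreal \<bar>f1 y - f2 y\<bar> \<partial>M2)"
        unfolding d[symmetric] by (simp add: mult_2 add.assoc)
      finally show "(\<integral>\<^sup>+(x, y). (\<psi>1 x + \<psi>2 y) * ennreal \<bar>k' x y * f2 y - k x y * f1 y\<bar> \<partial>MM)
        \<le> 2 * (\<integral>\<^sup>+(x, y). \<psi>1 x * ennreal (k x y * max 0 (f1 y - f2 y)) \<partial>MM)
        + (\<integral>\<^sup>+y. \<psi>2 y * ennreal \<bar>f1 y - f2 y\<bar> \<partial>M2)" by (simp add: P_def)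
    qed
  qed
qed

section \<open>Schroedinger potentials\<close>

text \<open>Density of the second marginal of exp (a + b - c) relative to its reference measure. The
  integrated factor \<open>N\<close> is a parameter, so the first marginal is the same function with
  the roles exchanged.\<close>

definition marg :: "'a measure \<Rightarrow> ('a \<Rightarrow> 'b \<Rightarrow> real) \<Rightarrow> ('a \<Rightarrow> real) \<Rightarrow> ('b \<Rightarrow> real) \<Rightarrow> 'b \<Rightarrow> real" where
  "marg N c a b y = (\<integral>x. exp (a x + b y - c x y) \<partial>N)"

lemma marg_nonneg: "0 \<le> marg N c a b y"
  unfolding marg_def by (rule integral_nonneg_AE) simp

text \<open>The weights \<open>\<phi>1\<close>, \<open>\<phi>2\<close> stand for p-th powers of
  distances to base points. Nothing topological enters, so the locale is stable under exchanging the
  factors and each half step has to be studied for one parity only. A bounded cost is the case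
  \<open>B1 = 0\<close>.\<close>

locale cost_space = pair_prob_space M1 M2 for M1 :: "'a measure" and M2 :: "'b measure" +
  fixes c :: "'a \<Rightarrow> 'b \<Rightarrow> real" and \<phi>1 :: "'a \<Rightarrow> real" and \<phi>2 :: "'b \<Rightarrow> real" and \<alpha> B0 B1 :: real
  assumes c_meas[measurable]: "case_prod c \<in> borel_measurable MM"
    and c_nonneg: "0 \<le> c x y"
    and c_le: "c x y \<le> B0 + B1 * (\<phi>1 x + \<phi>2 y)"
    and B_nonneg: "0 \<le> B0" "0 \<le> B1"
    and \<phi>1_meas[measurable]: "\<phi>1 \<in> borel_measurable M1" and \<phi>2_meas[measurable]: "\<phi>2 \<in> borel_measurable M2"
    and \<phi>1_nonneg: "0 \<le> \<phi>1 x" and \<phi>2_nonneg: "0 \<le> \<phi>2 y"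
    and \<alpha>_pos: "0 < \<alpha>"
    and exp1: "integrable M1 (\<lambda>x. exp (\<alpha> * \<phi>1 x))" and exp2: "integrable M2 (\<lambda>y. exp (\<alpha> * \<phi>2 y))"

lemma (in cost_space) cost_space_swap: "cost_space M2 M1 (\<lambda>y x. c x y) \<phi>2 \<phi>1 \<alpha> B0 B1"
proof -
  interpret Q: pair_prob_space M2 M1 ..
  show ?thesis
  proof unfold_locales
    show "(\<lambda>(y, x). c x y) \<in> borel_measurable (M2 \<Otimes>\<^sub>M M1)"
      using measurable_pair_swap[OF c_meas] by (simp add: case_prod_beta')
    show "c x y \<le> B0 + B1 * (\<phi>2 y + \<phi>1 x)" for y x using c_le[of x y] by (simp add: add.commute)
  qed (use c_nonneg B_nonneg \<phi>1_nonneg \<phi>2_nonneg \<alpha>_pos exp1 exp2 in auto)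
qed

lemma (in pair_sigma_finite) nn_integral_swap:
  assumes f: "case_prod f \<in> borel_measurable MM"
  shows "(\<integral>\<^sup>+(y, x). f x y \<partial>(M2 \<Otimes>\<^sub>M M1)) = (\<integral>\<^sup>+(x, y). f x y \<partial>MM)"
proof -
  interpret Q: pair_sigma_finite M2 M1 ..
  have "case_prod (\<lambda>y x. f x y) \<in> borel_measurable (M2 \<Otimes>\<^sub>M M1)"
    using measurable_pair_swap[OF f] by (simp add: case_prod_beta')
  from M1.nn_integral_fst[OF this] show ?thesis using nn_integral_snd[OF f] by simp
qed

context cost_space
begin

definition rho :: "('a \<Rightarrow> real) \<Rightarrow> ('b \<Rightarrow> real) \<Rightarrow> 'a \<Rightarrow> 'b \<Rightarrow> real" where
  "rho a b x y = exp (a x + b y - c x y)"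

text \<open>The one-sided growth bounds on the potentials serve to integrate a potential against the
  unmatched marginal of the iterate; their constants may vary with the iterate.\<close>

definition good :: "('a \<Rightarrow> real) \<Rightarrow> ('b \<Rightarrow> real) \<Rightarrow> bool" where
  "good a b \<longleftrightarrow> integrable M1 a \<and> integrable M2 b
    \<and> (\<exists>A. AE x in M1. a x \<le> A * (1 + \<phi>1 x)) \<and> (\<exists>A. AE y in M2. b y \<le> A * (1 + \<phi>2 y))
    \<and> (\<integral>\<^sup>+(x, y). ennreal (rho a b x y) \<partial>MM) = 1"

lemma rho_meas[measurable]:
  assumes [measurable]: "a \<in> borel_measurable M1" "b \<in> borel_measurable M2"
  shows "case_prod (rho a b) \<in> borel_measurable MM"
  unfolding rho_def[abs_def] by measurable

lemma marg_meas[measurable]: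
  assumes [measurable]: "a \<in> borel_measurable M1" "b \<in> borel_measurable M2"
  shows "marg M1 c a b \<in> borel_measurable M2"
proof -
  have "case_prod (\<lambda>y x. rho a b x y) \<in> borel_measurable (M2 \<Otimes>\<^sub>M M1)"
    using measurable_pair_swap[OF rho_meas[OF assms]] by (simp add: case_prod_beta')
  from M1.borel_measurable_lebesgue_integral[OF this] show ?thesis
    by (simp add: marg_def[abs_def] rho_def)
qed

lemma rho_pos: "0 < rho a b x y" by (simp add: rho_def)

lemma goodD:
  assumes "good a b"
  shows "integrable M1 a" "integrable M2 b" "a \<in> borel_measurable M1" "b \<in> borel_measurable M2"
    "(\<integral>\<^sup>+(x, y). ennreal (rho a b x y) \<partial>MM) = 1"
  using assms by (auto simp: good_def)

lemma \<phi>1_integrable: "integrable M1 \<phi>1"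
proof (rule Bochner_Integration.integrable_bound)
  show "integrable M1 (\<lambda>x. exp (\<alpha> * \<phi>1 x) / \<alpha>)" using exp1 by simp
  show "AE x in M1. norm (\<phi>1 x) \<le> norm (exp (\<alpha> * \<phi>1 x) / \<alpha>)"
  proof (rule AE_I2)
    fix x
    show "norm (\<phi>1 x) \<le> norm (exp (\<alpha> * \<phi>1 x) / \<alpha>)"
    proof -
      have "\<alpha> * \<phi>1 x \<le> exp (\<alpha> * \<phi>1 x)" using exp_ge_add_one_self[of "\<alpha> * \<phi>1 x"] by linarith
      then show ?thesis using \<phi>1_nonneg[of x] \<alpha>_pos by (simp add: field_simps)
    qed
  qed
qed simp

lemma \<phi>2_integrable: "integrable M2 \<phi>2"
  using cost_space.\<phi>1_integrable[OF cost_space_swap] .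

lemma c_norm_le: "norm (c x y) \<le> norm (B0 + B1 * (\<phi>1 x + \<phi>2 y))"
  using c_nonneg[of x y] c_le[of x y] unfolding real_norm_def by linarith

lemma c_integrable_fst: "y \<in> space M2 \<Longrightarrow> integrable M1 (\<lambda>x. c x y)"
  by (rule Bochner_Integration.integrable_bound[where f = "\<lambda>x. B0 + B1 * (\<phi>1 x + \<phi>2 y)", OF _ _ AE_I2[OF c_norm_le]])
     (use \<phi>1_integrable in simp_all)

lemma c_integral_fst_le:
  assumes y: "y \<in> space M2"
  shows "(\<integral>x. c x y \<partial>M1) \<le> B0 + B1 * ((\<integral>x. \<phi>1 x \<partial>M1) + \<phi>2 y)"
proof -
  have "(\<integral>x. c x y \<partial>M1) \<le> (\<integral>x. B0 + B1 * (\<phi>1 x + \<phi>2 y) \<partial>M1)"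
    using c_integrable_fst[OF y] \<phi>1_integrable c_le by (intro integral_mono) auto
  also have "\<dots> = B0 + B1 * ((\<integral>x. \<phi>1 x \<partial>M1) + \<phi>2 y)"
    using \<phi>1_integrable by (simp add: M1.prob_space algebra_simps)
  finally show ?thesis .
qed

lemma integrable_fst_fun:
  fixes g :: "'a \<Rightarrow> real"
  assumes g: "integrable M1 g"
  shows "integrable MM (\<lambda>(x, y). g x)" "(\<integral>(x, y). g x \<partial>MM) = (\<integral>x. g x \<partial>M1)"
proof -
  have *: "(\<lambda>(x, y). 1 :: real) \<in> borel_measurable MM" "g \<in> borel_measurable M1"
    "AE x in M1. (\<integral>\<^sup>+y. ennreal 1 \<partial>M2) = ennreal 1" "integrable M1 (\<lambda>x. 1 * g x)"
    using g by (simp_all add: M2.emeasure_space_1)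
  show "integrable MM (\<lambda>(x, y). g x)" "(\<integral>(x, y). g x \<partial>MM) = (\<integral>x. g x \<partial>M1)"
    using integrable_marginal_fst[OF *(1,2) _ _ *(3,4)] integral_marginal_fst[OF *(1,2) _ _ *(3,4)] by simp_all
qed

lemma integrable_snd_fun:
  fixes g :: "'b \<Rightarrow> real"
  assumes g: "integrable M2 g"
  shows "integrable MM (\<lambda>(x, y). g y)" "(\<integral>(x, y). g y \<partial>MM) = (\<integral>y. g y \<partial>M2)"
proof -
  have *: "(\<lambda>(x, y). 1 :: real) \<in> borel_measurable MM" "g \<in> borel_measurable M2"
    "AE y in M2. (\<integral>\<^sup>+x. ennreal 1 \<partial>M1) = ennreal 1" "integrable M2 (\<lambda>y. 1 * g y)"
    using g by (simp_all add: M1.emeasure_space_1)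
  show "integrable MM (\<lambda>(x, y). g y)" "(\<integral>(x, y). g y \<partial>MM) = (\<integral>y. g y \<partial>M2)"
    using integrable_marginal_snd[OF *(1,2) _ _ *(3,4)] integral_marginal_snd[OF *(1,2) _ _ *(3,4)] by simp_all
qed

lemma c_integrable: "integrable MM (\<lambda>(x, y). c x y)"
proof (rule Bochner_Integration.integrable_bound)
  show "integrable MM (\<lambda>z. B0 + B1 * ((case z of (x, y) \<Rightarrow> \<phi>1 x) + (case z of (x, y) \<Rightarrow> \<phi>2 y)))"
    using integrable_fst_fun(1)[OF \<phi>1_integrable] integrable_snd_fun(1)[OF \<phi>2_integrable] by auto
  show "AE z in MM. norm (case z of (x, y) \<Rightarrow> c x y)
      \<le> norm (B0 + B1 * ((case z of (x, y) \<Rightarrow> \<phi>1 x) + (case z of (x, y) \<Rightarrow> \<phi>2 y)))"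
    by (rule AE_I2) (simp only: case_prod_beta' c_norm_le)
qed simp

lemma good_swap:
  assumes "good a b"
  shows "cost_space.good M2 M1 (\<lambda>y x. c x y) \<phi>2 \<phi>1 b a"
proof -
  interpret S: cost_space M2 M1 "\<lambda>y x. c x y" \<phi>2 \<phi>1 \<alpha> B0 B1 by (rule cost_space_swap)
  note [measurable] = goodD(3,4)[OF assms]
  have "(\<integral>\<^sup>+(y, x). ennreal (S.rho b a y x) \<partial>(M2 \<Otimes>\<^sub>M M1)) = (\<integral>\<^sup>+(y, x). ennreal (rho a b x y) \<partial>(M2 \<Otimes>\<^sub>M M1))"
    by (simp add: rho_def S.rho_def add.commute)
  also have "\<dots> = (\<integral>\<^sup>+(x, y). ennreal (rho a b x y) \<partial>MM)"
    by (rule nn_integral_swap) simp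
  finally show ?thesis using assms unfolding good_def S.good_def by simp
qed

text \<open>Weak duality: integrate \<open>1 + z \<le> exp z\<close> at z = a + b - c, where the
  exponential has total mass one.\<close>

lemma sum_potentials_le:
  assumes g: "good a b"
  shows "(\<integral>x. a x \<partial>M1) + (\<integral>y. b y \<partial>M2) \<le> (\<integral>(x, y). c x y \<partial>MM)"
proof -
  note [measurable] = goodD(3,4)[OF g]
  have i: "integrable MM (case_prod (rho a b))"
    using goodD(5)[OF g] by (intro integrableI_bounded) (auto simp: case_prod_beta' rho_def)
  have I: "integral\<^sup>L MM (case_prod (rho a b)) = 1"
    using goodD(5)[OF g] by (subst integral_eq_nn_integral) (auto simp: case_prod_beta' rho_def)
  note ia = integrable_fst_fun[OF goodD(1)[OF g]] and ib = integrable_snd_fun[OF goodD(2)[OF g]]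
  have "(\<integral>z. (case z of (x, y) \<Rightarrow> a x) + (case z of (x, y) \<Rightarrow> b y) - (case z of (x, y) \<Rightarrow> c x y) \<partial>MM)
      \<le> (\<integral>z. case_prod (rho a b) z - 1 \<partial>MM)"
  proof (rule integral_mono)
    fix z :: "'a \<times> 'b"
    show "(case z of (x, y) \<Rightarrow> a x) + (case z of (x, y) \<Rightarrow> b y) - (case z of (x, y) \<Rightarrow> c x y) \<le> case_prod (rho a b) z - 1"
      using exp_ge_add_one_self[of "a (fst z) + b (snd z) - c (fst z) (snd z)"]
      unfolding rho_def case_prod_beta' by linarith
  qed (use i ia(1) ib(1) c_integrable in auto)
  also have "\<dots> = 0" using i I prob_space by simp
  finally show ?thesis using ia ib c_integrable by simp
qed

text \<open>The last claim is Jensen's inequality for the logarithm in \<open>x\<close>, combined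
  with the growth of \<open>c\<close>. It makes the marginal positive and bounds its logarithm below
  by \<open>b y\<close> minus a multiple of the weight, which is what keeps all later logarithms
  integrable.\<close>

lemma marg_basic:
  assumes g: "good a b"
  shows "AE y in M2. integrable M1 (\<lambda>x. rho a b x y)"
    and "AE y in M2. margin2 (rho a b) y = ennreal (marg M1 c a b y)"
    and "integrable M2 (marg M1 c a b)" and "(\<integral>y. marg M1 c a b y \<partial>M2) = 1"
    and "AE y in M2. 0 < marg M1 c a b y \<and>
      (\<integral>x. a x \<partial>M1) + b y - (B0 + B1 * ((\<integral>x. \<phi>1 x \<partial>M1) + \<phi>2 y)) \<le> ln (marg M1 c a b y)"
proof -
  note [measurable] = goodD(3,4)[OF g]
  have i: "integrable MM (case_prod (rho a b))"
    using goodD(5)[OF g] by (intro integrableI_bounded) (auto simp: case_prod_beta' rho_def)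
  have I: "integral\<^sup>L MM (case_prod (rho a b)) = 1"
    using goodD(5)[OF g] by (subst integral_eq_nn_integral) (auto simp: case_prod_beta' rho_def)
  show 1: "AE y in M2. integrable M1 (\<lambda>x. rho a b x y)" by (rule AE_integrable_snd[OF i])
  show "integrable M2 (marg M1 c a b)"
    using integrable_snd[OF i] by (simp add: marg_def[abs_def] rho_def)
  show "(\<integral>y. marg M1 c a b y \<partial>M2) = 1"
    using integral_snd[OF i] I by (simp add: marg_def[abs_def] rho_def)
  show "AE y in M2. margin2 (rho a b) y = ennreal (marg M1 c a b y)"
    using 1 by eventually_elim (subst nn_integral_eq_integral, auto simp: rho_def marg_def)
  show "AE y in M2. 0 < marg M1 c a b y \<and>
      (\<integral>x. a x \<partial>M1) + b y - (B0 + B1 * ((\<integral>x. \<phi>1 x \<partial>M1) + \<phi>2 y)) \<le> ln (marg M1 c a b y)"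
    using 1 AE_space
  proof eventually_elim
    case (elim y)
    have il: "integrable M1 (\<lambda>x. a x + b y - c x y)"
      using goodD(1)[OF g] c_integrable_fst[OF elim(2)] by auto
    have m: "marg M1 c a b y = (\<integral>x. 1 * rho a b x y \<partial>M1)" by (simp add: marg_def rho_def)
    have J: "0 < (\<integral>x. 1 * rho a b x y \<partial>M1)" "(\<integral>x. 1 * ln (rho a b x y) \<partial>M1) \<le> ln (\<integral>x. 1 * rho a b x y \<partial>M1)"
      by (rule jensen_ln; use elim il M1.prob_space in \<open>simp add: rho_def\<close>)+
    have "(\<integral>x. 1 * ln (rho a b x y) \<partial>M1) = (\<integral>x. a x \<partial>M1) + b y - (\<integral>x. c x y \<partial>M1)"
      using goodD(1)[OF g] c_integrable_fst[OF elim(2)] by (simp add: rho_def M1.prob_space)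
    then show ?case using J c_integral_fst_le[OF elim(2)] unfolding m by linarith
  qed
qed

text \<open>The logarithm lies between the Jensen lower bound and
  \<open>marg M1 c a b y - 1\<close>; integrating the upper bound gives the sign of the
  entropy.\<close>

lemma marg_ln_integrable:
  assumes g: "good a b"
  shows "integrable M2 (\<lambda>y. ln (marg M1 c a b y))" "0 \<le> (\<integral>y. - ln (marg M1 c a b y) \<partial>M2)"
proof -
  note [measurable] = goodD(3,4)[OF g]
  let ?f = "marg M1 c a b"
  let ?l = "\<lambda>y. (\<integral>x. a x \<partial>M1) + b y - (B0 + B1 * ((\<integral>x. \<phi>1 x \<partial>M1) + \<phi>2 y))"
  show i: "integrable M2 (\<lambda>y. ln (?f y))"
  proof (rule Bochner_Integration.integrable_bound)
    show "integrable M2 (\<lambda>y. \<bar>?f y\<bar> + \<bar>?l y\<bar>)"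
      using marg_basic(3)[OF g] goodD(2)[OF g] \<phi>2_integrable by auto
    show "AE y in M2. norm (ln (?f y)) \<le> norm (\<bar>?f y\<bar> + \<bar>?l y\<bar>)"
      using marg_basic(5)[OF g]
    proof eventually_elim
      case (elim y)
      then show ?case using ln_le_minus_one[of "?f y"] by (auto simp: abs_real_def)
    qed
  qed simp
  have "(\<integral>y. ln (?f y) \<partial>M2) \<le> (\<integral>y. ?f y - 1 \<partial>M2)"
  proof (rule integral_mono_AE)
    show "AE y in M2. ln (?f y) \<le> ?f y - 1"
      using marg_basic(5)[OF g] by eventually_elim (simp add: ln_le_minus_one)
  qed (use i marg_basic(3)[OF g] in auto)
  also have "\<dots> = 0" using marg_basic(3,4)[OF g] M2.prob_space by simp
  finally show "0 \<le> (\<integral>y. - ln (?f y) \<partial>M2)" by simp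
qed

text \<open>One half step: normalising the second marginal subtracts the logarithm of its density
  from \<open>b\<close>, and the dual value grows by the entropy in the third claim.\<close>

lemma good_step:
  assumes g: "good a b"
  defines "b' \<equiv> \<lambda>y. b y - ln (marg M1 c a b y)"
  shows "good a b'" "AE y in M2. (\<integral>\<^sup>+x. ennreal (rho a b' x y) \<partial>M1) = 1"
    "(\<integral>y. b' y \<partial>M2) = (\<integral>y. b y \<partial>M2) + (\<integral>y. - ln (marg M1 c a b y) \<partial>M2)"
    "AE y in M2. \<forall>x. rho a b' x y = rho a b x y / marg M1 c a b y"
proof -
  note [measurable] = goodD(3,4)[OF g]
  have [measurable]: "b' \<in> borel_measurable M2" unfolding b'_def by measurable
  show r: "AE y in M2. \<forall>x. rho a b' x y = rho a b x y / marg M1 c a b y"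
    using marg_basic(5)[OF g]
  proof eventually_elim
    case (elim y)
    show ?case
    proof
      fix x
      have "rho a b' x y = exp (a x + b y - c x y - ln (marg M1 c a b y))"
        by (simp add: rho_def b'_def algebra_simps)
      then show "rho a b' x y = rho a b x y / marg M1 c a b y"
        using elim by (simp add: exp_diff rho_def)
    qed
  qed
  show m: "AE y in M2. (\<integral>\<^sup>+x. ennreal (rho a b' x y) \<partial>M1) = 1"
    using r marg_basic(2,5)[OF g] AE_space
  proof eventually_elim
    case (elim y)
    let ?f = "marg M1 c a b y"
    have "(\<integral>\<^sup>+x. ennreal (rho a b' x y) \<partial>M1) = (\<integral>\<^sup>+x. ennreal (1 / ?f) * ennreal (rho a b x y) \<partial>M1)"
      using elim by (intro nn_integral_cong) (auto simp: rho_pos less_imp_le simp flip: ennreal_mult)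
    also have "\<dots> = ennreal (1 / ?f) * ennreal ?f"
      using elim by (subst nn_integral_cmult) (auto simp: rho_def)
    also have "\<dots> = 1" using elim by (simp flip: ennreal_mult)
    finally show ?case .
  qed
  have i: "integrable M2 b'" unfolding b'_def using goodD(2)[OF g] marg_ln_integrable[OF g] by auto
  show "(\<integral>y. b' y \<partial>M2) = (\<integral>y. b y \<partial>M2) + (\<integral>y. - ln (marg M1 c a b y) \<partial>M2)"
    unfolding b'_def using goodD(2)[OF g] marg_ln_integrable[OF g] by simp
  have "(\<integral>\<^sup>+(x, y). ennreal (rho a b' x y) \<partial>MM) = (\<integral>\<^sup>+y. \<integral>\<^sup>+x. ennreal (rho a b' x y) \<partial>M1 \<partial>M2)"
    by (subst nn_integral_snd[symmetric]) auto
  also have "\<dots> = (\<integral>\<^sup>+y. 1 \<partial>M2)" by (rule nn_integral_cong_AE[OF m])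
  finally have one: "(\<integral>\<^sup>+(x, y). ennreal (rho a b' x y) \<partial>MM) = 1"
    by (simp add: M2.emeasure_space_1)
  \<comment> \<open>In \<open>b'\<close> the old \<open>b\<close> cancels against the Jensen lower
    bound for the logarithm, so the new growth constant depends on \<open>a\<close> only through its
    integral.\<close>
  let ?A = "max B1 \<bar>B0 + B1 * (\<integral>x. \<phi>1 x \<partial>M1) - (\<integral>x. a x \<partial>M1)\<bar>"
  have "AE y in M2. b' y \<le> ?A * (1 + \<phi>2 y)"
    using marg_basic(5)[OF g]
  proof eventually_elim
    case (elim y)
    have "b' y \<le> (B0 + B1 * (\<integral>x. \<phi>1 x \<partial>M1) - (\<integral>x. a x \<partial>M1)) + B1 * \<phi>2 y"
      using elim by (simp add: b'_def algebra_simps)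
    also have "\<dots> \<le> ?A + ?A * \<phi>2 y"
      by (intro add_mono mult_right_mono \<phi>2_nonneg) auto
    finally show ?case by (simp add: algebra_simps)
  qed
  then show "good a b'" using g one i unfolding good_def by auto
qed

text \<open>Both bounds are data processing for the projection to the first factor, applied to the iterates
  before and after the half step.\<close>

lemma marg_entropy_decrease:
  assumes g: "good a b" and mx: "AE x in M1. margin1 (rho a b) x = 1"
  defines "f \<equiv> marg M1 c a b"
  defines "b' \<equiv> \<lambda>y. b y - ln (f y)"
  defines "f' \<equiv> marg M2 (\<lambda>y x. c x y) b' a"
  shows "integrable M1 (\<lambda>x. f' x * ln (f' x))"
    and "(\<integral>x. f' x * ln (f' x) \<partial>M1) \<le> (\<integral>y. - ln (f y) \<partial>M2)"
    and "integrable M2 (\<lambda>y. f y * ln (f y)) \<Longrightarrow> (\<integral>x. - ln (f' x) \<partial>M1) \<le> (\<integral>y. f y * ln (f y) \<partial>M2)"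
proof -
  interpret S: cost_space M2 M1 "\<lambda>y x. c x y" \<phi>2 \<phi>1 \<alpha> B0 B1 by (rule cost_space_swap)
  note [measurable] = goodD(3,4)[OF g]
  have g': "good a b'" unfolding b'_def f_def by (rule good_step(1)[OF g])
  have Sg': "S.good b' a" by (rule good_swap[OF g'])
  note [measurable] = goodD(3,4)[OF g']
  have [measurable]: "f \<in> borel_measurable M2" unfolding f_def by measurable
  have [measurable]: "f' \<in> borel_measurable M1" unfolding f'_def by (rule S.marg_meas) measurable
  have f0: "0 \<le> f y" for y by (simp add: f_def marg_nonneg)
  have fpos: "AE y in M2. 0 < f y" using marg_basic(5)[OF g] by (auto simp: f_def)
  have rb': "AE y in M2. \<forall>x. rho a b' x y = rho a b x y / f y"
    unfolding b'_def f_def by (rule good_step(4)[OF g])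
  have my': "AE y in M2. (\<integral>\<^sup>+x. ennreal (rho a b' x y) \<partial>M1) = ennreal 1"
    unfolding b'_def f_def using good_step(2)[OF g] by simp
  have Srho: "S.rho b' a y x = rho a b' x y" for x y by (simp add: rho_def S.rho_def add.commute)
  have f': "f' x = (\<integral>y. rho a b' x y \<partial>M2)" for x
    by (simp add: f'_def marg_def rho_def add.commute)
  have ir': "AE x in M1. integrable M2 (\<lambda>y. rho a b' x y)"
    using S.marg_basic(1)[OF Sg'] by (simp add: Srho)
  have w: "AE x in M1. integrable M2 (\<lambda>y. rho a b x y) \<and> (\<integral>y. rho a b x y \<partial>M2) = 1"
    using mx AE_space
  proof eventually_elim
    case (elim x)
    then have [measurable]: "rho a b x \<in> borel_measurable M2" using rho_meas[of a b] by simp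
    have "integrable M2 (\<lambda>y. rho a b x y)"
      using elim by (intro integrableI_bounded) (auto simp: rho_def)
    moreover have "(\<integral>y. rho a b x y \<partial>M2) = 1"
      using elim by (subst integral_eq_nn_integral) (auto simp: rho_def)
    ultimately show ?case by simp
  qed
  \<comment> \<open>The first marginal is matched, so \<open>rho a b x\<close> is a probability
    density in \<open>y\<close>, and \<open>f' x\<close> is the mean of \<open>1 / f y\<close> under
    it. Jensen for \<open>t * ln t\<close> and for \<open>ln\<close> at this mean gives the two
    entropy bounds.\<close>
  have fx: "AE x in M1. f' x = (\<integral>y. rho a b x y * (1 / f y) \<partial>M2) \<and> integrable M2 (\<lambda>y. rho a b x y * (1 / f y))"
    using ir' AE_space
  proof eventually_elim
    case (elim x)
    then have [measurable]: "rho a b x \<in> borel_measurable M2" "rho a b' x \<in> borel_measurable M2"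
      using rho_meas[of a b] rho_meas[of a b'] by simp_all
    have e: "AE y in M2. rho a b' x y = rho a b x y * (1 / f y)" using rb' by eventually_elim simp
    have "f' x = (\<integral>y. rho a b x y * (1 / f y) \<partial>M2)"
      unfolding f' by (rule integral_cong_AE) (use e in auto)
    moreover have "integrable M2 (\<lambda>y. rho a b x y * (1 / f y))"
      by (rule integrable_cong_AE_imp[OF elim(1)]) (use e in auto)
    ultimately show ?case by simp
  qed
  have ilf: "integrable M2 (\<lambda>y. ln (f y))" unfolding f_def by (rule marg_ln_integrable[OF g])
  have i1: "integrable MM (\<lambda>(x, y). rho a b' x y * (- ln (f y)))"
    and I1: "(\<integral>(x, y). rho a b' x y * (- ln (f y)) \<partial>MM) = (\<integral>y. - ln (f y) \<partial>M2)"
    using integrable_marginal_snd[OF _ _ _ _ my', of "\<lambda>y. - ln (f y)"] integral_marginal_snd[OF _ _ _ _ my', of "\<lambda>y. - ln (f y)"] ilf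
    by (auto simp: rho_def)
  let ?U = "\<lambda>x. \<integral>y. rho a b' x y * (- ln (f y)) \<partial>M2"
  have iU: "integrable M1 ?U" and UI: "(\<integral>x. ?U x \<partial>M1) = (\<integral>y. - ln (f y) \<partial>M2)"
    using integrable_fst[OF i1] integral_fst[OF i1] I1 by auto
  have leU: "AE x in M1. f' x * ln (f' x) \<le> ?U x"
    using fx w AE_integrable_fst[OF i1] AE_space
  proof eventually_elim
    case (elim x)
    then have [measurable]: "rho a b x \<in> borel_measurable M2" "rho a b' x \<in> borel_measurable M2"
      using rho_meas[of a b] rho_meas[of a b'] by simp_all
    have e: "AE y in M2. rho a b' x y * (- ln (f y)) = rho a b x y * (1 / f y * ln (1 / f y))"
      using rb' fpos by eventually_elim (simp add: ln_div)
    have ie: "integrable M2 (\<lambda>y. rho a b x y * (1 / f y * ln (1 / f y)))"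
      by (rule integrable_cong_AE_imp[OF elim(3)]) (use e in auto)
    have "f' x * ln (f' x) \<le> (\<integral>y. rho a b x y * (1 / f y * ln (1 / f y)) \<partial>M2)"
      unfolding elim(1)[THEN conjunct1]
      by (rule jensen_xlnx) (use elim ie f0 in \<open>auto simp: rho_def\<close>)
    also have "\<dots> = ?U x" by (rule integral_cong_AE) (use e in auto)
    finally show ?case .
  qed
  have f'0: "0 \<le> f' x" for x by (simp add: f'_def marg_nonneg)
  show i: "integrable M1 (\<lambda>x. f' x * ln (f' x))"
  proof (rule Bochner_Integration.integrable_bound)
    show "integrable M1 (\<lambda>x. \<bar>?U x\<bar> + 1)" using iU by auto
    show "AE x in M1. norm (f' x * ln (f' x)) \<le> norm (\<bar>?U x\<bar> + 1)"
      using leU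
    proof eventually_elim
      case (elim x)
      have "- 1 \<le> f' x * ln (f' x)" using xlnx_ge[OF f'0[of x]] f'0[of x] by linarith
      with elim show ?case unfolding real_norm_def by linarith
    qed
  qed simp
  show "(\<integral>x. f' x * ln (f' x) \<partial>M1) \<le> (\<integral>y. - ln (f y) \<partial>M2)"
    unfolding UI[symmetric] by (rule integral_mono_AE[OF i iU leU])
  show "(\<integral>x. - ln (f' x) \<partial>M1) \<le> (\<integral>y. f y * ln (f y) \<partial>M2)" if ent: "integrable M2 (\<lambda>y. f y * ln (f y))"
  proof -
    have my: "AE y in M2. margin2 (rho a b) y = ennreal (f y)"
      unfolding f_def by (rule marg_basic(2)[OF g])
    have i2: "integrable MM (\<lambda>(x, y). rho a b x y * ln (f y))"
      and I2: "(\<integral>(x, y). rho a b x y * ln (f y) \<partial>MM) = (\<integral>y. f y * ln (f y) \<partial>M2)"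
      using integrable_marginal_snd[OF _ _ _ f0 my, of "\<lambda>y. ln (f y)"] integral_marginal_snd[OF _ _ _ f0 my, of "\<lambda>y. ln (f y)"] ent
      by (auto simp: rho_def)
    let ?V = "\<lambda>x. \<integral>y. rho a b x y * ln (f y) \<partial>M2"
    have iV: "integrable M1 ?V" and VI: "(\<integral>x. ?V x \<partial>M1) = (\<integral>y. f y * ln (f y) \<partial>M2)"
      using integrable_fst[OF i2] integral_fst[OF i2] I2 by auto
    have "AE x in M1. - ln (f' x) \<le> ?V x"
      using fx w AE_integrable_fst[OF i2] AE_space
    proof eventually_elim
      case (elim x)
      then have [measurable]: "rho a b x \<in> borel_measurable M2" using rho_meas[of a b] by simp
      have e: "AE y in M2. rho a b x y * ln (f y) = - (rho a b x y * ln (1 / f y))"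
        using fpos by eventually_elim (simp add: ln_div)
      then have e': "AE y in M2. - (rho a b x y * ln (f y)) = rho a b x y * ln (1 / f y)"
        by eventually_elim simp
      have i3: "integrable M2 (\<lambda>y. rho a b x y * ln (1 / f y))"
        by (rule integrable_cong_AE_imp[OF Bochner_Integration.integrable_minus[OF elim(3)]]) (use e' in auto)
      have "(\<integral>y. rho a b x y * ln (1 / f y) \<partial>M2) \<le> ln (f' x)"
        unfolding elim(1)[THEN conjunct1]
        by (rule jensen_ln(2)) (use elim i3 fpos in \<open>auto simp: rho_def\<close>)
      moreover have "?V x = (\<integral>y. - (rho a b x y * ln (1 / f y)) \<partial>M2)"
        by (rule integral_cong_AE) (use e in auto)
      ultimately show ?case by simp
    qed
    moreover have "integrable M1 (\<lambda>x. - ln (f' x))"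
      unfolding f'_def using S.marg_ln_integrable(1)[OF Sg'] by simp
    ultimately show ?thesis unfolding VI[symmetric] using iV by (intro integral_mono_AE) auto
  qed
qed

end

text \<open>Chaining the hypotheses gives monotonicity of \<open>A\<close> only over two steps. Sums
  of neighbouring terms therefore decrease, and a decreasing summable sequence is O(1/n).\<close>

lemma alternating_decrease_rate:
  fixes A B :: "nat \<Rightarrow> real"
  assumes A0: "\<And>n. 0 \<le> A n"
    and AB: "\<And>n. 2 \<le> n \<Longrightarrow> A (Suc n) \<le> B n" and BA: "\<And>n. 1 \<le> n \<Longrightarrow> B (Suc n) \<le> A n"
    and S: "\<And>n. (\<Sum>k<n. A k) \<le> C" and n: "2 \<le> n"
  shows "B n \<le> 4 * C / real n"
proof -
  define s where "s k = A k + A (Suc k)" for k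
  have step: "s (Suc k) \<le> s k" if "1 \<le> k" for k
    using AB[of "Suc k"] BA[of k] that by (simp add: s_def)
  have mono: "s n \<le> s k" if "1 \<le> k" "k \<le> n" for k n
    using that(2)
  proof (induction rule: dec_induct)
    case (step m)
    then show ?case using \<open>\<And>k. 1 \<le> k \<Longrightarrow> s (Suc k) \<le> s k\<close>[of m] that(1) by linarith
  qed simp
  have sum: "(\<Sum>k<n. s k) \<le> 2 * C" for n
  proof -
    have "(\<Sum>k<n. A (Suc k)) \<le> (\<Sum>k<Suc n. A k)"
      unfolding sum.lessThan_Suc_shift using A0[of 0] by simp
    then show ?thesis using S[of n] S[of "Suc n"] by (simp add: s_def sum.distrib)
  qed
  obtain m where m: "n = Suc m" "1 \<le> m" using n by (cases n) auto
  have "real m * s m = (\<Sum>k\<in>{1..m}. s m)" by simp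
  also have "\<dots> \<le> (\<Sum>k\<in>{1..m}. s k)" by (intro sum_mono mono) auto
  also have "\<dots> \<le> (\<Sum>k<Suc m. s k)"
    by (intro sum_mono2) (use A0 in \<open>auto simp: s_def\<close>)
  also have "\<dots> \<le> 2 * C" by (rule sum)
  finally have "real m * s m \<le> 2 * C" .
  moreover have "real m * A m \<le> real m * s m" using A0 by (intro mult_left_mono) (auto simp: s_def)
  ultimately have mA: "real m * A m \<le> 2 * C" by linarith
  have "real n * B n \<le> real n * A m" using BA[of m] m by (intro mult_left_mono) auto
  \<comment> \<open>Here n = m + 1 is at most 2 m because \<open>m\<close> is positive; with the
    factor 2 from the paired sums this makes the 4.\<close>
  also have "\<dots> \<le> (2 * real m) * A m" using m A0 by (intro mult_right_mono) auto
  also have "\<dots> = 2 * (real m * A m)" by simp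
  also have "\<dots> \<le> 4 * C" using mA by linarith
  finally show ?thesis using n by (simp add: field_simps)
qed

section \<open>The iteration on potentials and the entropy rate\<close>

context cost_space
begin

abbreviation "margX a b \<equiv> marg M2 (\<lambda>y x. c x y) b a"
abbreviation "margY a b \<equiv> marg M1 c a b"

text \<open>The normalising constant of the initial Gibbs measure is put into the second potential.
  An even \<open>n\<close> corrects the first potential because it leads to an odd iterate, which
  matches the first marginal.\<close>

primrec pots :: "nat \<Rightarrow> ('a \<Rightarrow> real) \<times> ('b \<Rightarrow> real)" where
  "pots 0 = ((\<lambda>_. 0), (\<lambda>_. - ln (\<integral>(x, y). exp (- c x y) \<partial>MM)))"
| "pots (Suc n) = (if even n
     then (\<lambda>x. fst (pots n) x - ln (margX (fst (pots n)) (snd (pots n)) x), snd (pots n))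
     else (fst (pots n), \<lambda>y. snd (pots n) y - ln (margY (fst (pots n)) (snd (pots n)) y)))"

abbreviation "pa n \<equiv> fst (pots n)"
abbreviation "pb n \<equiv> snd (pots n)"

lemma partition_function:
  "integrable MM (\<lambda>(x, y). exp (- c x y))"
  "0 < (\<integral>(x, y). exp (- c x y) \<partial>MM)" "(\<integral>(x, y). exp (- c x y) \<partial>MM) \<le> 1"
proof -
  show i: "integrable MM (\<lambda>(x, y). exp (- c x y))"
    by (rule integrable_const_bound[where B = 1]) (use c_nonneg in \<open>auto intro!: AE_I2\<close>)
  have "(\<integral>(x, y). exp (- c x y) \<partial>MM) \<le> (\<integral>z. 1 \<partial>MM)"
    by (rule integral_mono) (use i c_nonneg in auto)
  then show "(\<integral>(x, y). exp (- c x y) \<partial>MM) \<le> 1" using prob_space by simp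
  have "(\<integral>(x, y). exp (- c x y) \<partial>MM) \<noteq> 0"
  proof
    assume "(\<integral>(x, y). exp (- c x y) \<partial>MM) = 0"
    then have "AE z in MM. (case z of (x, y) \<Rightarrow> exp (- c x y)) = 0"
      by (subst (asm) integral_nonneg_eq_0_iff_AE) (use i in auto)
    then have "AE z in MM. False" by eventually_elim auto
    then show False by simp
  qed
  moreover have "0 \<le> (\<integral>(x, y). exp (- c x y) \<partial>MM)" by (rule integral_nonneg_AE) auto
  ultimately show "0 < (\<integral>(x, y). exp (- c x y) \<partial>MM)" by simp
qed

lemma good_swapD:
  assumes "cost_space.good M2 M1 (\<lambda>y x. c x y) \<phi>2 \<phi>1 b a"
  shows "good a b"
  using cost_space.good_swap[OF cost_space_swap assms] .

lemma rho_swap: "cost_space.rho (\<lambda>y x. c x y) b a y x = rho a b x y"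
  unfolding cost_space.rho_def[OF cost_space_swap] rho_def by (simp add: add.commute)

lemma good_step_fst:
  assumes g: "good a b"
  defines "a' \<equiv> \<lambda>x. a x - ln (margX a b x)"
  shows "good a' b" "AE x in M1. (\<integral>\<^sup>+y. ennreal (rho a' b x y) \<partial>M2) = 1"
    "(\<integral>x. a' x \<partial>M1) = (\<integral>x. a x \<partial>M1) + (\<integral>x. - ln (margX a b x) \<partial>M1)"
    "AE x in M1. \<forall>y. rho a' b x y = rho a b x y / margX a b x"
proof -
  interpret S: cost_space M2 M1 "\<lambda>y x. c x y" \<phi>2 \<phi>1 \<alpha> B0 B1 by (rule cost_space_swap)
  note * = S.good_step[OF good_swap[OF g], folded a'_def]
  show "good a' b" by (rule good_swapD[OF *(1)])
  show "AE x in M1. (\<integral>\<^sup>+y. ennreal (rho a' b x y) \<partial>M2) = 1" using *(2) by (simp add: rho_swap)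
  show "(\<integral>x. a' x \<partial>M1) = (\<integral>x. a x \<partial>M1) + (\<integral>x. - ln (margX a b x) \<partial>M1)" by (rule *(3))
  show "AE x in M1. \<forall>y. rho a' b x y = rho a b x y / margX a b x" using *(4) by (simp add: rho_swap)
qed

lemma good_pots: "good (pa n) (pb n)"
proof (induction n)
  case 0
  let ?Z = "\<integral>(x, y). exp (- c x y) \<partial>MM"
  have "(\<integral>\<^sup>+(x, y). ennreal (rho (\<lambda>_. 0) (\<lambda>_. - ln ?Z) x y) \<partial>MM)
      = (\<integral>\<^sup>+z. ennreal (1 / ?Z) * ennreal (case z of (x, y) \<Rightarrow> exp (- c x y)) \<partial>MM)"
    using partition_function(2)
    by (intro nn_integral_cong) (auto simp: rho_def exp_diff exp_minus field_simps simp flip: ennreal_mult)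
  also have "\<dots> = ennreal (1 / ?Z) * ennreal ?Z"
    by (subst nn_integral_cmult, measurable, subst nn_integral_eq_integral[OF partition_function(1)]) auto
  also have "\<dots> = 1" using partition_function(2) by (simp flip: ennreal_mult)
  finally have "(\<integral>\<^sup>+(x, y). ennreal (rho (\<lambda>_. 0) (\<lambda>_. - ln ?Z) x y) \<partial>MM) = 1" .
  moreover have "\<exists>A. AE x in M1. 0 \<le> A * (1 + \<phi>1 x)" by (rule exI[of _ 0]) simp
  moreover have "\<exists>A. AE y in M2. - ln ?Z \<le> A * (1 + \<phi>2 y)"
  proof (rule exI[of _ "\<bar>ln ?Z\<bar>"], rule AE_I2)
    fix y
    have "- ln ?Z \<le> \<bar>ln ?Z\<bar> * 1" by simp
    also have "\<dots> \<le> \<bar>ln ?Z\<bar> * (1 + \<phi>2 y)" using \<phi>2_nonneg[of y] by (intro mult_left_mono) auto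
    finally show "- ln ?Z \<le> \<bar>ln ?Z\<bar> * (1 + \<phi>2 y)" .
  qed
  ultimately show ?case unfolding good_def by simp
next
  case (Suc n)
  then show ?case using good_step(1)[OF Suc] good_step_fst(1)[OF Suc] by simp
qed

lemma pots_matched_fst:
  assumes "odd n"
  shows "AE x in M1. (\<integral>\<^sup>+y. ennreal (rho (pa n) (pb n) x y) \<partial>M2) = 1"
proof -
  obtain m where m: "n = Suc m" "even m" using assms by (cases n) auto
  show ?thesis using good_step_fst(2)[OF good_pots, of m] m by simp
qed

lemma pots_matched_snd:
  assumes "even n" "n \<noteq> 0"
  shows "AE y in M2. (\<integral>\<^sup>+x. ennreal (rho (pa n) (pb n) x y) \<partial>M1) = 1"
proof -
  obtain m where m: "n = Suc m" "odd m" using assms by (cases n) auto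
  show ?thesis using good_step(2)[OF good_pots, of m] m by simp
qed

text \<open>\<open>ent_rev\<close> is the entropy of the prescribed marginal relative to the current one, \<open>ent_fwd\<close> the reverse.\<close>

definition ent_rev :: "nat \<Rightarrow> real" where
  "ent_rev n = (if even n then \<integral>x. - ln (margX (pa n) (pb n) x) \<partial>M1 else \<integral>y. - ln (margY (pa n) (pb n) y) \<partial>M2)"

definition ent_fwd :: "nat \<Rightarrow> real" where
  "ent_fwd n = (if even n then \<integral>x. margX (pa n) (pb n) x * ln (margX (pa n) (pb n) x) \<partial>M1
     else \<integral>y. margY (pa n) (pb n) y * ln (margY (pa n) (pb n) y) \<partial>M2)"

text \<open>Recorded separately because a Bochner integral without integrability is 0, which would
  make a bound on \<open>ent_fwd\<close> empty.\<close>

definition ent_finite :: "nat \<Rightarrow> bool" where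
  "ent_finite n = (if even n then integrable M1 (\<lambda>x. margX (pa n) (pb n) x * ln (margX (pa n) (pb n) x))
     else integrable M2 (\<lambda>y. margY (pa n) (pb n) y * ln (margY (pa n) (pb n) y)))"

lemma ent_rev_nonneg: "0 \<le> ent_rev n"
  using marg_ln_integrable(2)[OF good_pots]
    cost_space.marg_ln_integrable(2)[OF cost_space_swap good_swap[OF good_pots]]
  by (simp add: ent_rev_def)

text \<open>Each half step moves the unmatched marginal to the other factor, so even
  \<open>n\<close> is the data processing lemma with exchanged factors. The iterate at 0 need not
  match either marginal, hence \<open>1 \<le> n\<close>.\<close>

lemma ent_step:
  assumes n: "1 \<le> n"
  shows "ent_finite (Suc n)" "ent_fwd (Suc n) \<le> ent_rev n"
    "ent_finite n \<Longrightarrow> ent_rev (Suc n) \<le> ent_fwd n"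
proof -
  interpret S: cost_space M2 M1 "\<lambda>y x. c x y" \<phi>2 \<phi>1 \<alpha> B0 B1 by (rule cost_space_swap)
  show "ent_finite (Suc n)" "ent_fwd (Suc n) \<le> ent_rev n"
    "ent_finite n \<Longrightarrow> ent_rev (Suc n) \<le> ent_fwd n"
  proof (atomize (full), cases "even n")
    case True
    then have "AE y in M2. (\<integral>\<^sup>+x. ennreal (S.rho (pb n) (pa n) y x) \<partial>M1) = 1"
      using pots_matched_snd n by (simp add: rho_swap)
    from S.marg_entropy_decrease[OF good_swap[OF good_pots] this]
    show "ent_finite (Suc n) \<and> ent_fwd (Suc n) \<le> ent_rev n \<and> (ent_finite n \<longrightarrow> ent_rev (Suc n) \<le> ent_fwd n)"
      using True by (simp add: ent_finite_def ent_fwd_def ent_rev_def)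
  next
    case False
    from marg_entropy_decrease[OF good_pots pots_matched_fst[OF False]]
    show "ent_finite (Suc n) \<and> ent_fwd (Suc n) \<le> ent_rev n \<and> (ent_finite n \<longrightarrow> ent_rev (Suc n) \<le> ent_fwd n)"
      using False by (simp add: ent_finite_def ent_fwd_def ent_rev_def)
  qed
qed

text \<open>The dual value telescopes: it starts at minus the logarithm of the partition function,
  which is nonnegative because \<open>c\<close> is, and never exceeds the integral of
  \<open>c\<close>.\<close>

lemma sum_ent_rev_le: "(\<Sum>k<n. ent_rev k) \<le> (\<integral>(x, y). c x y \<partial>MM)"
proof -
  have "(\<Sum>k<n. ent_rev k) \<le> (\<integral>x. pa n x \<partial>M1) + (\<integral>y. pb n y \<partial>M2)"
  proof (induction n)
    case 0
    have "0 \<le> - ln (\<integral>(x, y). exp (- c x y) \<partial>MM)"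
      using partition_function(2,3) by simp
    then show ?case by (simp add: M2.prob_space)
  next
    case (Suc n)
    then show ?case
      using good_step(3)[OF good_pots, of n] good_step_fst(3)[OF good_pots, of n]
      by (auto simp: ent_rev_def)
  qed
  then show ?thesis using sum_potentials_le[OF good_pots, of n] by linarith
qed

lemma ent_fwd_rate:
  assumes "2 \<le> n"
  shows "ent_finite n" "ent_fwd n \<le> 4 * (\<integral>(x, y). c x y \<partial>MM) / real n"
proof -
  have fin: "ent_finite n" if "2 \<le> n" for n
    using ent_step(1)[of "n - 1"] that by (cases n) auto
  show "ent_finite n" using fin assms .
  show "ent_fwd n \<le> 4 * (\<integral>(x, y). c x y \<partial>MM) / real n"
    by (rule alternating_decrease_rate[where A = ent_rev])
       (use ent_rev_nonneg ent_step fin sum_ent_rev_le assms in auto)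
qed

end

section \<open>Stability under perturbation of one marginal\<close>

context cost_space
begin

text \<open>Finite entropy is part of the notion, so that \<open>Fcost\<close> is the true free
  energy on this class.\<close>

definition coupling_density :: "('a \<Rightarrow> 'b \<Rightarrow> real) \<Rightarrow> bool" where
  "coupling_density s \<longleftrightarrow> case_prod s \<in> borel_measurable MM \<and> (\<forall>x y. 0 \<le> s x y)
    \<and> (AE x in M1. margin1 s x = 1) \<and> (AE y in M2. margin2 s y = 1)
    \<and> integrable MM (\<lambda>(x, y). s x y * ln (s x y))"

definition Fcost :: "('a \<Rightarrow> 'b \<Rightarrow> real) \<Rightarrow> real" where
  "Fcost s = (\<integral>(x, y). s x y * c x y \<partial>MM) + (\<integral>(x, y). s x y * ln (s x y) \<partial>MM)"

abbreviation "wtv r s \<equiv> \<integral>\<^sup>+(x, y). ennreal ((1 + (\<phi>1 x + \<phi>2 y)) * \<bar>r x y - s x y\<bar>) \<partial>MM"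

text \<open>The integrability clauses are what later identifies \<open>Fcost s\<close> with the
  extended-valued \<open>Fent\<close>.\<close>

abbreviation "rate_bound C \<sigma> n r s \<equiv>
  integrable MM (\<lambda>(x, y). s x y * c x y) \<and> integrable MM (\<lambda>(x, y). s x y * ln (s x y)) \<and>
  \<bar>Fcost r - Fcost s\<bar> \<le> C * real n powr (- \<sigma> / 2) \<and> wtv r s \<le> ennreal (C * real n powr (- \<sigma> / 4))"

definition optimal_density :: "('a \<Rightarrow> 'b \<Rightarrow> real) \<Rightarrow> bool" where
  "optimal_density r \<longleftrightarrow> coupling_density r \<and> (\<forall>s. coupling_density s \<longrightarrow> Fcost r \<le> Fcost s)"

lemma weighted_c_integrable:
  assumes [measurable]: "case_prod s \<in> borel_measurable MM" and s0: "\<And>x y. 0 \<le> s x y"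
    and i1: "integrable MM (\<lambda>(x, y). s x y * (1 + \<phi>1 x))"
    and i2: "integrable MM (\<lambda>(x, y). s x y * \<phi>2 y)"
  shows "integrable MM (\<lambda>(x, y). s x y * c x y)"
proof (rule Bochner_Integration.integrable_bound)
  show "integrable MM (\<lambda>z. (B0 + B1) * (case z of (x, y) \<Rightarrow> s x y * (1 + \<phi>1 x)) + B1 * (case z of (x, y) \<Rightarrow> s x y * \<phi>2 y))"
    using i1 i2 by auto
  show "AE z in MM. norm (case z of (x, y) \<Rightarrow> s x y * c x y)
      \<le> norm ((B0 + B1) * (case z of (x, y) \<Rightarrow> s x y * (1 + \<phi>1 x)) + B1 * (case z of (x, y) \<Rightarrow> s x y * \<phi>2 y))"
  proof (rule AE_I2)
    fix z :: "'a \<times> 'b"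
    obtain x y where z: "z = (x, y)" by (cases z)
    have "B0 + B1 * (\<phi>1 x + \<phi>2 y) \<le> (B0 + B1) * (1 + \<phi>1 x) + B1 * \<phi>2 y"
      using B_nonneg \<phi>1_nonneg[of x] by (simp add: algebra_simps)
    then have "c x y \<le> (B0 + B1) * (1 + \<phi>1 x) + B1 * \<phi>2 y" using c_le[of x y] by linarith
    then have "s x y * c x y \<le> s x y * ((B0 + B1) * (1 + \<phi>1 x) + B1 * \<phi>2 y)"
      using s0 by (intro mult_left_mono) auto
    also have "\<dots> = (B0 + B1) * (s x y * (1 + \<phi>1 x)) + B1 * (s x y * \<phi>2 y)" by (simp add: algebra_simps)
    finally have "s x y * c x y \<le> (B0 + B1) * (s x y * (1 + \<phi>1 x)) + B1 * (s x y * \<phi>2 y)" .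
    moreover have "0 \<le> s x y * c x y" using s0 c_nonneg by simp
    ultimately show "norm (case z of (x, y) \<Rightarrow> s x y * c x y)
      \<le> norm ((B0 + B1) * (case z of (x, y) \<Rightarrow> s x y * (1 + \<phi>1 x)) + B1 * (case z of (x, y) \<Rightarrow> s x y * \<phi>2 y))"
      unfolding z prod.case real_norm_def by linarith
  qed
qed simp

lemma coupling_c_integrable:
  assumes s: "coupling_density s"
  shows "integrable MM (\<lambda>(x, y). s x y * c x y)"
proof -
  have m: "case_prod s \<in> borel_measurable MM" and s0: "\<And>x y. 0 \<le> s x y"
    and 1: "AE x in M1. margin1 s x = ennreal 1"
    and 2: "AE y in M2. margin2 s y = ennreal 1"
    using s by (auto simp: coupling_density_def)
  show ?thesis
    by (rule weighted_c_integrable[OF m s0 integrable_marginal_fst[OF m _ s0 _ 1] integrable_marginal_snd[OF m _ s0 _ 2]])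
       (use \<phi>1_integrable \<phi>2_integrable in auto)
qed

end

text \<open>The state after a half step that matched the first marginal; \<open>f\<close> is the density of the
  remaining marginal with respect to \<open>M2\<close>, modified on a null set to be positive everywhere.\<close>

locale sinkhorn_state = cost_space +
  fixes a :: "'a \<Rightarrow> real" and b :: "'b \<Rightarrow> real" and f :: "'b \<Rightarrow> real" and K t :: real
  assumes good: "good a b"
    and matched: "AE x in M1. margin1 (rho a b) x = 1"
    and f_meas[measurable]: "f \<in> borel_measurable M2"
    and f_pos: "\<And>y. 0 < f y"
    and f_marg: "AE y in M2. margin2 (rho a b) y = ennreal (f y)"
    and f_ent: "integrable M2 (\<lambda>y. f y * ln (f y))"
    and f_ent_le: "(\<integral>y. f y * ln (f y) \<partial>M2) \<le> K * t\<^sup>2"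
    and t: "0 < t" "t \<le> 1"
begin

abbreviation "\<rho> \<equiv> rho a b"

definition "E1 = (\<integral>x. exp (\<alpha> * \<phi>1 x) \<partial>M1)"
definition "E2 = (\<integral>y. exp (\<alpha> * \<phi>2 y) \<partial>M2)"
text \<open>Pinsker constant for the unmatched marginal, from the choice
  \<open>l = \<alpha> / 2 * t\<close>; \<open>\<omega>\<close> is the price of the weight
  \<open>\<phi>1\<close> on displaced mass after truncation, and \<open>\<delta>\<close> bounds the
  change of transport cost.\<close>

definition "C1 = 2 * K / \<alpha> + 4 * exp \<alpha> * E2 / \<alpha>"
definition "\<omega> = t * (2 / \<alpha> * (C1 * ln (1 / t) + E1))"
definition "\<delta> = 2 * (B0 * (C1 * t) + B1 * \<omega>) + B1 * (C1 * t)"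

lemma ab_meas[measurable]: "a \<in> borel_measurable M1" "b \<in> borel_measurable M2"
  using goodD[OF good] by auto

lemma f_nonneg: "0 \<le> f y" using f_pos[of y] by simp

lemma \<rho>_nonneg: "0 \<le> \<rho> x y" using rho_pos[of a b x y] by simp

lemma f_int: "integrable M2 f" "(\<integral>y. f y \<partial>M2) = 1"
proof -
  have "(\<integral>\<^sup>+y. ennreal (f y) \<partial>M2) = (\<integral>\<^sup>+y. \<integral>\<^sup>+x. ennreal (\<rho> x y) \<partial>M1 \<partial>M2)"
    by (rule nn_integral_cong_AE) (use f_marg in eventually_elim, auto)
  also have "\<dots> = 1" using nn_integral_snd[of "\<lambda>(x, y). ennreal (\<rho> x y)"] goodD(5)[OF good] by simp
  finally have "(\<integral>\<^sup>+y. ennreal (f y) \<partial>M2) = 1" .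
  then show "integrable M2 f" "(\<integral>y. f y \<partial>M2) = 1"
    by (auto intro!: integrableI_bounded simp: f_nonneg integral_eq_nn_integral)
qed

lemma ent_nonneg: "0 \<le> (\<integral>y. f y * ln (f y) \<partial>M2)"
proof -
  have "(\<integral>y. f y - 1 \<partial>M2) \<le> (\<integral>y. f y * ln (f y) \<partial>M2)"
    using f_int f_ent xlnx_ge[OF f_nonneg] by (intro integral_mono) auto
  then show ?thesis using f_int M2.prob_space by simp
qed

lemma K_nonneg: "0 \<le> K"
proof -
  have "0 \<le> K * t\<^sup>2" using ent_nonneg f_ent_le by linarith
  then show ?thesis using t by (simp add: zero_le_mult_iff)
qed

lemma E_nonneg: "0 \<le> E1" "0 \<le> E2" unfolding E1_def E2_def by (auto intro!: integral_nonneg_AE)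

lemma C1_nonneg: "0 \<le> C1" unfolding C1_def using K_nonneg E_nonneg \<alpha>_pos by simp

lemma \<omega>_nonneg: "0 \<le> \<omega>"
  unfolding \<omega>_def using C1_nonneg E_nonneg \<alpha>_pos t
  by (intro mult_nonneg_nonneg add_nonneg_nonneg) auto

lemma \<delta>_nonneg: "0 \<le> \<delta>" unfolding \<delta>_def using C1_nonneg \<omega>_nonneg B_nonneg t by simp

lemma weighted_tv:
  "integrable M2 (\<lambda>y. (1 + \<phi>2 y) * \<bar>f y - 1\<bar>)" "(\<integral>y. (1 + \<phi>2 y) * \<bar>f y - 1\<bar> \<partial>M2) \<le> C1 * t"
proof -
  \<comment> \<open>With an entropy of order \<open>t\<^sup>2\<close> this makes entropy / l and l
    times the exponential moment both of order \<open>t\<close>.\<close>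
  define l where "l = \<alpha> / 2 * t"
  have l: "0 < l" "l \<le> \<alpha> / 2" using t \<alpha>_pos by (auto simp: l_def mult_left_le)
  let ?U = "\<lambda>y. (f y * ln (f y) - f y + 1) / l + l * (8 / \<alpha>\<^sup>2) * (exp \<alpha> * exp (\<alpha> * \<phi>2 y))"
  have le: "(1 + \<phi>2 y) * \<bar>f y - 1\<bar> \<le> ?U y" for y
    using weighted_pinsker_pointwise[OF l _ f_nonneg, of "1 + \<phi>2 y" 1 y] \<phi>2_nonneg[of y]
    by (simp add: distrib_left exp_add)
  have iU: "integrable M2 ?U" using f_ent f_int exp2 by auto
  show i: "integrable M2 (\<lambda>y. (1 + \<phi>2 y) * \<bar>f y - 1\<bar>)"
  proof (rule Bochner_Integration.integrable_bound[OF iU])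
    show "AE y in M2. norm ((1 + \<phi>2 y) * \<bar>f y - 1\<bar>) \<le> norm (?U y)"
    proof (rule AE_I2)
      fix y
      have "0 \<le> (1 + \<phi>2 y) * \<bar>f y - 1\<bar>" using \<phi>2_nonneg[of y] by simp
      then show "norm ((1 + \<phi>2 y) * \<bar>f y - 1\<bar>) \<le> norm (?U y)"
        using le[of y] unfolding real_norm_def by linarith
    qed
  qed measurable
  have "(\<integral>y. (1 + \<phi>2 y) * \<bar>f y - 1\<bar> \<partial>M2) \<le> (\<integral>y. ?U y \<partial>M2)"
    by (rule integral_mono[OF i iU le])
  also have "\<dots> = (\<integral>y. f y * ln (f y) \<partial>M2) / l + l * (8 / \<alpha>\<^sup>2) * (exp \<alpha> * E2)"
    using f_ent f_int exp2 M2.prob_space by (simp add: E2_def)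
  also have "\<dots> \<le> K * t\<^sup>2 / l + l * (8 / \<alpha>\<^sup>2) * (exp \<alpha> * E2)"
    using f_ent_le l by (intro add_right_mono divide_right_mono) auto
  also have "\<dots> = C1 * t"
    using t \<alpha>_pos by (simp add: l_def C1_def power2_eq_square field_simps)
  finally show "(\<integral>y. (1 + \<phi>2 y) * \<bar>f y - 1\<bar> \<partial>M2) \<le> C1 * t" .
qed

lemma nn_weighted_tv: "(\<integral>\<^sup>+y. ennreal ((1 + \<phi>2 y) * \<bar>f y - 1\<bar>) \<partial>M2) \<le> ennreal (C1 * t)"
  using nn_integral_eq_integral[OF weighted_tv(1)] weighted_tv(2) \<phi>2_nonneg
  by (simp add: ennreal_leI)

text \<open>Used in both directions, with (f1, f2) equal to (f, 1) and to (1, f), which is why only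
  the distance of \<open>f1\<close> and \<open>f2\<close> is prescribed. The weight in
  \<open>y\<close> is covered by the weighted total variation of the marginals; the weight in
  \<open>x\<close> is not, and is truncated.\<close>

lemma shadow_weighted_bound:
  fixes k k' :: "'a \<Rightarrow> 'b \<Rightarrow> real"
  assumes k[measurable]: "case_prod k \<in> borel_measurable MM" and k0: "\<And>x y. 0 \<le> k x y"
    and f1[measurable]: "f1 \<in> borel_measurable M2" and f2[measurable]: "f2 \<in> borel_measurable M2"
    and f10: "\<And>y. 0 < f1 y" and f20: "\<And>y. 0 < f2 y"
    and f12: "\<And>y. \<bar>f1 y - f2 y\<bar> = \<bar>f y - 1\<bar>"
    and mx: "AE x in M1. (\<integral>\<^sup>+y. ennreal (k x y * f1 y) \<partial>M2) = 1"
    and my: "AE y in M2. margin2 k y = 1"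
    and bd: "\<And>\<psi>1 \<psi>2. \<psi>1 \<in> borel_measurable M1 \<Longrightarrow> \<psi>2 \<in> borel_measurable M2 \<Longrightarrow>
      (\<integral>\<^sup>+(x, y). (\<psi>1 x + \<psi>2 y) * ennreal \<bar>k' x y * f2 y - k x y * f1 y\<bar> \<partial>MM)
      \<le> 2 * (\<integral>\<^sup>+(x, y). \<psi>1 x * ennreal (k x y * max 0 (f1 y - f2 y)) \<partial>MM)
        + (\<integral>\<^sup>+y. \<psi>2 y * ennreal \<bar>f1 y - f2 y\<bar> \<partial>M2)"
    and u: "0 \<le> u0" "0 \<le> u1"
  shows "(\<integral>\<^sup>+(x, y). ennreal ((u0 + u1 * (\<phi>1 x + \<phi>2 y)) * \<bar>k' x y * f2 y - k x y * f1 y\<bar>) \<partial>MM)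
    \<le> ennreal (2 * (u0 * (C1 * t) + u1 * \<omega>) + u1 * (C1 * t))"
proof -
  define P where "P y = max 0 (f1 y - f2 y)" for y
  have [measurable]: "P \<in> borel_measurable M2" unfolding P_def[abs_def] by measurable
  have P0: "0 \<le> P y" and Pf: "P y \<le> f1 y" and Pd: "P y \<le> \<bar>f y - 1\<bar>" for y
    using f10[of y] f20[of y] f12[of y] by (auto simp: P_def)
  have nP: "(\<integral>\<^sup>+(x, y). ennreal (k x y * P y) \<partial>MM) \<le> ennreal (C1 * t)"
  proof -
    have "(\<integral>\<^sup>+(x, y). ennreal (k x y * P y) \<partial>MM) = (\<integral>\<^sup>+y. \<integral>\<^sup>+x. ennreal (P y) * ennreal (k x y) \<partial>M1 \<partial>M2)"
      by (subst nn_integral_snd[symmetric]) (auto simp: ennreal_mult k0 P0 mult.commute)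
    also have "\<dots> = (\<integral>\<^sup>+y. ennreal (P y) \<partial>M2)"
    proof (rule nn_integral_cong_AE)
      show "AE y in M2. (\<integral>\<^sup>+x. ennreal (P y) * ennreal (k x y) \<partial>M1) = ennreal (P y)"
        using my AE_space by eventually_elim (simp add: nn_integral_cmult)
    qed
    also have "\<dots> \<le> (\<integral>\<^sup>+y. ennreal ((1 + \<phi>2 y) * \<bar>f y - 1\<bar>) \<partial>M2)"
    proof (rule nn_integral_mono, rule ennreal_leI)
      fix y
      have "P y \<le> 1 * \<bar>f y - 1\<bar>" using Pd by simp
      also have "\<dots> \<le> (1 + \<phi>2 y) * \<bar>f y - 1\<bar>" using \<phi>2_nonneg[of y] by (intro mult_right_mono) auto
      finally show "P y \<le> (1 + \<phi>2 y) * \<bar>f y - 1\<bar>" .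
    qed
    also have "\<dots> \<le> ennreal (C1 * t)" by (rule nn_weighted_tv)
    finally show ?thesis .
  qed
  have nE: "(\<integral>\<^sup>+(x, y). ennreal (exp (\<alpha> * \<phi>1 x)) * ennreal (k x y * P y) \<partial>MM) \<le> ennreal E1"
  proof -
    have "(\<integral>\<^sup>+(x, y). ennreal (exp (\<alpha> * \<phi>1 x)) * ennreal (k x y * P y) \<partial>MM)
      \<le> (\<integral>\<^sup>+(x, y). ennreal (exp (\<alpha> * \<phi>1 x)) * ennreal (k x y * f1 y) \<partial>MM)"
      using k0 Pf by (intro nn_integral_mono) (auto intro!: mult_left_mono ennreal_leI)
    also have "\<dots> = (\<integral>\<^sup>+x. \<integral>\<^sup>+y. ennreal (exp (\<alpha> * \<phi>1 x)) * ennreal (k x y * f1 y) \<partial>M2 \<partial>M1)"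
      by (subst M2.nn_integral_fst[symmetric]) auto
    also have "\<dots> = (\<integral>\<^sup>+x. ennreal (exp (\<alpha> * \<phi>1 x)) \<partial>M1)"
    proof (rule nn_integral_cong_AE)
      show "AE x in M1. (\<integral>\<^sup>+y. ennreal (exp (\<alpha> * \<phi>1 x)) * ennreal (k x y * f1 y) \<partial>M2) = ennreal (exp (\<alpha> * \<phi>1 x))"
        using mx AE_space by eventually_elim (simp add: nn_integral_cmult)
    qed
    also have "\<dots> = ennreal E1" unfolding E1_def by (rule nn_integral_eq_integral[OF exp1]) simp
    finally show ?thesis by simp
  qed
  \<comment> \<open>At this level the tail factor \<open>exp (- \<alpha> * R / 2)\<close> is exactly
    \<open>t\<close>: the tail costs O(t), the bulk O(t ln (1/t)).\<close>
  define R where "R = 2 / \<alpha> * ln (1 / t)"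
  have R0: "0 \<le> R" using t \<alpha>_pos by (simp add: R_def)
  have eR: "exp (- \<alpha> * R / 2) = t" using t \<alpha>_pos by (simp add: R_def ln_div)
  have n\<phi>: "(\<integral>\<^sup>+(x, y). ennreal (\<phi>1 x) * ennreal (k x y * P y) \<partial>MM) \<le> ennreal \<omega>"
  proof -
    have "(\<integral>\<^sup>+(x, y). ennreal (\<phi>1 x) * ennreal (k x y * P y) \<partial>MM)
      \<le> (\<integral>\<^sup>+z. ennreal R * (case z of (x, y) \<Rightarrow> ennreal (k x y * P y))
          + ennreal (2 / \<alpha> * t) * (case z of (x, y) \<Rightarrow> ennreal (exp (\<alpha> * \<phi>1 x)) * ennreal (k x y * P y)) \<partial>MM)"
    proof (rule nn_integral_mono)
      fix z :: "'a \<times> 'b"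
      obtain x y where z: "z = (x, y)" by (cases z)
      have "\<phi>1 x \<le> R + 2 / \<alpha> * t * exp (\<alpha> * \<phi>1 x)"
        using exp_tail_bound[OF \<alpha>_pos \<phi>1_nonneg[of x] R0] unfolding eR by simp
      then have "ennreal (\<phi>1 x) \<le> ennreal R + ennreal (2 / \<alpha> * t) * ennreal (exp (\<alpha> * \<phi>1 x))"
        using R0 \<alpha>_pos t by (simp add: ennreal_leI flip: ennreal_plus ennreal_mult)
      then have "ennreal (\<phi>1 x) * ennreal (k x y * P y) \<le> (ennreal R + ennreal (2 / \<alpha> * t) * ennreal (exp (\<alpha> * \<phi>1 x))) * ennreal (k x y * P y)"
        by (rule mult_right_mono) simp
      then show "(case z of (x, y) \<Rightarrow> ennreal (\<phi>1 x) * ennreal (k x y * P y))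
        \<le> ennreal R * (case z of (x, y) \<Rightarrow> ennreal (k x y * P y))
          + ennreal (2 / \<alpha> * t) * (case z of (x, y) \<Rightarrow> ennreal (exp (\<alpha> * \<phi>1 x)) * ennreal (k x y * P y))"
        by (simp add: z distrib_right mult.assoc)
    qed
    also have "\<dots> = ennreal R * (\<integral>\<^sup>+(x, y). ennreal (k x y * P y) \<partial>MM)
       + ennreal (2 / \<alpha> * t) * (\<integral>\<^sup>+(x, y). ennreal (exp (\<alpha> * \<phi>1 x)) * ennreal (k x y * P y) \<partial>MM)"
      by (simp add: nn_integral_add nn_integral_cmult)
    also have "\<dots> \<le> ennreal R * ennreal (C1 * t) + ennreal (2 / \<alpha> * t) * ennreal E1"
      by (intro add_mono mult_left_mono nP nE) auto
    also have "\<dots> = ennreal (R * (C1 * t) + 2 / \<alpha> * t * E1)"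
      using R0 C1_nonneg t \<alpha>_pos E_nonneg by (simp flip: ennreal_mult ennreal_plus)
    also have "R * (C1 * t) + 2 / \<alpha> * t * E1 = \<omega>" by (simp add: \<omega>_def R_def algebra_simps)
    finally show ?thesis .
  qed
  have n2: "(\<integral>\<^sup>+y. ennreal (u1 * \<phi>2 y) * ennreal \<bar>f1 y - f2 y\<bar> \<partial>M2) \<le> ennreal (u1 * (C1 * t))"
  proof -
    have "(\<integral>\<^sup>+y. ennreal (u1 * \<phi>2 y) * ennreal \<bar>f1 y - f2 y\<bar> \<partial>M2)
      \<le> (\<integral>\<^sup>+y. ennreal u1 * ennreal ((1 + \<phi>2 y) * \<bar>f y - 1\<bar>) \<partial>M2)"
    proof (rule nn_integral_mono)
      fix y
      have "u1 * \<phi>2 y * \<bar>f y - 1\<bar> \<le> u1 * ((1 + \<phi>2 y) * \<bar>f y - 1\<bar>)"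
        using u \<phi>2_nonneg[of y] by (simp add: mult_right_mono mult_left_mono mult.assoc)
      then show "ennreal (u1 * \<phi>2 y) * ennreal \<bar>f1 y - f2 y\<bar> \<le> ennreal u1 * ennreal ((1 + \<phi>2 y) * \<bar>f y - 1\<bar>)"
        using u \<phi>2_nonneg[of y] by (simp add: f12 ennreal_leI flip: ennreal_mult)
    qed
    also have "\<dots> = ennreal u1 * (\<integral>\<^sup>+y. ennreal ((1 + \<phi>2 y) * \<bar>f y - 1\<bar>) \<partial>M2)"
      by (simp add: nn_integral_cmult)
    also have "\<dots> \<le> ennreal u1 * ennreal (C1 * t)" by (intro mult_left_mono nn_weighted_tv) simp
    finally show ?thesis using u C1_nonneg t by (simp add: ennreal_mult)
  qed
  have n1: "(\<integral>\<^sup>+(x, y). ennreal (u0 + u1 * \<phi>1 x) * ennreal (k x y * P y) \<partial>MM) \<le> ennreal (u0 * (C1 * t) + u1 * \<omega>)"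
  proof -
    have "(\<integral>\<^sup>+(x, y). ennreal (u0 + u1 * \<phi>1 x) * ennreal (k x y * P y) \<partial>MM)
      = (\<integral>\<^sup>+z. ennreal u0 * (case z of (x, y) \<Rightarrow> ennreal (k x y * P y))
          + ennreal u1 * (case z of (x, y) \<Rightarrow> ennreal (\<phi>1 x) * ennreal (k x y * P y)) \<partial>MM)"
      using u \<phi>1_nonneg by (intro nn_integral_cong) (auto simp: ennreal_plus ennreal_mult distrib_right mult.assoc)
    also have "\<dots> = ennreal u0 * (\<integral>\<^sup>+(x, y). ennreal (k x y * P y) \<partial>MM)
       + ennreal u1 * (\<integral>\<^sup>+(x, y). ennreal (\<phi>1 x) * ennreal (k x y * P y) \<partial>MM)"
      by (simp add: nn_integral_add nn_integral_cmult)
    also have "\<dots> \<le> ennreal u0 * ennreal (C1 * t) + ennreal u1 * ennreal \<omega>"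
      by (intro add_mono mult_left_mono nP n\<phi>) auto
    also have "\<dots> = ennreal (u0 * (C1 * t) + u1 * \<omega>)"
      using u C1_nonneg t \<omega>_nonneg by (simp add: ennreal_mult ennreal_plus)
    finally show ?thesis .
  qed
  have "(\<integral>\<^sup>+(x, y). ennreal ((u0 + u1 * (\<phi>1 x + \<phi>2 y)) * \<bar>k' x y * f2 y - k x y * f1 y\<bar>) \<partial>MM)
    = (\<integral>\<^sup>+(x, y). (ennreal (u0 + u1 * \<phi>1 x) + ennreal (u1 * \<phi>2 y)) * ennreal \<bar>k' x y * f2 y - k x y * f1 y\<bar> \<partial>MM)"
    using u \<phi>1_nonneg \<phi>2_nonneg
    by (intro nn_integral_cong) (auto simp: distrib_left add.assoc simp flip: ennreal_plus ennreal_mult)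
  also have "\<dots> \<le> 2 * (\<integral>\<^sup>+(x, y). ennreal (u0 + u1 * \<phi>1 x) * ennreal (k x y * max 0 (f1 y - f2 y)) \<partial>MM)
        + (\<integral>\<^sup>+y. ennreal (u1 * \<phi>2 y) * ennreal \<bar>f1 y - f2 y\<bar> \<partial>M2)"
    by (rule bd) measurable
  also have "\<dots> \<le> 2 * ennreal (u0 * (C1 * t) + u1 * \<omega>) + ennreal (u1 * (C1 * t))"
    by (intro add_mono mult_left_mono n2 n1[unfolded P_def]) auto
  also have "\<dots> = ennreal (2 * (u0 * (C1 * t) + u1 * \<omega>) + u1 * (C1 * t))"
  proof -
    have n: "0 \<le> u0 * (C1 * t) + u1 * \<omega>" "0 \<le> u1 * (C1 * t)" using u C1_nonneg t \<omega>_nonneg by auto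
    have "2 * ennreal (u0 * (C1 * t) + u1 * \<omega>) = ennreal (2 * (u0 * (C1 * t) + u1 * \<omega>))"
      using n by (subst ennreal_mult) auto
    then show ?thesis using n by (subst ennreal_plus) auto
  qed
  finally show ?thesis .
qed

end

section \<open>Plans sharing the marginals of the iterate\<close>

context sinkhorn_state
begin

text \<open>The class containing both the iterate and the competitor; on it the integral of a + b is
  constant.\<close>

definition state_density :: "('a \<Rightarrow> 'b \<Rightarrow> real) \<Rightarrow> bool" where
  "state_density s \<longleftrightarrow> case_prod s \<in> borel_measurable MM \<and> (\<forall>x y. 0 \<le> s x y)
    \<and> (AE x in M1. margin1 s x = ennreal 1) \<and> (AE y in M2. margin2 s y = ennreal (f y))"

lemma state_densityD:
  assumes "state_density s"
  shows "case_prod s \<in> borel_measurable MM" "\<And>x y. 0 \<le> s x y"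
    "AE x in M1. margin1 s x = ennreal 1" "AE y in M2. margin2 s y = ennreal (f y)"
  using assms by (auto simp: state_density_def)

lemma \<rho>_section: "y \<in> space M2 \<Longrightarrow> (\<lambda>x. \<rho> x y) \<in> borel_measurable M1"
  unfolding rho_def by measurable

lemma state_density_\<rho>: "state_density \<rho>"
  using matched f_marg \<rho>_nonneg by (simp add: state_density_def)

lemma state_fst:
  assumes s: "state_density s" and g: "integrable M1 g"
  shows "integrable MM (\<lambda>(x, y). s x y * g x)"
    "(\<integral>(x, y). s x y * g x \<partial>MM) = (\<integral>x. g x \<partial>M1)"
proof -
  have g': "g \<in> borel_measurable M1" "integrable M1 (\<lambda>x. 1 * g x)" using g by auto
  note * = state_densityD[OF s]
  show "integrable MM (\<lambda>(x, y). s x y * g x)"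
    "(\<integral>(x, y). s x y * g x \<partial>MM) = (\<integral>x. g x \<partial>M1)"
    using integrable_marginal_fst[OF *(1) g'(1) *(2) _ *(3) g'(2)]
      integral_marginal_fst[OF *(1) g'(1) *(2) _ *(3) g'(2)] by simp_all
qed

lemma state_snd:
  assumes s: "state_density s" and [measurable]: "g \<in> borel_measurable M2" and g: "integrable M2 (\<lambda>y. f y * g y)"
  shows "integrable MM (\<lambda>(x, y). s x y * g y)"
    "(\<integral>(x, y). s x y * g y \<partial>MM) = (\<integral>y. f y * g y \<partial>M2)"
proof -
  note * = state_densityD[OF s]
  show "integrable MM (\<lambda>(x, y). s x y * g y)"
    "(\<integral>(x, y). s x y * g y \<partial>MM) = (\<integral>y. f y * g y \<partial>M2)"
    using integrable_marginal_snd[OF *(1) assms(2) *(2) f_nonneg *(4) g]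
      integral_marginal_snd[OF *(1) assms(2) *(2) f_nonneg *(4) g] by simp_all
qed

lemma state_integrable:
  assumes s: "state_density s"
  shows "integrable MM (case_prod s)" "integral\<^sup>L MM (case_prod s) = 1"
  using state_fst[OF s, of "\<lambda>_. 1"] M1.prob_space by simp_all

lemma f\<phi>2_integrable: "integrable M2 (\<lambda>y. f y * (1 + \<phi>2 y))"
proof (rule Bochner_Integration.integrable_bound)
  show "integrable M2 (\<lambda>y. (1 + \<phi>2 y) * \<bar>f y - 1\<bar> + (1 + \<phi>2 y))"
    using weighted_tv(1) \<phi>2_integrable by auto
  show "AE y in M2. norm (f y * (1 + \<phi>2 y)) \<le> norm ((1 + \<phi>2 y) * \<bar>f y - 1\<bar> + (1 + \<phi>2 y))"
  proof (rule AE_I2)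
    fix y
    have "f y * (1 + \<phi>2 y) \<le> (\<bar>f y - 1\<bar> + 1) * (1 + \<phi>2 y)" using \<phi>2_nonneg[of y] by (intro mult_right_mono) auto
    also have "\<dots> = (1 + \<phi>2 y) * \<bar>f y - 1\<bar> + (1 + \<phi>2 y)" by (simp add: algebra_simps)
    finally show "norm (f y * (1 + \<phi>2 y)) \<le> norm ((1 + \<phi>2 y) * \<bar>f y - 1\<bar> + (1 + \<phi>2 y))"
      using f_nonneg[of y] \<phi>2_nonneg[of y] by simp
  qed
qed simp

lemma f\<phi>2_integrable': "integrable M2 (\<lambda>y. f y * \<phi>2 y)"
  using Bochner_Integration.integrable_diff[OF f\<phi>2_integrable f_int(1)] by (simp add: algebra_simps)

lemma state_c_integrable:
  assumes s: "state_density s"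
  shows "integrable MM (\<lambda>(x, y). s x y * c x y)"
  using weighted_c_integrable[OF state_densityD(1,2)[OF s] state_fst(1)[OF s, of "\<lambda>x. 1 + \<phi>1 x"]
      state_snd(1)[OF s \<phi>2_meas f\<phi>2_integrable']] \<phi>1_integrable by simp

lemma f_marg_real: "AE y in M2. (\<integral>x. \<rho> x y \<partial>M1) = f y"
  using f_marg AE_space
proof eventually_elim
  case (elim y)
  have "(\<integral>x. \<rho> x y \<partial>M1) = enn2real (margin2 \<rho> y)"
    by (rule integral_eq_nn_integral[OF \<rho>_section[OF elim(2)] AE_I2[OF \<rho>_nonneg]])
  also have "\<dots> = f y" unfolding elim(1) by (rule enn2real_ennreal[OF f_nonneg])
  finally show ?case .
qed

text \<open>The growth bound from \<open>good\<close> controls the density times \<open>b\<close>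
  from above. From below, \<open>\<rho> * ln \<rho> \<ge> -1\<close> does, since this entropy equals
  \<rho> a + \<rho> b - \<rho> c with \<rho> a integrable and \<rho> c nonnegative.\<close>

lemma fb_integrable: "integrable M2 (\<lambda>y. f y * b y)"
proof -
  have aux: "\<bar>X\<bar> \<le> \<bar>\<bar>Y\<bar> + Z + 1\<bar>" if "-1 \<le> E" "E = Y + X - W" "0 \<le> W" "0 \<le> Z" "X \<le> Z" for X Y Z W E :: real
    using that by linarith
  obtain A where A: "AE y in M2. b y \<le> A * (1 + \<phi>2 y)" using good unfolding good_def by blast
  have AM: "AE z in MM. b (snd z) \<le> A * (1 + \<phi>2 (snd z))"
    by (rule AE_pair_measure) (use A in auto)
  have i1: "integrable MM (\<lambda>(x, y). \<rho> x y * a x)"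
    by (rule state_fst(1)[OF state_density_\<rho> goodD(1)[OF good]])
  have i2: "integrable MM (\<lambda>(x, y). \<rho> x y * (1 + \<phi>2 y))"
    by (rule state_snd(1)[OF state_density_\<rho> _ f\<phi>2_integrable]) simp
  have i3: "integrable MM (\<lambda>(x, y). \<rho> x y * b y)"
  proof (rule Bochner_Integration.integrable_bound)
    show "integrable MM (\<lambda>z. \<bar>case z of (x, y) \<Rightarrow> \<rho> x y * a x\<bar> + \<bar>A\<bar> * \<bar>case z of (x, y) \<Rightarrow> \<rho> x y * (1 + \<phi>2 y)\<bar> + 1)"
      using i1 i2 by auto
    show "AE z in MM. norm (case z of (x, y) \<Rightarrow> \<rho> x y * b y)
      \<le> norm (\<bar>case z of (x, y) \<Rightarrow> \<rho> x y * a x\<bar> + \<bar>A\<bar> * \<bar>case z of (x, y) \<Rightarrow> \<rho> x y * (1 + \<phi>2 y)\<bar> + 1)"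
      using AM
    proof eventually_elim
      case (elim z)
      obtain x y where z: "z = (x, y)" by (cases z)
      have "\<rho> x y * b y \<le> \<rho> x y * (A * (1 + \<phi>2 y))"
        using elim \<rho>_nonneg by (intro mult_left_mono) (auto simp: z)
      also have "\<dots> \<le> \<bar>A\<bar> * \<bar>\<rho> x y * (1 + \<phi>2 y)\<bar>"
        by (metis abs_ge_self abs_mult mult.left_commute)
      finally have up: "\<rho> x y * b y \<le> \<bar>A\<bar> * \<bar>\<rho> x y * (1 + \<phi>2 y)\<bar>" .
      have "-1 \<le> \<rho> x y * ln (\<rho> x y)" using xlnx_ge[OF \<rho>_nonneg[of x y]] \<rho>_nonneg[of x y] by linarith
      moreover have "\<rho> x y * ln (\<rho> x y) = \<rho> x y * a x + \<rho> x y * b y - \<rho> x y * c x y"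
        by (simp add: rho_def algebra_simps)
      moreover have "0 \<le> \<rho> x y * c x y" using \<rho>_nonneg c_nonneg by simp
      moreover have "0 \<le> \<bar>A\<bar> * \<bar>\<rho> x y * (1 + \<phi>2 y)\<bar>" by simp
      ultimately show ?case unfolding z prod.case real_norm_def using up by (intro aux)
    qed
  qed measurable
  show ?thesis
  proof (rule integrable_cong_AE_imp[OF integrable_snd[OF i3]])
    show "AE y in M2. (\<integral>x. \<rho> x y * b y \<partial>M1) = f y * b y"
      using f_marg_real by eventually_elim (simp only: integral_mult_left_zero)
  qed simp
qed

text \<open>Dual functional evaluated at the marginals of the iterate itself; it turns out to be the
  free energy of the iterate.\<close>

definition "\<Lambda> = (\<integral>x. a x \<partial>M1) + (\<integral>y. f y * b y \<partial>M2)"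

lemma state_potential:
  assumes s: "state_density s"
  shows "integrable MM (\<lambda>(x, y). s x y * (a x + b y))"
    "(\<integral>(x, y). s x y * (a x + b y) \<partial>MM) = \<Lambda>"
proof -
  note 1 = state_fst[OF s goodD(1)[OF good]] and 2 = state_snd[OF s ab_meas(2) fb_integrable]
  show "integrable MM (\<lambda>(x, y). s x y * (a x + b y))"
    using Bochner_Integration.integrable_add[OF 1(1) 2(1)] by (simp add: case_prod_beta' distrib_left)
  show "(\<integral>(x, y). s x y * (a x + b y) \<partial>MM) = \<Lambda>"
    using Bochner_Integration.integral_add[OF 1(1) 2(1)] 1(2) 2(2) by (simp add: case_prod_beta' distrib_left \<Lambda>_def)
qed

lemma \<rho>_entropy:
  shows "integrable MM (\<lambda>(x, y). \<rho> x y * ln (\<rho> x y))" "Fcost \<rho> = \<Lambda>"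
proof -
  have e: "(\<lambda>(x, y). \<rho> x y * ln (\<rho> x y)) = (\<lambda>z. (case z of (x, y) \<Rightarrow> \<rho> x y * (a x + b y)) - (case z of (x, y) \<Rightarrow> \<rho> x y * c x y))"
    by (auto simp: fun_eq_iff rho_def algebra_simps)
  note 1 = state_potential[OF state_density_\<rho>] and 2 = state_c_integrable[OF state_density_\<rho>]
  show "integrable MM (\<lambda>(x, y). \<rho> x y * ln (\<rho> x y))"
    unfolding e by (rule Bochner_Integration.integrable_diff[OF 1(1) 2])
  show "Fcost \<rho> = \<Lambda>"
    unfolding Fcost_def e Bochner_Integration.integral_diff[OF 1(1) 2] 1(2) by simp
qed

lemma cost_difference:
  assumes [measurable]: "case_prod s1 \<in> borel_measurable MM" "case_prod s2 \<in> borel_measurable MM"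
    and i: "integrable MM (\<lambda>(x, y). s1 x y * c x y)" "integrable MM (\<lambda>(x, y). s2 x y * c x y)"
    and le: "(\<integral>\<^sup>+(x, y). ennreal ((B0 + B1 * (\<phi>1 x + \<phi>2 y)) * \<bar>s1 x y - s2 x y\<bar>) \<partial>MM) \<le> ennreal \<delta>"
  shows "(\<integral>(x, y). s1 x y * c x y \<partial>MM) \<le> (\<integral>(x, y). s2 x y * c x y \<partial>MM) + \<delta>"
proof -
  let ?d = "\<lambda>z. (case z of (x, y) \<Rightarrow> s1 x y * c x y) - (case z of (x, y) \<Rightarrow> s2 x y * c x y)"
  have "ennreal (norm (integral\<^sup>L MM ?d)) \<le> (\<integral>\<^sup>+z. norm (?d z) \<partial>MM)"
    by (rule integral_norm_bound_ennreal[OF Bochner_Integration.integrable_diff[OF i]])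
  also have "\<dots> \<le> (\<integral>\<^sup>+(x, y). ennreal ((B0 + B1 * (\<phi>1 x + \<phi>2 y)) * \<bar>s1 x y - s2 x y\<bar>) \<partial>MM)"
  proof (rule nn_integral_mono)
    fix z :: "'a \<times> 'b"
    obtain x y where z: "z = (x, y)" by (cases z)
    have "?d z = c x y * (s1 x y - s2 x y)" by (simp add: z algebra_simps)
    then have "norm (?d z) = c x y * \<bar>s1 x y - s2 x y\<bar>"
      using c_nonneg[of x y] by (simp add: abs_mult)
    also have "\<dots> \<le> (B0 + B1 * (\<phi>1 x + \<phi>2 y)) * \<bar>s1 x y - s2 x y\<bar>"
      by (intro mult_right_mono c_le) simp
    finally show "ennreal (norm (?d z)) \<le> (case z of (x, y) \<Rightarrow> ennreal ((B0 + B1 * (\<phi>1 x + \<phi>2 y)) * \<bar>s1 x y - s2 x y\<bar>))"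
      by (simp add: z ennreal_leI)
  qed
  also note le
  finally have "norm (integral\<^sup>L MM ?d) \<le> \<delta>" using \<delta>_nonneg by simp
  moreover have "integral\<^sup>L MM ?d = (\<integral>(x, y). s1 x y * c x y \<partial>MM) - (\<integral>(x, y). s2 x y * c x y \<partial>MM)"
    by (rule Bochner_Integration.integral_diff[OF i])
  ultimately show ?thesis unfolding real_norm_def by linarith
qed

text \<open>Dividing by \<open>f\<close> passes to the density relative to the product of the
  iterate's own marginals, which lowers the entropy by the nonnegative entropy of \<open>f\<close>.
  The shadow is then a coupling of the prescribed marginals, hence admissible for the
  optimizer.\<close>

lemma optimal_le:
  assumes r: "optimal_density r"
  shows "Fcost r \<le> \<Lambda> + \<delta>"
proof -
  define k where "k x y = \<rho> x y / f y" for x y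
  have [measurable]: "case_prod k \<in> borel_measurable MM" unfolding k_def[abs_def] by measurable
  have k0: "0 \<le> k x y" for x y using \<rho>_nonneg f_nonneg by (simp add: k_def)
  have kf: "k x y * f y = \<rho> x y" for x y using f_pos[of y] by (simp add: k_def)
  have mx: "AE x in M1. (\<integral>\<^sup>+y. ennreal (k x y * f y) \<partial>M2) = 1" using matched by (simp add: kf)
  have my: "AE y in M2. margin2 k y = 1"
    using f_marg AE_space
  proof eventually_elim
    case (elim y)
    have "margin2 k y = (\<integral>\<^sup>+x. ennreal (1 / f y) * ennreal (\<rho> x y) \<partial>M1)"
      using f_pos[of y] \<rho>_nonneg by (intro nn_integral_cong) (simp add: k_def flip: ennreal_mult)
    also have "\<dots> = ennreal (1 / f y) * ennreal (f y)" using elim by (simp add: nn_integral_cmult)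
    also have "\<dots> = 1" using f_pos[of y] by (simp flip: ennreal_mult)
    finally show ?case .
  qed
  have e: "f y * (k x y * ln (k x y)) = \<rho> x y * ln (\<rho> x y) - \<rho> x y * ln (f y)" for x y
  proof -
    have l: "ln (k x y) = ln (\<rho> x y) - ln (f y)"
      using f_pos[of y] rho_pos[of a b x y] by (simp add: k_def ln_div)
    have "f y * (k x y * ln (k x y)) = (k x y * f y) * ln (k x y)" by simp
    also have "\<dots> = \<rho> x y * ln (k x y)" by (simp only: kf)
    finally show ?thesis by (simp only: l right_diff_distrib)
  qed
  have e': "(\<lambda>(x, y). f y * (k x y * ln (k x y)))
      = (\<lambda>z. (case z of (x, y) \<Rightarrow> \<rho> x y * ln (\<rho> x y)) - (case z of (x, y) \<Rightarrow> \<rho> x y * ln (f y)))"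
    by (auto simp: fun_eq_iff e)
  have iln: "integrable MM (\<lambda>(x, y). \<rho> x y * ln (f y))"
    "(\<integral>(x, y). \<rho> x y * ln (f y) \<partial>MM) = (\<integral>y. f y * ln (f y) \<partial>M2)"
    using state_snd[OF state_density_\<rho> _ f_ent] by simp_all
  have ent: "integrable MM (\<lambda>(x, y). f y * (k x y * ln (k x y)))"
    unfolding e' by (rule Bochner_Integration.integrable_diff[OF \<rho>_entropy(1) iln(1)])
  have entI: "(\<integral>(x, y). f y * (k x y * ln (k x y)) \<partial>MM) \<le> (\<integral>(x, y). \<rho> x y * ln (\<rho> x y) \<partial>MM)"
    unfolding e' Bochner_Integration.integral_diff[OF \<rho>_entropy(1) iln(1)] iln(2) using ent_nonneg by simp
  obtain k' where k'm: "case_prod k' \<in> borel_measurable MM" and k'0: "\<And>x y. 0 \<le> k' x y"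
    and k'x: "AE x in M1. (\<integral>\<^sup>+y. ennreal (k' x y * 1) \<partial>M2) = 1"
    and k'y: "AE y in M2. margin2 k' y = 1"
    and k'i: "integrable MM (\<lambda>(x, y). 1 * (k' x y * ln (k' x y)))"
    and k'I: "(\<integral>(x, y). 1 * (k' x y * ln (k' x y)) \<partial>MM)
      \<le> (\<integral>(x, y). f y * (k x y * ln (k x y)) \<partial>MM)"
    and bd: "\<And>\<psi>1 \<psi>2. \<psi>1 \<in> borel_measurable M1 \<Longrightarrow> \<psi>2 \<in> borel_measurable M2 \<Longrightarrow>
      (\<integral>\<^sup>+(x, y). (\<psi>1 x + \<psi>2 y) * ennreal \<bar>k' x y * 1 - k x y * f y\<bar> \<partial>MM)
      \<le> 2 * (\<integral>\<^sup>+(x, y). \<psi>1 x * ennreal (k x y * max 0 (f y - 1)) \<partial>MM)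
        + (\<integral>\<^sup>+y. \<psi>2 y * ennreal \<bar>f y - 1\<bar> \<partial>M2)"
    by (rule shadow[of k f "\<lambda>_. 1"]) (use k0 f_pos f_int mx my ent M2.prob_space in simp_all)
  have cd: "coupling_density k'"
    using k'm k'0 k'x k'y k'i by (simp add: coupling_density_def)
  have "(\<integral>\<^sup>+(x, y). ennreal ((B0 + B1 * (\<phi>1 x + \<phi>2 y)) * \<bar>k' x y * 1 - k x y * f y\<bar>) \<partial>MM) \<le> ennreal \<delta>"
    unfolding \<delta>_def
    by (rule shadow_weighted_bound[OF _ k0 _ _ _ _ _ mx my bd B_nonneg]) (use f_pos in auto)
  then have "(\<integral>(x, y). k' x y * c x y \<partial>MM) \<le> (\<integral>(x, y). \<rho> x y * c x y \<partial>MM) + \<delta>"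
    by (intro cost_difference k'm coupling_c_integrable cd state_c_integrable state_density_\<rho>) (simp_all add: kf)
  then have "Fcost k' \<le> Fcost \<rho> + \<delta>"
    unfolding Fcost_def using k'I entI by simp
  then show ?thesis using r cd \<rho>_entropy by (auto simp: optimal_density_def)
qed

text \<open>The same construction from the prescribed to the current marginal. Returning to
  densities relative to the prescribed product adds the entropy of \<open>f\<close>, whence the term
  \<open>K * t\<^sup>2\<close>.\<close>

lemma optimal_shadow:
  assumes r: "optimal_density r"
  obtains s where "state_density s" "integrable MM (\<lambda>(x, y). s x y * ln (s x y))"
    "Fcost s \<le> Fcost r + \<delta> + K * t\<^sup>2"
    "(\<integral>\<^sup>+(x, y). ennreal ((1 + 1 * (\<phi>1 x + \<phi>2 y)) * \<bar>s x y - r x y\<bar>) \<partial>MM)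
      \<le> ennreal (2 * (1 * (C1 * t) + 1 * \<omega>) + 1 * (C1 * t))"
proof -
  have cr: "coupling_density r" using r by (simp add: optimal_density_def)
  then have [measurable]: "case_prod r \<in> borel_measurable MM" and r0: "\<And>x y. 0 \<le> r x y"
    and mx: "AE x in M1. (\<integral>\<^sup>+y. ennreal (r x y * 1) \<partial>M2) = 1"
    and my: "AE y in M2. margin2 r y = 1"
    and ent: "integrable MM (\<lambda>(x, y). 1 * (r x y * ln (r x y)))"
    by (auto simp: coupling_density_def)
  obtain k where km[measurable]: "case_prod k \<in> borel_measurable MM" and k0: "\<And>x y. 0 \<le> k x y"
    and kx: "AE x in M1. (\<integral>\<^sup>+y. ennreal (k x y * f y) \<partial>M2) = 1"
    and ky: "AE y in M2. margin2 k y = 1"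
    and ki: "integrable MM (\<lambda>(x, y). f y * (k x y * ln (k x y)))"
    and kI: "(\<integral>(x, y). f y * (k x y * ln (k x y)) \<partial>MM)
      \<le> (\<integral>(x, y). 1 * (r x y * ln (r x y)) \<partial>MM)"
    and bd: "\<And>\<psi>1 \<psi>2. \<psi>1 \<in> borel_measurable M1 \<Longrightarrow> \<psi>2 \<in> borel_measurable M2 \<Longrightarrow>
      (\<integral>\<^sup>+(x, y). (\<psi>1 x + \<psi>2 y) * ennreal \<bar>k x y * f y - r x y * 1\<bar> \<partial>MM)
      \<le> 2 * (\<integral>\<^sup>+(x, y). \<psi>1 x * ennreal (r x y * max 0 (1 - f y)) \<partial>MM)
        + (\<integral>\<^sup>+y. \<psi>2 y * ennreal \<bar>1 - f y\<bar> \<partial>M2)"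
    by (rule shadow[of r "\<lambda>_. 1" f]) (use r0 f_pos f_int mx my ent M2.prob_space in simp_all)
  define s where "s x y = k x y * f y" for x y
  have sm[measurable]: "case_prod s \<in> borel_measurable MM" unfolding s_def[abs_def] by measurable
  have s0: "0 \<le> s x y" for x y using k0 f_nonneg by (simp add: s_def)
  have sy: "AE y in M2. margin2 s y = ennreal (f y)"
    using ky AE_space
  proof eventually_elim
    case (elim y)
    have "margin2 s y = (\<integral>\<^sup>+x. ennreal (k x y) * ennreal (f y) \<partial>M1)"
      using k0 f_nonneg by (simp add: s_def ennreal_mult)
    also have "\<dots> = ennreal (f y)" using elim by (simp add: nn_integral_multc)
    finally show ?case .
  qed
  have sd: "state_density s" using sm s0 kx sy by (simp add: state_density_def s_def)
  have e: "s x y * ln (s x y) = f y * (k x y * ln (k x y)) + s x y * ln (f y)" for x y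
  proof (cases "k x y = 0")
    case False
    then have "0 < k x y" using k0[of x y] by simp
    then show ?thesis using f_pos[of y] by (simp add: s_def ln_mult algebra_simps)
  qed (simp add: s_def)
  have e': "(\<lambda>(x, y). s x y * ln (s x y))
      = (\<lambda>z. (case z of (x, y) \<Rightarrow> f y * (k x y * ln (k x y))) + (case z of (x, y) \<Rightarrow> s x y * ln (f y)))"
    by (auto simp: fun_eq_iff e)
  have iln: "integrable MM (\<lambda>(x, y). s x y * ln (f y))"
    "(\<integral>(x, y). s x y * ln (f y) \<partial>MM) = (\<integral>y. f y * ln (f y) \<partial>M2)"
    using state_snd[OF sd _ f_ent] by simp_all
  have si: "integrable MM (\<lambda>(x, y). s x y * ln (s x y))" unfolding e' by (rule Bochner_Integration.integrable_add[OF ki iln(1)])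
  have sI: "(\<integral>(x, y). s x y * ln (s x y) \<partial>MM) \<le> (\<integral>(x, y). r x y * ln (r x y) \<partial>MM) + K * t\<^sup>2"
    unfolding e' Bochner_Integration.integral_add[OF ki iln(1)] iln(2) using kI f_ent_le by simp
  have bound: "(\<integral>\<^sup>+(x, y). ennreal ((u0 + u1 * (\<phi>1 x + \<phi>2 y)) * \<bar>k x y * f y - r x y * 1\<bar>) \<partial>MM)
     \<le> ennreal (2 * (u0 * (C1 * t) + u1 * \<omega>) + u1 * (C1 * t))" if "0 \<le> u0" "0 \<le> u1" for u0 u1
    by (rule shadow_weighted_bound[OF _ r0 _ _ _ _ _ mx my bd that]) (use f_pos in auto)
  have "(\<integral>(x, y). s x y * c x y \<partial>MM) \<le> (\<integral>(x, y). r x y * c x y \<partial>MM) + \<delta>"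
    by (intro cost_difference coupling_c_integrable cr state_c_integrable sd)
       (use bound[OF B_nonneg] in \<open>simp_all add: s_def \<delta>_def\<close>)
  then have "Fcost s \<le> Fcost r + \<delta> + K * t\<^sup>2" unfolding Fcost_def using sI by simp
  from that[OF sd si this] bound[of 1 1] show thesis by (simp add: s_def)
qed

end

section \<open>Comparing the optimizer with the iterate\<close>

context sinkhorn_state
begin

text \<open>Since ln (s / \<rho>) = ln s - (a + b) + c, the potentials contribute only the constant
  \<open>\<Lambda>\<close>. The terms \<open>- s x y + \<rho> x y\<close> integrate to zero and make
  the integrand pointwise nonnegative.\<close>

lemma state_relative_entropy:
  assumes s: "state_density s" and ent: "integrable MM (\<lambda>(x, y). s x y * ln (s x y))"
  shows "integrable MM (\<lambda>(x, y). s x y * ln (s x y / \<rho> x y) - s x y + \<rho> x y)"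
    "(\<integral>(x, y). s x y * ln (s x y / \<rho> x y) - s x y + \<rho> x y \<partial>MM) = Fcost s - \<Lambda>"
    "\<And>x y. 0 \<le> s x y * ln (s x y / \<rho> x y) - s x y + \<rho> x y"
proof -
  note s0 = state_densityD(2)[OF s]
  have "s x y * ln (s x y / \<rho> x y) = s x y * ln (s x y) - s x y * (a x + b y) + s x y * c x y" for x y
  proof (cases "s x y = 0")
    case False
    then have "0 < s x y" using s0[of x y] by simp
    then have "ln (s x y / \<rho> x y) = ln (s x y) - ln (\<rho> x y)"
      using rho_pos[of a b x y] by (intro ln_divide_pos)
    then have "ln (s x y / \<rho> x y) = ln (s x y) - (a x + b y) + c x y" by (simp add: rho_def)
    then show ?thesis by (simp only: distrib_left right_diff_distrib)
  qed simp
  then have e: "(\<lambda>(x, y). s x y * ln (s x y / \<rho> x y) - s x y + \<rho> x y) =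
    (\<lambda>z. (case z of (x, y) \<Rightarrow> s x y * ln (s x y)) - (case z of (x, y) \<Rightarrow> s x y * (a x + b y))
      + (case z of (x, y) \<Rightarrow> s x y * c x y) - case_prod s z + case_prod \<rho> z)"
    by (auto simp: fun_eq_iff)
  note i = ent state_potential[OF s] state_c_integrable[OF s] state_integrable[OF s] state_integrable[OF state_density_\<rho>]
  show "integrable MM (\<lambda>(x, y). s x y * ln (s x y / \<rho> x y) - s x y + \<rho> x y)"
    unfolding e by (intro Bochner_Integration.integrable_add Bochner_Integration.integrable_diff i)
  show "(\<integral>(x, y). s x y * ln (s x y / \<rho> x y) - s x y + \<rho> x y \<partial>MM) = Fcost s - \<Lambda>"
    unfolding e Fcost_def
    by (simp only: Bochner_Integration.integral_add Bochner_Integration.integral_diff i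
        Bochner_Integration.integrable_add Bochner_Integration.integrable_diff)
  show "0 \<le> s x y * ln (s x y / \<rho> x y) - s x y + \<rho> x y" for x y
  proof -
    have "s x y / \<rho> x y - 1 \<le> s x y / \<rho> x y * ln (s x y / \<rho> x y)"
      using s0[of x y] \<rho>_nonneg[of x y] by (intro xlnx_ge) simp
    from mult_left_mono[OF this \<rho>_nonneg[of x y]] show ?thesis
      using rho_pos[of a b x y] by (simp add: algebra_simps)
  qed
qed

text \<open>Nonnegativity of the competitor's relative entropy says that the iterate minimises the
  free energy among plans with its own marginals; this is the direction not covered by
  \<open>optimal_le\<close>.\<close>

lemma Fcost_estimate:
  assumes r: "optimal_density r"
  shows "\<bar>Fcost r - Fcost \<rho>\<bar> \<le> \<delta> + K * t\<^sup>2"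
proof -
  obtain s where s: "state_density s" "integrable MM (\<lambda>(x, y). s x y * ln (s x y))"
    "Fcost s \<le> Fcost r + \<delta> + K * t\<^sup>2"
    "(\<integral>\<^sup>+(x, y). ennreal ((1 + 1 * (\<phi>1 x + \<phi>2 y)) * \<bar>s x y - r x y\<bar>) \<partial>MM)
      \<le> ennreal (2 * (1 * (C1 * t) + 1 * \<omega>) + 1 * (C1 * t))"
    by (rule optimal_shadow[OF r])
  have "0 \<le> (\<integral>(x, y). s x y * ln (s x y / \<rho> x y) - s x y + \<rho> x y \<partial>MM)"
    by (rule integral_nonneg_AE) (use state_relative_entropy(3)[OF s(1,2)] in auto)
  then have "0 \<le> Fcost s - \<Lambda>" using state_relative_entropy(2)[OF s(1,2)] by simp
  then have "\<Lambda> - Fcost r \<le> \<delta> + K * t\<^sup>2" using s(3) by simp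
  moreover have "Fcost r - \<Lambda> \<le> \<delta> + K * t\<^sup>2"
    using optimal_le[OF r] K_nonneg by (simp add: add_increasing2)
  ultimately show ?thesis unfolding \<rho>_entropy(2) by (intro abs_leI) simp_all
qed

text \<open>Triangle inequality through the competitor. Pinsker has the iterate as reference, whose
  second marginal need not have exponential moments, so the weight \<open>\<phi>2\<close> is split
  before Pinsker is applied. The parameter \<open>l\<close> stays free to be balanced against
  \<open>\<delta>\<close>.\<close>

lemma density_estimate:
  assumes r: "optimal_density r" and l: "0 < l" "l \<le> \<alpha> / 2"
  shows "wtv r \<rho>
    \<le> ennreal ((2 * (C1 * t + \<omega>) + C1 * t)
       + (2 * ((2 * \<delta> + K * t\<^sup>2) / l) + l * (8 / \<alpha>\<^sup>2) * (exp \<alpha> * E1 + E2) + 2 * (C1 * t)))"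
proof -
  obtain s where s: "state_density s" and sent: "integrable MM (\<lambda>(x, y). s x y * ln (s x y))"
    and sF: "Fcost s \<le> Fcost r + \<delta> + K * t\<^sup>2"
    and sr: "(\<integral>\<^sup>+(x, y). ennreal ((1 + 1 * (\<phi>1 x + \<phi>2 y)) * \<bar>s x y - r x y\<bar>) \<partial>MM)
      \<le> ennreal (2 * (1 * (C1 * t) + 1 * \<omega>) + 1 * (C1 * t))"
    by (rule optimal_shadow[OF r])
  note sm[measurable] = state_densityD(1)[OF s] and s0 = state_densityD(2)[OF s]
  have [measurable]: "case_prod r \<in> borel_measurable MM"
    using r by (auto simp: optimal_density_def coupling_density_def)
  define g where "g x y = s x y * ln (s x y / \<rho> x y) - s x y + \<rho> x y" for x y
  note gi = state_relative_entropy(1)[OF s sent, folded g_def]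
    and gI = state_relative_entropy(2)[OF s sent, folded g_def] and g0 = state_relative_entropy(3)[OF s sent, folded g_def]
  \<comment> \<open>One \<open>\<delta>\<close> is the cost error of the competitor, the other that
    of \<open>optimal_le\<close>.\<close>
  have gle: "(\<integral>(x, y). g x y \<partial>MM) \<le> 2 * \<delta> + K * t\<^sup>2"
    unfolding gI using sF optimal_le[OF r] by linarith
  \<comment> \<open>On the fraction \<open>h\<close> the marginal \<open>f\<close> is cut down to at
    most 1, so exponential moments of \<open>M2\<close> suffice. The remainder
    \<open>f y * (1 - h y)\<close> is at most the deviation of \<open>f y\<close> from 1, and both
    plans have this same second marginal, so the weighted total variation bound applies to
    each.\<close>
  define h where "h y = min 1 (1 / f y)" for y
  have [measurable]: "h \<in> borel_measurable M2" unfolding h_def[abs_def] by measurable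
  have h01: "0 \<le> h y" "h y \<le> 1" for y using f_pos[of y] by (auto simp: h_def)
  have fh: "f y * h y \<le> 1" "f y * (1 - h y) \<le> \<bar>f y - 1\<bar>" "0 \<le> f y * (1 - h y)" for y
    using f_pos[of y] by (auto simp: h_def min_def field_simps)
  have i1: "integrable M2 (\<lambda>y. f y * (h y * exp (\<alpha> * \<phi>2 y)))"
  proof (rule Bochner_Integration.integrable_bound[OF exp2], measurable, rule AE_I2)
    fix y
    have "f y * (h y * exp (\<alpha> * \<phi>2 y)) \<le> 1 * exp (\<alpha> * \<phi>2 y)"
      unfolding mult.assoc[symmetric] by (intro mult_right_mono fh) simp
    then show "norm (f y * (h y * exp (\<alpha> * \<phi>2 y))) \<le> norm (exp (\<alpha> * \<phi>2 y))"
      using f_nonneg[of y] h01[of y] by simp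
  qed
  have I1: "(\<integral>y. f y * (h y * exp (\<alpha> * \<phi>2 y)) \<partial>M2) \<le> E2"
    unfolding E2_def
  proof (rule integral_mono[OF i1 exp2])
    fix y
    show "f y * (h y * exp (\<alpha> * \<phi>2 y)) \<le> exp (\<alpha> * \<phi>2 y)"
      using mult_right_mono[OF fh(1)[of y], of "exp (\<alpha> * \<phi>2 y)"] by (simp add: mult.assoc)
  qed
  have le2: "f y * ((1 - h y) * \<phi>2 y) \<le> (1 + \<phi>2 y) * \<bar>f y - 1\<bar>" for y
  proof -
    have "f y * ((1 - h y) * \<phi>2 y) = (f y * (1 - h y)) * \<phi>2 y" by simp
    also have "\<dots> \<le> \<bar>f y - 1\<bar> * (1 + \<phi>2 y)" using \<phi>2_nonneg[of y] fh[of y] by (intro mult_mono) auto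
    finally show ?thesis by (simp add: mult.commute)
  qed
  have i2: "integrable M2 (\<lambda>y. f y * ((1 - h y) * \<phi>2 y))"
  proof (rule Bochner_Integration.integrable_bound[OF weighted_tv(1)], measurable, rule AE_I2)
    fix y
    have "0 \<le> f y * ((1 - h y) * \<phi>2 y)" using f_nonneg[of y] h01[of y] \<phi>2_nonneg[of y] by simp
    then show "norm (f y * ((1 - h y) * \<phi>2 y)) \<le> norm ((1 + \<phi>2 y) * \<bar>f y - 1\<bar>)"
      using le2[of y] unfolding real_norm_def by linarith
  qed
  have I2: "(\<integral>y. f y * ((1 - h y) * \<phi>2 y) \<partial>M2) \<le> C1 * t"
    using integral_mono[OF i2 weighted_tv(1) le2] weighted_tv(2) by linarith
  define W where "W z = 2 * ((case z of (x, y) \<Rightarrow> g x y) / l)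
    + l * (8 / \<alpha>\<^sup>2) * (exp \<alpha> * (case z of (x, y) \<Rightarrow> \<rho> x y * exp (\<alpha> * \<phi>1 x)) + (case z of (x, y) \<Rightarrow> \<rho> x y * (h y * exp (\<alpha> * \<phi>2 y))))
    + ((case z of (x, y) \<Rightarrow> s x y * ((1 - h y) * \<phi>2 y)) + (case z of (x, y) \<Rightarrow> \<rho> x y * ((1 - h y) * \<phi>2 y)))" for z
  note j1 = state_fst[OF state_density_\<rho> exp1]
  note j2 = state_snd[OF state_density_\<rho> _ i1, simplified]
  note j3 = state_snd[OF s _ i2, simplified] and j4 = state_snd[OF state_density_\<rho> _ i2, simplified]
  have iW: "integrable MM W"
    unfolding W_def
    by (intro Bochner_Integration.integrable_add integrable_mult_right integrable_divide gi j1(1) j2(1) j3(1) j4(1))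
  have WI: "integral\<^sup>L MM W \<le> 2 * ((2 * \<delta> + K * t\<^sup>2) / l) + l * (8 / \<alpha>\<^sup>2) * (exp \<alpha> * E1 + E2) + 2 * (C1 * t)"
  proof -
    have "integral\<^sup>L MM W = 2 * ((\<integral>(x, y). g x y \<partial>MM) / l)
      + l * (8 / \<alpha>\<^sup>2) * (exp \<alpha> * E1 + (\<integral>y. f y * (h y * exp (\<alpha> * \<phi>2 y)) \<partial>M2))
      + ((\<integral>y. f y * ((1 - h y) * \<phi>2 y) \<partial>M2) + (\<integral>y. f y * ((1 - h y) * \<phi>2 y) \<partial>M2))"
      unfolding W_def E1_def
      by (simp only: Bochner_Integration.integral_add integral_mult_right_zero integral_divide_zero
          Bochner_Integration.integrable_add integrable_mult_right integrable_divide gi j1 j2 j3 j4)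
    also have "\<dots> \<le> 2 * ((2 * \<delta> + K * t\<^sup>2) / l) + l * (8 / \<alpha>\<^sup>2) * (exp \<alpha> * E1 + E2) + (C1 * t + C1 * t)"
      using l by (intro add_mono mult_left_mono divide_right_mono gle I1 I2) auto
    finally show ?thesis by (simp only: mult_2)
  qed
  have W: "(1 + (\<phi>1 x + \<phi>2 y)) * \<bar>s x y - \<rho> x y\<bar> \<le> W (x, y)" for x y
  proof -
    let ?B = "l * (8 / \<alpha>\<^sup>2)"
    have B0: "0 \<le> ?B" using l by simp
    have 1: "(1 + \<phi>1 x) * \<bar>s x y - \<rho> x y\<bar> \<le> g x y / l + ?B * (exp \<alpha> * (\<rho> x y * exp (\<alpha> * \<phi>1 x)))"
      using weighted_pinsker_pointwise[OF l _ s0 rho_pos, of "1 + \<phi>1 x" x y a b x y] \<phi>1_nonneg[of x]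
      by (simp add: g_def distrib_left exp_add mult.left_commute)
    have 2: "\<phi>2 y * \<bar>s x y - \<rho> x y\<bar> \<le> g x y / l + ?B * (\<rho> x y * exp (\<alpha> * \<phi>2 y))"
      using weighted_pinsker_pointwise[OF l \<phi>2_nonneg[of y] s0 rho_pos, of x y a b x y] by (simp add: g_def)
    have "h y * (\<phi>2 y * \<bar>s x y - \<rho> x y\<bar>) \<le> h y * (g x y / l + ?B * (\<rho> x y * exp (\<alpha> * \<phi>2 y)))"
      by (intro mult_left_mono 2 h01)
    also have "\<dots> = h y * (g x y / l) + ?B * (\<rho> x y * (h y * exp (\<alpha> * \<phi>2 y)))" by (simp add: algebra_simps)
    also have "\<dots> \<le> 1 * (g x y / l) + ?B * (\<rho> x y * (h y * exp (\<alpha> * \<phi>2 y)))"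
      using g0[of x y] l by (intro add_right_mono mult_right_mono h01) auto
    finally have 3: "h y * (\<phi>2 y * \<bar>s x y - \<rho> x y\<bar>) \<le> g x y / l + ?B * (\<rho> x y * (h y * exp (\<alpha> * \<phi>2 y)))" by simp
    have "\<bar>s x y - \<rho> x y\<bar> \<le> s x y + \<rho> x y" using s0[of x y] \<rho>_nonneg[of x y] by linarith
    then have "((1 - h y) * \<phi>2 y) * \<bar>s x y - \<rho> x y\<bar> \<le> ((1 - h y) * \<phi>2 y) * (s x y + \<rho> x y)"
      using h01[of y] \<phi>2_nonneg[of y] by (intro mult_left_mono) auto
    then have 4: "((1 - h y) * \<phi>2 y) * \<bar>s x y - \<rho> x y\<bar> \<le> s x y * ((1 - h y) * \<phi>2 y) + \<rho> x y * ((1 - h y) * \<phi>2 y)"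
      by (simp add: algebra_simps)
    have "(1 + (\<phi>1 x + \<phi>2 y)) * \<bar>s x y - \<rho> x y\<bar>
      = (1 + \<phi>1 x) * \<bar>s x y - \<rho> x y\<bar> + h y * (\<phi>2 y * \<bar>s x y - \<rho> x y\<bar>) + ((1 - h y) * \<phi>2 y) * \<bar>s x y - \<rho> x y\<bar>"
      by (simp add: algebra_simps)
    also have "\<dots> \<le> (g x y / l + ?B * (exp \<alpha> * (\<rho> x y * exp (\<alpha> * \<phi>1 x))))
        + (g x y / l + ?B * (\<rho> x y * (h y * exp (\<alpha> * \<phi>2 y))))
        + (s x y * ((1 - h y) * \<phi>2 y) + \<rho> x y * ((1 - h y) * \<phi>2 y))"
      by (intro add_mono 1 3 4)
    also have "\<dots> = W (x, y)" unfolding W_def prod.case by (simp only: distrib_left mult_2 add_ac)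
    finally show ?thesis .
  qed
  have s\<rho>: "wtv s \<rho>
    \<le> ennreal (2 * ((2 * \<delta> + K * t\<^sup>2) / l) + l * (8 / \<alpha>\<^sup>2) * (exp \<alpha> * E1 + E2) + 2 * (C1 * t))"
  proof -
    have nn: "0 \<le> (1 + (\<phi>1 x + \<phi>2 y)) * \<bar>s x y - \<rho> x y\<bar>" for x y using \<phi>1_nonneg[of x] \<phi>2_nonneg[of y] by simp
    have W0: "0 \<le> W z" for z using order_trans[OF nn W, of "fst z" "snd z"] by simp
    have "wtv s \<rho> \<le> (\<integral>\<^sup>+z. ennreal (W z) \<partial>MM)"
      by (intro nn_integral_mono) (use W in \<open>auto intro!: ennreal_leI\<close>)
    also have "\<dots> = ennreal (integral\<^sup>L MM W)" by (rule nn_integral_eq_integral[OF iW AE_I2[OF W0]])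
    also have "\<dots> \<le> ennreal (2 * ((2 * \<delta> + K * t\<^sup>2) / l) + l * (8 / \<alpha>\<^sup>2) * (exp \<alpha> * E1 + E2) + 2 * (C1 * t))"
      by (rule ennreal_leI[OF WI])
    finally show ?thesis .
  qed
  have "wtv r \<rho>
    \<le> (\<integral>\<^sup>+z. (case z of (x, y) \<Rightarrow> ennreal ((1 + (\<phi>1 x + \<phi>2 y)) * \<bar>s x y - r x y\<bar>))
       + (case z of (x, y) \<Rightarrow> ennreal ((1 + (\<phi>1 x + \<phi>2 y)) * \<bar>s x y - \<rho> x y\<bar>)) \<partial>MM)"
  proof (rule nn_integral_mono)
    fix z :: "'a \<times> 'b"
    obtain x y where z: "z = (x, y)" by (cases z)
    have p: "0 \<le> 1 + (\<phi>1 x + \<phi>2 y)" using \<phi>1_nonneg[of x] \<phi>2_nonneg[of y] by simp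
    have "(1 + (\<phi>1 x + \<phi>2 y)) * \<bar>r x y - \<rho> x y\<bar> \<le> (1 + (\<phi>1 x + \<phi>2 y)) * (\<bar>s x y - r x y\<bar> + \<bar>s x y - \<rho> x y\<bar>)"
      using p by (intro mult_left_mono) auto
    then show "(case z of (x, y) \<Rightarrow> ennreal ((1 + (\<phi>1 x + \<phi>2 y)) * \<bar>r x y - \<rho> x y\<bar>))
      \<le> (case z of (x, y) \<Rightarrow> ennreal ((1 + (\<phi>1 x + \<phi>2 y)) * \<bar>s x y - r x y\<bar>))
       + (case z of (x, y) \<Rightarrow> ennreal ((1 + (\<phi>1 x + \<phi>2 y)) * \<bar>s x y - \<rho> x y\<bar>))"
      unfolding z prod.case using p by (subst ennreal_plus[symmetric]) (auto intro!: ennreal_leI simp: distrib_left simp del: ennreal_plus)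
  qed
  also have "\<dots> = wtv s r
     + wtv s \<rho>"
    by (rule nn_integral_add) measurable
  also have "\<dots> \<le> ennreal (2 * (C1 * t + \<omega>) + C1 * t)
     + ennreal (2 * ((2 * \<delta> + K * t\<^sup>2) / l) + l * (8 / \<alpha>\<^sup>2) * (exp \<alpha> * E1 + E2) + 2 * (C1 * t))"
    using sr s\<rho> by (intro add_mono) simp_all
  also have "\<dots> = ennreal ((2 * (C1 * t + \<omega>) + C1 * t)
       + (2 * ((2 * \<delta> + K * t\<^sup>2) / l) + l * (8 / \<alpha>\<^sup>2) * (exp \<alpha> * E1 + E2) + 2 * (C1 * t)))"
    using C1_nonneg \<omega>_nonneg \<delta>_nonneg K_nonneg E_nonneg t l
    by (intro ennreal_plus[symmetric] add_nonneg_nonneg mult_nonneg_nonneg divide_nonneg_nonneg) auto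
  finally show ?thesis .
qed

end

section \<open>Absorbing the logarithm and balancing the exponents\<close>

lemma t_ln_bound:
  fixes t \<sigma> :: real
  assumes "0 < t" "t \<le> 1" "\<sigma> < 1"
  shows "t * ln (1 / t) \<le> t powr \<sigma> / (1 - \<sigma>)"
proof -
  have "ln (1 / t) \<le> (1 / t) powr (1 - \<sigma>) / (1 - \<sigma>)"
    using assms by (intro ln_powr_bound) auto
  also have "(1 / t) powr (1 - \<sigma>) = t powr (\<sigma> - 1)"
    using assms by (simp add: powr_divide powr_minus_divide[symmetric])
  finally have "t * ln (1 / t) \<le> t * (t powr (\<sigma> - 1) / (1 - \<sigma>))" using assms by (intro mult_left_mono) auto
  also have "\<dots> = t powr \<sigma> / (1 - \<sigma>)" using assms by (simp add: powr_diff)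
  finally show ?thesis .
qed

text \<open>The constant is fixed before the potentials and \<open>n\<close>: for t = n^(-1/2) all
  previous constants depend only on the locale data and \<open>K\<close>. With q = t^(\<sigma>/2)
  the cost error is of order q^2, and an \<open>l\<close> of order q balances cost error / l against
  l.\<close>

lemma (in cost_space) core_rate:
  assumes K: "0 \<le> K" and \<sigma>: "0 < \<sigma>" "\<sigma> \<le> 1" and B\<sigma>: "\<sigma> < 1 \<or> B1 = 0"
  obtains C where "0 \<le> C" "\<And>a b r n. 1 \<le> n \<Longrightarrow> good a b \<Longrightarrow>
    AE x in M1. margin1 (rho a b) x = 1 \<Longrightarrow>
    integrable M2 (\<lambda>y. margY a b y * ln (margY a b y)) \<Longrightarrow>
    (\<integral>y. margY a b y * ln (margY a b y) \<partial>M2) \<le> K / real n \<Longrightarrow> optimal_density r \<Longrightarrow>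
    rate_bound C \<sigma> n r (rho a b)"
proof -
  define e1 where "e1 = (\<integral>x. exp (\<alpha> * \<phi>1 x) \<partial>M1)"
  define e2 where "e2 = (\<integral>y. exp (\<alpha> * \<phi>2 y) \<partial>M2)"
  define c1 where "c1 = 2 * K / \<alpha> + 4 * exp \<alpha> * e2 / \<alpha>"
  \<comment> \<open>The constant of \<open>t_ln_bound\<close>; for \<open>B1 = 0\<close> the
    logarithm is multiplied by 0, so \<sigma> = 1 is allowed.\<close>
  define L where "L = (if B1 = 0 then 0 else 1 / (1 - \<sigma>))"
  define D where "D = 2 * (B0 * c1 + B1 * (2 / \<alpha> * (c1 * L + e1))) + B1 * c1"
  define C2 where "C2 = (2 * (c1 + 2 / \<alpha> * (c1 * 2 + e1)) + c1) + (2 * ((2 * D + K) * (2 / \<alpha>)) + 4 / \<alpha> * (exp \<alpha> * e1 + e2) + 2 * c1)"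
  have e0: "0 \<le> e1" "0 \<le> e2" unfolding e1_def e2_def by (auto intro!: integral_nonneg_AE)
  have c10: "0 \<le> c1" unfolding c1_def using K e0 \<alpha>_pos by simp
  have L0: "0 \<le> L" unfolding L_def using B\<sigma> by auto
  have D0: "0 \<le> D" unfolding D_def using c10 L0 e0 B_nonneg \<alpha>_pos by simp
  have C20: "0 \<le> C2" unfolding C2_def using c10 D0 K e0 \<alpha>_pos by simp
  show thesis
  proof (rule that[of "(D + K) + C2"])
    show "0 \<le> (D + K) + C2" using D0 K C20 by simp
    fix a b r and n :: nat
    assume n: "1 \<le> n" and g: "good a b" and mt: "AE x in M1. margin1 (rho a b) x = 1"
      and ent: "integrable M2 (\<lambda>y. margY a b y * ln (margY a b y))"
      and entle: "(\<integral>y. margY a b y * ln (margY a b y) \<partial>M2) \<le> K / real n" and r: "optimal_density r"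
    define t where "t = real n powr (- 1 / 2)"
    \<comment> \<open>The marginal is positive only almost everywhere: its Bochner integral is 0
      where a section fails to be integrable.\<close>
    define f where "f y = (if 0 < margY a b y then margY a b y else 1)" for y
    note [measurable] = goodD(3,4)[OF g]
    have t: "0 < t" "t \<le> 1"
      using n powr_mono[of "- 1 / 2" 0 "real n"] by (simp_all add: t_def)
    have t2: "t\<^sup>2 = 1 / real n"
      using n by (simp add: t_def power2_eq_square powr_minus_divide flip: powr_add)
    have fm: "AE y in M2. margY a b y = f y"
      using marg_basic(5)[OF g] by eventually_elim (simp add: f_def)
    have fm': "AE y in M2. margY a b y * ln (margY a b y) = f y * ln (f y)"
      using fm by eventually_elim simp
    have [measurable]: "f \<in> borel_measurable M2" unfolding f_def[abs_def] by measurable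
    interpret S: sinkhorn_state M1 M2 c \<phi>1 \<phi>2 \<alpha> B0 B1 a b f K t
    proof
      show "good a b" by fact
      show "AE x in M1. margin1 (rho a b) x = 1" by fact
      show "f \<in> borel_measurable M2" by measurable
      show "0 < f y" for y by (simp add: f_def)
      show "AE y in M2. margin2 (rho a b) y = ennreal (f y)"
        using marg_basic(2)[OF g] fm by eventually_elim simp
      show "integrable M2 (\<lambda>y. f y * ln (f y))"
        by (rule integrable_cong_AE_imp[OF ent]) (use fm' in auto)
      have "(\<integral>y. f y * ln (f y) \<partial>M2) = (\<integral>y. margY a b y * ln (margY a b y) \<partial>M2)"
        by (rule integral_cong_AE) (use fm' in auto)
      then show "(\<integral>y. f y * ln (f y) \<partial>M2) \<le> K * t\<^sup>2" using entle t2 by simp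
      show "0 < t" "t \<le> 1" by fact+
    qed
    have C1: "S.C1 = c1" by (simp add: S.C1_def S.E2_def c1_def e2_def)
    have \<omega>: "S.\<omega> = 2 / \<alpha> * (c1 * (t * ln (1 / t)) + e1 * t)"
      by (simp add: S.\<omega>_def C1 S.E1_def e1_def algebra_simps)
    define q where "q = t powr (\<sigma> / 2)"
    have q: "0 < q" "q \<le> 1" using t \<sigma> by (auto simp: q_def intro!: powr_le1)
    have q2: "t powr \<sigma> = q * q" unfolding q_def using t by (simp flip: powr_add)
    have tq2: "t \<le> q * q" using powr_mono'[of \<sigma> 1 t] t \<sigma> by (simp flip: q2)
    have tq: "t \<le> q" using tq2 q mult_left_le[of q q] by linarith
    have tt: "t\<^sup>2 \<le> q * q" using tq2 t by (intro order_trans[OF _ tq2]) (simp add: power2_eq_square mult_left_le)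
    \<comment> \<open>The transport estimate needs the logarithmic term only to order q, which
      t^(1/2) never exceeds, so this holds even for \<sigma> = 1. The cost estimate needs order q^2;
      there the alternative in \<open>B\<sigma>\<close> enters.\<close>
    have lnq: "t * ln (1 / t) \<le> 2 * q"
    proof -
      have "t * ln (1 / t) \<le> t powr (1/2) / (1 - 1/2)" by (rule t_ln_bound) (use t in auto)
      also have "\<dots> = 2 * t powr (1/2)" by simp
      also have "t powr (1/2) \<le> q" unfolding q_def using t \<sigma> by (intro powr_mono') auto
      finally show ?thesis by simp
    qed
    have Blnq: "B1 * (t * ln (1 / t)) \<le> B1 * (L * (q * q))"
    proof (cases "B1 = 0")
      case False
      then have "t * ln (1 / t) \<le> t powr \<sigma> / (1 - \<sigma>)" using B\<sigma> t by (intro t_ln_bound) auto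
      then show ?thesis using False B_nonneg by (intro mult_left_mono) (auto simp: L_def q2)
    qed simp
    have \<omega>q: "S.\<omega> \<le> 2 / \<alpha> * (c1 * 2 + e1) * q"
    proof -
      have "S.\<omega> \<le> 2 / \<alpha> * (c1 * (2 * q) + e1 * q)"
        unfolding \<omega> using \<alpha>_pos by (intro mult_left_mono add_mono lnq tq c10 e0) auto
      then show ?thesis by (simp add: algebra_simps)
    qed
    have B\<omega>: "B1 * S.\<omega> \<le> B1 * (2 / \<alpha> * (c1 * L + e1)) * (q * q)"
    proof -
      have "B1 * S.\<omega> = 2 / \<alpha> * (c1 * (B1 * (t * ln (1 / t))) + B1 * e1 * t)" by (simp add: \<omega> algebra_simps)
      also have "\<dots> \<le> 2 / \<alpha> * (c1 * (B1 * (L * (q * q))) + B1 * e1 * (q * q))"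
        using \<alpha>_pos B_nonneg e0 by (intro mult_left_mono add_mono Blnq tq2 c10 mult_nonneg_nonneg) auto
      also have "\<dots> = B1 * (2 / \<alpha> * (c1 * L + e1)) * (q * q)" by (simp add: field_simps)
      finally show ?thesis .
    qed
    have \<delta>q: "S.\<delta> \<le> D * (q * q)"
    proof -
      have "S.\<delta> = 2 * ((B0 * c1) * t + B1 * S.\<omega>) + (B1 * c1) * t" by (simp add: S.\<delta>_def C1)
      also have "\<dots> \<le> 2 * ((B0 * c1) * (q * q) + B1 * (2 / \<alpha> * (c1 * L + e1)) * (q * q)) + (B1 * c1) * (q * q)"
        using B_nonneg c10 by (intro add_mono mult_left_mono tq2 B\<omega> mult_nonneg_nonneg) auto
      also have "\<dots> = D * (q * q)" by (simp add: D_def algebra_simps)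
      finally show ?thesis .
    qed
    have Kt: "K * t\<^sup>2 \<le> K * (q * q)" using K tt by (intro mult_left_mono)
    have nq: "real n powr (- \<sigma> / 4) = q" "real n powr (- \<sigma> / 2) = q * q"
      unfolding q2[symmetric] by (simp_all add: q_def t_def powr_powr)
    have A: "\<bar>Fcost r - Fcost (rho a b)\<bar> \<le> (D + K) * (q * q)"
      using S.Fcost_estimate[OF r] \<delta>q Kt by (simp add: algebra_simps)
    let ?l = "\<alpha> / 2 * q"
    have l: "0 < ?l" "?l \<le> \<alpha> / 2" using \<alpha>_pos q by auto
    have "(2 * (S.C1 * t + S.\<omega>) + S.C1 * t)
       + (2 * ((2 * S.\<delta> + K * t\<^sup>2) / ?l) + ?l * (8 / \<alpha>\<^sup>2) * (exp \<alpha> * S.E1 + S.E2) + 2 * (S.C1 * t))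
      \<le> (2 * (c1 * q + 2 / \<alpha> * (c1 * 2 + e1) * q) + c1 * q)
       + (2 * ((2 * (D * (q * q)) + K * (q * q)) / ?l) + ?l * (8 / \<alpha>\<^sup>2) * (exp \<alpha> * e1 + e2) + 2 * (c1 * q))"
      unfolding C1 S.E1_def S.E2_def e1_def[symmetric] e2_def[symmetric] using l
      by (intro add_mono mult_left_mono divide_right_mono tq \<omega>q \<delta>q Kt c10 order_refl) auto
    also have "\<dots> = C2 * q"
    proof -
      have "(2 * (D * (q * q)) + K * (q * q)) / ?l = (2 * D + K) * (2 / \<alpha>) * q"
        using q \<alpha>_pos by (simp add: field_simps)
      moreover have "?l * (8 / \<alpha>\<^sup>2) = 4 / \<alpha> * q" using \<alpha>_pos by (simp add: power2_eq_square)
      ultimately show ?thesis unfolding C2_def by (simp add: algebra_simps)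
    qed
    finally have Bd: "wtv r (rho a b) \<le> ennreal (C2 * q)"
      using S.density_estimate[OF r l] by (meson ennreal_leI order_trans)
    have "(D + K) * (q * q) \<le> ((D + K) + C2) * (q * q)" "C2 * q \<le> ((D + K) + C2) * q"
      using D0 K C20 q by (auto intro!: mult_right_mono)
    then show "rate_bound ((D + K) + C2) \<sigma> n r (rho a b)"
      unfolding nq using A Bd S.state_c_integrable[OF S.state_density_\<rho>] S.\<rho>_entropy(1)
      by (meson ennreal_leI order_trans)
  qed
qed

section \<open>Sinkhorn iterates and couplings as densities\<close>

context cost_space
begin

lemma coupling_density_swap:
  assumes s: "coupling_density s"
  shows "cost_space.coupling_density M2 M1 (\<lambda>y x. s x y)"
proof -
  interpret S: cost_space M2 M1 "\<lambda>y x. c x y" \<phi>2 \<phi>1 \<alpha> B0 B1 by (rule cost_space_swap)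
  have m: "case_prod s \<in> borel_measurable MM" using s by (simp add: coupling_density_def)
  have "case_prod (\<lambda>y x. s x y) \<in> borel_measurable (M2 \<Otimes>\<^sub>M M1)"
    using measurable_pair_swap[OF m] by (simp add: case_prod_beta')
  moreover have "integrable (M2 \<Otimes>\<^sub>M M1) (\<lambda>(y, x). s x y * ln (s x y))"
    using integrable_product_swap[of "\<lambda>(x, y). s x y * ln (s x y)"] s by (simp add: coupling_density_def)
  ultimately show ?thesis using s by (simp add: coupling_density_def S.coupling_density_def)
qed

lemma Fcost_swap:
  assumes [measurable]: "case_prod s \<in> borel_measurable MM"
  shows "cost_space.Fcost M2 M1 (\<lambda>y x. c x y) (\<lambda>y x. s x y) = Fcost s"
proof -
  interpret S: cost_space M2 M1 "\<lambda>y x. c x y" \<phi>2 \<phi>1 \<alpha> B0 B1 by (rule cost_space_swap)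
  show ?thesis
    using integral_product_swap[of "\<lambda>(x, y). s x y * c x y"] integral_product_swap[of "\<lambda>(x, y). s x y * ln (s x y)"]
    by (simp add: S.Fcost_def Fcost_def)
qed

lemma optimal_density_swap:
  assumes r: "optimal_density r"
  shows "cost_space.optimal_density M2 M1 (\<lambda>y x. c x y) (\<lambda>y x. r x y)"
proof -
  interpret S: cost_space M2 M1 "\<lambda>y x. c x y" \<phi>2 \<phi>1 \<alpha> B0 B1 by (rule cost_space_swap)
  have cr: "coupling_density r" using r by (simp add: optimal_density_def)
  have "S.Fcost (\<lambda>y x. r x y) \<le> S.Fcost s" if s: "S.coupling_density s" for s
  proof -
    have s': "coupling_density (\<lambda>x y. s y x)" using S.coupling_density_swap[OF s] .
    then have "Fcost r \<le> Fcost (\<lambda>x y. s y x)" using r by (simp add: optimal_density_def)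
    moreover have "S.Fcost (\<lambda>y x. r x y) = Fcost r"
      by (rule Fcost_swap) (use cr in \<open>simp add: coupling_density_def\<close>)
    moreover have "S.Fcost s = Fcost (\<lambda>x y. s y x)"
      using Fcost_swap[of "\<lambda>x y. s y x"] s' by (simp add: coupling_density_def)
    ultimately show ?thesis by simp
  qed
  then show ?thesis using coupling_density_swap[OF cr] by (simp add: S.optimal_density_def)
qed

lemma c_integral_nonneg: "0 \<le> (\<integral>(x, y). c x y \<partial>MM)"
  by (rule integral_nonneg_AE) (auto simp: c_nonneg)

abbreviation "srho n \<equiv> rho (pa n) (pb n)"

lemma srho_meas[measurable]: "case_prod (srho n) \<in> borel_measurable MM"
  by (rule rho_meas[OF goodD(3,4)[OF good_pots]])

text \<open>Odd iterates match the first marginal and fall under \<open>core_rate\<close> directly;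
  even ones do so after exchanging the factors.\<close>

lemma sinkhorn_rate:
  assumes \<sigma>: "0 < \<sigma>" "\<sigma> \<le> 1" and B\<sigma>: "\<sigma> < 1 \<or> B1 = 0"
  obtains C where "0 \<le> C" "\<And>r n. 2 \<le> n \<Longrightarrow> optimal_density r \<Longrightarrow>
    rate_bound C \<sigma> n r (srho n)"
proof -
  interpret S: cost_space M2 M1 "\<lambda>y x. c x y" \<phi>2 \<phi>1 \<alpha> B0 B1 by (rule cost_space_swap)
  let ?K = "4 * (\<integral>(x, y). c x y \<partial>MM)"
  have K: "0 \<le> ?K" using c_integral_nonneg by simp
  obtain C1 where C1: "0 \<le> C1" "\<And>a b r n. 1 \<le> n \<Longrightarrow> good a b \<Longrightarrow>
    AE x in M1. margin1 (rho a b) x = 1 \<Longrightarrow>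
    integrable M2 (\<lambda>y. margY a b y * ln (margY a b y)) \<Longrightarrow>
    (\<integral>y. margY a b y * ln (margY a b y) \<partial>M2) \<le> ?K / real n \<Longrightarrow> optimal_density r \<Longrightarrow>
    rate_bound C1 \<sigma> n r (rho a b)"
    using core_rate[OF K \<sigma> B\<sigma>] by blast
  obtain C2 where C2: "0 \<le> C2" "\<And>a b r n. 1 \<le> n \<Longrightarrow> S.good a b \<Longrightarrow>
    AE x in M2. S.margin1 (S.rho a b) x = 1 \<Longrightarrow>
    integrable M1 (\<lambda>y. S.margY a b y * ln (S.margY a b y)) \<Longrightarrow>
    (\<integral>y. S.margY a b y * ln (S.margY a b y) \<partial>M1) \<le> ?K / real n \<Longrightarrow> S.optimal_density r \<Longrightarrow>
    S.rate_bound C2 \<sigma> n r (S.rho a b)"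
    using S.core_rate[OF K \<sigma> B\<sigma>] by blast
  show thesis
  proof (rule that[of "max C1 C2"])
    show "0 \<le> max C1 C2" using C1(1) by simp
    fix r and n :: nat
    assume n: "2 \<le> n" and r: "optimal_density r"
    have [measurable]: "case_prod r \<in> borel_measurable MM"
      using r by (simp add: optimal_density_def coupling_density_def)
    note rate = ent_fwd_rate[OF n]
    have "\<exists>C\<le>max C1 C2. rate_bound C \<sigma> n r (srho n)"
    proof (cases "even n")
      case False
      have "1 \<le> n" using n by simp
      from C1(2)[OF this good_pots pots_matched_fst[OF False] _ _ r] rate False
      show ?thesis by (intro exI[of _ C1]) (auto simp: ent_finite_def ent_fwd_def)
    next
      case True
      have n1: "1 \<le> n" using n by simp
      have mt: "AE y in M2. (\<integral>\<^sup>+x. ennreal (S.rho (pb n) (pa n) y x) \<partial>M1) = 1"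
        using pots_matched_snd[OF True] n by (simp add: rho_swap)
      have R: "S.rho (pb n) (pa n) = (\<lambda>y x. srho n x y)" by (intro ext) (rule rho_swap)
      note * = C2(2)[OF n1 good_swap[OF good_pots] mt _ _ optimal_density_swap[OF r], unfolded R]
      have **: "S.rate_bound C2 \<sigma> n (\<lambda>y x. r x y) (\<lambda>y x. srho n x y)"
        using rate True by (intro *) (simp_all add: ent_finite_def ent_fwd_def)
      have 1: "integrable MM (\<lambda>(x, y). srho n x y * c x y)"
        using S.integrable_product_swap[OF **[THEN conjunct1]] by simp
      have 2: "integrable MM (\<lambda>(x, y). srho n x y * ln (srho n x y))"
        using S.integrable_product_swap[OF **[THEN conjunct2, THEN conjunct1]] by simp
      have 3: "\<bar>Fcost r - Fcost (srho n)\<bar> \<le> C2 * real n powr (- \<sigma> / 2)"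
        using ** by (simp add: Fcost_swap)
      have "(\<integral>\<^sup>+(y, x). ennreal ((1 + (\<phi>1 x + \<phi>2 y)) * \<bar>r x y - srho n x y\<bar>) \<partial>(M2 \<Otimes>\<^sub>M M1))
        = wtv r (srho n)"
        by (rule nn_integral_swap) measurable
      then have 4: "wtv r (srho n)
        \<le> ennreal (C2 * real n powr (- \<sigma> / 4))"
        using **[THEN conjunct2, THEN conjunct2, THEN conjunct2] by (simp add: add.commute)
      show ?thesis using 1 2 3 4 by (intro exI[of _ C2]) simp
    qed
    then obtain C where C: "C \<le> max C1 C2" and H: "integrable MM (\<lambda>(x, y). srho n x y * c x y)"
      "integrable MM (\<lambda>(x, y). srho n x y * ln (srho n x y))"
      "\<bar>Fcost r - Fcost (srho n)\<bar> \<le> C * real n powr (- \<sigma> / 2)"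
      "wtv r (srho n)
        \<le> ennreal (C * real n powr (- \<sigma> / 4))" by blast
    have "C * real n powr (- \<sigma> / 2) \<le> max C1 C2 * real n powr (- \<sigma> / 2)"
      "C * real n powr (- \<sigma> / 4) \<le> max C1 C2 * real n powr (- \<sigma> / 4)"
      using C by (intro mult_right_mono; simp)+
    with H show "rate_bound (max C1 C2) \<sigma> n r (srho n)"
      by (meson ennreal_leI order_trans)
  qed
qed

end

section \<open>Radon-Nikodym derivatives and the iterates as densities\<close>

lemma RN_deriv_density_self:
  fixes f :: "'a \<Rightarrow> real"
  assumes "prob_space M" and f[measurable]: "f \<in> borel_measurable M" and pos: "AE x in M. 0 < f x"
    and P: "prob_space (density M (\<lambda>x. ennreal (f x)))"
  shows "AE x in M. RN_deriv (density M (\<lambda>x. ennreal (f x))) M x = ennreal (1 / f x)"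
proof -
  interpret N: prob_space "density M (\<lambda>x. ennreal (f x))" by (rule P)
  \<comment> \<open>Positivity almost everywhere makes the two measures equivalent, so the
    reciprocal density leads back to \<open>M\<close>; uniqueness of the derivative does the
    rest.\<close>
  have "density (density M (\<lambda>x. ennreal (f x))) (\<lambda>x. ennreal (1 / f x)) = density M (\<lambda>x. ennreal (f x) * ennreal (1 / f x))"
    by (rule density_density_eq) measurable
  also have "\<dots> = density M (\<lambda>x. 1)"
    by (rule density_cong) (use pos in \<open>auto elim!: eventually_mono simp flip: ennreal_mult\<close>)
  finally have "density (density M (\<lambda>x. ennreal (f x))) (\<lambda>x. ennreal (1 / f x)) = M" by (simp add: density_1)
  from N.RN_deriv_unique[OF _ this] have "AE x in density M (\<lambda>x. ennreal (f x)). ennreal (1 / f x) = RN_deriv (density M (\<lambda>x. ennreal (f x))) M x"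
    by simp
  then have "AE x in M. 0 < ennreal (f x) \<longrightarrow> ennreal (1 / f x) = RN_deriv (density M (\<lambda>x. ennreal (f x))) M x"
    by (subst (asm) AE_density) auto
  with pos show ?thesis by eventually_elim auto
qed

lemma ext_integral_integrable:
  assumes f: "integrable M f"
  shows "ext_integral M f = ereal (\<integral>x. f x \<partial>M)"
proof -
  have 1: "(\<integral>\<^sup>+x. ennreal (max 0 (f x)) \<partial>M) = ennreal (\<integral>x. max 0 (f x) \<partial>M)"
    and 2: "(\<integral>\<^sup>+x. ennreal (max 0 (- f x)) \<partial>M) = ennreal (\<integral>x. max 0 (- f x) \<partial>M)"
    by (rule nn_integral_eq_integral; use f in simp)+
  have "(\<integral>x. max 0 (f x) \<partial>M) - (\<integral>x. max 0 (- f x) \<partial>M) = (\<integral>x. max 0 (f x) - max 0 (- f x) \<partial>M)"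
    using f by (intro Bochner_Integration.integral_diff[symmetric]) auto
  also have "(\<lambda>x. max 0 (f x) - max 0 (- f x)) = f" by (auto simp: fun_eq_iff max_def)
  finally show ?thesis
    unfolding ext_integral_def 1 2
    by (subst (1 2) enn2ereal_ennreal) (auto intro!: integral_nonneg_AE)
qed

locale borel_cost_space = cost_space M1 M2 c \<phi>1 \<phi>2 \<alpha> B0 B1
  for M1 :: "'a::polish_space measure" and M2 :: "'b::polish_space measure" and c \<phi>1 \<phi>2 \<alpha> B0 B1 +
  assumes sets1: "sets M1 = sets borel" and sets2: "sets M2 = sets borel"
begin

lemma sets_M: "sets MM = sets (borel :: ('a \<times> 'b) measure)"
  by (metis borel_prod sets_pair_measure_cong sets1 sets2)

abbreviation "dens s \<equiv> density MM (\<lambda>z. ennreal (case_prod s z))"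

lemma fst_meas: "fst \<in> measurable MM borel" "snd \<in> measurable MM borel"
  using measurable_fst[of M1 M2] measurable_snd[of M1 M2]
  by (simp_all add: measurable_cong_sets[OF refl sets1] measurable_cong_sets[OF refl sets2])

lemma distr_dens_fst:
  assumes s[measurable]: "case_prod s \<in> borel_measurable MM"
  shows "distr (dens s) borel fst = density M1 (\<lambda>x. \<integral>\<^sup>+y. ennreal (s x y) \<partial>M2)"
proof (rule measure_eqI)
  show "sets (distr (dens s) borel fst) = sets (density M1 (\<lambda>x. \<integral>\<^sup>+y. ennreal (s x y) \<partial>M2))" by (simp add: sets1)
  fix A assume "A \<in> sets (distr (dens s) borel fst)"
  then have A: "A \<in> sets borel" and A1[measurable]: "A \<in> sets M1" by (simp_all add: sets1)
  have "emeasure (distr (dens s) borel fst) A = emeasure (dens s) (fst -` A \<inter> space MM)"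
    using fst_meas A by (subst emeasure_distr) auto
  also have "\<dots> = (\<integral>\<^sup>+z. ennreal (case_prod s z) * indicator (fst -` A \<inter> space MM) z \<partial>MM)"
    by (rule emeasure_density) (use fst_meas A in \<open>auto intro!: measurable_sets\<close>)
  also have "\<dots> = (\<integral>\<^sup>+z. (case z of (x, y) \<Rightarrow> ennreal (s x y) * indicator A x) \<partial>MM)"
    by (rule nn_integral_cong) (auto simp: indicator_def split: prod.splits)
  also have "\<dots> = (\<integral>\<^sup>+x. \<integral>\<^sup>+y. ennreal (s x y) * indicator A x \<partial>M2 \<partial>M1)"
    by (subst M2.nn_integral_fst[symmetric]) auto
  also have "\<dots> = (\<integral>\<^sup>+x. margin1 s x * indicator A x \<partial>M1)"
    by (rule nn_integral_cong) (simp add: nn_integral_multc)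
  also have "\<dots> = emeasure (density M1 (\<lambda>x. \<integral>\<^sup>+y. ennreal (s x y) \<partial>M2)) A"
    by (subst emeasure_density) auto
  finally show "emeasure (distr (dens s) borel fst) A = emeasure (density M1 (\<lambda>x. \<integral>\<^sup>+y. ennreal (s x y) \<partial>M2)) A" .
qed

lemma distr_dens_snd:
  assumes s[measurable]: "case_prod s \<in> borel_measurable MM"
  shows "distr (dens s) borel snd = density M2 (\<lambda>y. \<integral>\<^sup>+x. ennreal (s x y) \<partial>M1)"
proof (rule measure_eqI)
  show "sets (distr (dens s) borel snd) = sets (density M2 (\<lambda>y. \<integral>\<^sup>+x. ennreal (s x y) \<partial>M1))" by (simp add: sets2)
  fix A assume "A \<in> sets (distr (dens s) borel snd)"
  then have A: "A \<in> sets borel" and A1[measurable]: "A \<in> sets M2" by (simp_all add: sets2)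
  have "emeasure (distr (dens s) borel snd) A = emeasure (dens s) (snd -` A \<inter> space MM)"
    using fst_meas A by (subst emeasure_distr) auto
  also have "\<dots> = (\<integral>\<^sup>+z. ennreal (case_prod s z) * indicator (snd -` A \<inter> space MM) z \<partial>MM)"
    by (rule emeasure_density) (use fst_meas A in \<open>auto intro!: measurable_sets\<close>)
  also have "\<dots> = (\<integral>\<^sup>+z. (case z of (x, y) \<Rightarrow> ennreal (s x y) * indicator A y) \<partial>MM)"
    by (rule nn_integral_cong) (auto simp: indicator_def split: prod.splits)
  also have "\<dots> = (\<integral>\<^sup>+y. \<integral>\<^sup>+x. ennreal (s x y) * indicator A y \<partial>M1 \<partial>M2)"
    by (subst nn_integral_snd[symmetric]) auto
  also have "\<dots> = (\<integral>\<^sup>+y. margin2 s y * indicator A y \<partial>M2)"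
    by (rule nn_integral_cong) (simp add: nn_integral_multc)
  also have "\<dots> = emeasure (density M2 (\<lambda>y. \<integral>\<^sup>+x. ennreal (s x y) \<partial>M1)) A"
    by (subst emeasure_density) auto
  finally show "emeasure (distr (dens s) borel snd) A = emeasure (density M2 (\<lambda>y. \<integral>\<^sup>+x. ennreal (s x y) \<partial>M1)) A" .
qed

lemma prob_space_density_marg:
  assumes "good a b"
  shows "prob_space (density M2 (\<lambda>y. ennreal (margY a b y)))"
proof
  have "(\<integral>\<^sup>+y. ennreal (margY a b y) \<partial>M2) = 1"
    using nn_integral_eq_integral[OF marg_basic(3)[OF assms]] marg_basic(4)[OF assms] by (simp add: marg_nonneg)
  then show "emeasure (density M2 (\<lambda>y. ennreal (margY a b y))) (space (density M2 (\<lambda>y. ennreal (margY a b y)))) = 1"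
    using goodD(3,4)[OF assms] by (simp add: emeasure_density)
qed

text \<open>The derivative in the update is the reciprocal of the marginal density, so the update is
  a subtraction of its logarithm from \<open>b\<close>.\<close>

lemma density_step_snd:
  assumes g: "good a b"
  shows "density (dens (rho a b)) (\<lambda>z. RN_deriv (distr (dens (rho a b)) borel snd) M2 (snd z))
    = dens (rho a (\<lambda>y. b y - ln (margY a b y)))"
proof -
  note [measurable] = goodD(3,4)[OF g]
  let ?f = "margY a b" and ?b' = "\<lambda>y. b y - ln (margY a b y)"
  have d: "distr (dens (rho a b)) borel snd = density M2 (\<lambda>y. ennreal (?f y))"
    by (subst distr_dens_snd, measurable, rule density_cong) (use marg_basic(2)[OF g] in auto)
  have rn: "AE y in M2. RN_deriv (density M2 (\<lambda>y. ennreal (?f y))) M2 y = ennreal (1 / ?f y)"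
    by (rule RN_deriv_density_self)
       (use M2.prob_space_axioms prob_space_density_marg[OF g] marg_basic(5)[OF g] in auto)
  have [measurable]: "RN_deriv (density M2 (\<lambda>y. ennreal (?f y))) M2 \<in> borel_measurable M2"
    using borel_measurable_RN_deriv[of "density M2 (\<lambda>y. ennreal (?f y))" M2] by simp
  have "AE y in M2. \<forall>x. ennreal (rho a b x y) * RN_deriv (density M2 (\<lambda>y. ennreal (?f y))) M2 y = ennreal (rho a ?b' x y)"
    using rn good_step(4)[OF g] marg_basic(5)[OF g]
    by eventually_elim (auto simp: rho_pos less_imp_le simp flip: ennreal_mult)
  then have "AE z in MM. ennreal (rho a b (fst z) (snd z)) * RN_deriv (density M2 (\<lambda>y. ennreal (?f y))) M2 (snd z) = ennreal (rho a ?b' (fst z) (snd z))"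
    by (intro AE_pair_measure) (auto elim!: eventually_mono)
  then show ?thesis
    unfolding d by (subst density_density_eq) (auto intro!: density_cong simp: case_prod_beta')
qed

lemma prob_space_density_margX:
  assumes "good a b"
  shows "prob_space (density M1 (\<lambda>x. ennreal (margX a b x)))"
proof -
  interpret S: cost_space M2 M1 "\<lambda>y x. c x y" \<phi>2 \<phi>1 \<alpha> B0 B1 by (rule cost_space_swap)
  interpret S: borel_cost_space M2 M1 "\<lambda>y x. c x y" \<phi>2 \<phi>1 \<alpha> B0 B1 by unfold_locales (simp_all add: sets1 sets2)
  show ?thesis by (rule S.prob_space_density_marg[OF good_swap[OF assms]])
qed

lemma density_step_fst:
  assumes g: "good a b"
  shows "density (dens (rho a b)) (\<lambda>z. RN_deriv (distr (dens (rho a b)) borel fst) M1 (fst z))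
    = dens (rho (\<lambda>x. a x - ln (margX a b x)) b)"
proof -
  interpret S: cost_space M2 M1 "\<lambda>y x. c x y" \<phi>2 \<phi>1 \<alpha> B0 B1 by (rule cost_space_swap)
  note Sg = good_swap[OF g]
  note [measurable] = goodD(3,4)[OF g]
  let ?f = "margX a b" and ?a' = "\<lambda>x. a x - ln (margX a b x)"
  have [measurable]: "?f \<in> borel_measurable M1" by (rule S.marg_meas) measurable
  have d: "distr (dens (rho a b)) borel fst = density M1 (\<lambda>x. ennreal (?f x))"
    by (subst distr_dens_fst, measurable, rule density_cong) (use S.marg_basic(2)[OF Sg] in \<open>auto simp: rho_swap\<close>)
  have rn: "AE x in M1. RN_deriv (density M1 (\<lambda>x. ennreal (?f x))) M1 x = ennreal (1 / ?f x)"
    by (rule RN_deriv_density_self)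
       (use M1.prob_space_axioms prob_space_density_margX[OF g] S.marg_basic(5)[OF Sg] in auto)
  have [measurable]: "RN_deriv (density M1 (\<lambda>x. ennreal (?f x))) M1 \<in> borel_measurable M1"
    using borel_measurable_RN_deriv[of "density M1 (\<lambda>x. ennreal (?f x))" M1] by simp
  have "AE x in M1. \<forall>y. ennreal (rho a b x y) * RN_deriv (density M1 (\<lambda>x. ennreal (?f x))) M1 x = ennreal (rho ?a' b x y)"
    using rn good_step_fst(4)[OF g] S.marg_basic(5)[OF Sg]
    by eventually_elim (auto simp: rho_pos less_imp_le simp flip: ennreal_mult)
  then have "AE z in MM. ennreal (rho a b (fst z) (snd z)) * RN_deriv (density M1 (\<lambda>x. ennreal (?f x))) M1 (fst z) = ennreal (rho ?a' b (fst z) (snd z))"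
    by (intro AE_pair_measure) (auto elim!: eventually_mono)
  then show ?thesis
    unfolding d by (subst density_density_eq) (auto intro!: density_cong simp: case_prod_beta')
qed

lemma sinkhorn_eq: "sinkhorn (case_prod c) M1 M2 n = dens (srho n)"
proof (induction n)
  case 0
  let ?Z = "\<integral>(x, y). exp (- c x y) \<partial>MM"
  have Z: "(\<integral>\<^sup>+z. ennreal (exp (- case_prod c z)) \<partial>MM) = ennreal ?Z"
    using nn_integral_eq_integral[OF partition_function(1)] by (simp add: case_prod_beta')
  have "ennreal (exp (- case_prod c z)) / ennreal ?Z = ennreal (case_prod (srho 0) z)" for z
    using partition_function(2)
    by (cases z) (simp add: rho_def exp_diff exp_minus divide_ennreal field_simps)
  then show ?case by (simp only: sinkhorn.simps Z)
next
  case (Suc n)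
  show ?case
    unfolding sinkhorn.simps Suc
    using density_step_fst[OF good_pots, of n] density_step_snd[OF good_pots, of n] by simp
qed

end

section \<open>Extended-valued free energy and optimal couplings as densities\<close>

lemma ext_integral_cong_AE:
  assumes "AE x in M. f x = g x"
  shows "ext_integral M f = ext_integral M g"
proof -
  have "(\<integral>\<^sup>+x. ennreal (max 0 (f x)) \<partial>M) = (\<integral>\<^sup>+x. ennreal (max 0 (g x)) \<partial>M)"
    "(\<integral>\<^sup>+x. ennreal (max 0 (- f x)) \<partial>M) = (\<integral>\<^sup>+x. ennreal (max 0 (- g x)) \<partial>M)"
    by (rule nn_integral_cong_AE; use assms in eventually_elim; simp)+
  then show ?thesis by (simp add: ext_integral_def)
qed

context borel_cost_space
begin

lemma RN_deriv_dens:
  assumes [measurable]: "case_prod s \<in> borel_measurable MM" and s0: "\<And>x y. 0 \<le> s x y"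
  shows "AE z in dens s. ln (enn2real (RN_deriv MM (dens s) z)) = ln (case_prod s z)"
proof -
  have "AE z in MM. ennreal (case_prod s z) = RN_deriv MM (dens s) z"
    by (rule RN_deriv_unique) auto
  then have "AE z in MM. ln (enn2real (RN_deriv MM (dens s) z)) = ln (case_prod s z)"
  proof eventually_elim
    case (elim z)
    have "enn2real (RN_deriv MM (dens s) z) = case_prod s z"
      unfolding elim[symmetric] by (rule enn2real_ennreal) (simp add: case_prod_beta' s0)
    then show ?case by simp
  qed
  then show ?thesis by (subst AE_density) auto
qed

lemma KL_dens:
  assumes [measurable]: "case_prod s \<in> borel_measurable MM" and s0: "\<And>x y. 0 \<le> s x y"
  shows "KL (dens s) MM = ext_integral (dens s) (\<lambda>z. ln (case_prod s z))"
proof -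
  have "absolutely_continuous MM (dens s)" by (rule absolutely_continuousI_density) measurable
  then show ?thesis
    unfolding KL_def using ext_integral_cong_AE[OF RN_deriv_dens[OF assms]] by simp
qed

lemma ext_integral_dens:
  assumes [measurable]: "case_prod s \<in> borel_measurable MM" "case_prod g \<in> borel_measurable MM"
    and s0: "\<And>x y. 0 \<le> s x y" and i: "integrable MM (\<lambda>(x, y). s x y * g x y)"
  shows "ext_integral (dens s) (case_prod g) = ereal (\<integral>(x, y). s x y * g x y \<partial>MM)"
proof -
  have AE: "AE z in MM. 0 \<le> case_prod s z" by (rule AE_I2) (simp add: case_prod_beta' s0)
  have e: "(\<lambda>z. case_prod s z *\<^sub>R case_prod g z) = (\<lambda>(x, y). s x y * g x y)" by (auto simp: fun_eq_iff)
  have "integrable (dens s) (case_prod g)"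
    using integrable_density[of "case_prod g" "MM" "case_prod s", unfolded e] AE i by simp
  moreover have "integral\<^sup>L (dens s) (case_prod g) = (\<integral>(x, y). s x y * g x y \<partial>MM)"
    using integral_density[of "case_prod g" "MM" "case_prod s", unfolded e] AE by simp
  ultimately show ?thesis using ext_integral_integrable[of "dens s" "case_prod g"] by simp
qed

lemma Fent_dens:
  assumes [measurable]: "case_prod s \<in> borel_measurable MM" and s0: "\<And>x y. 0 \<le> s x y"
    and i: "integrable MM (\<lambda>(x, y). s x y * c x y)" "integrable MM (\<lambda>(x, y). s x y * ln (s x y))"
  shows "Fent (case_prod c) M1 M2 (dens s) = ereal (Fcost s)"
proof -
  have "(\<lambda>z. ln (case_prod s z)) = case_prod (\<lambda>x y. ln (s x y))" by auto
  then have "KL (dens s) MM = ereal (\<integral>(x, y). s x y * ln (s x y) \<partial>MM)"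
    using ext_integral_dens[of s "\<lambda>x y. ln (s x y)"] KL_dens[of s] s0 i(2) by simp
  then show ?thesis
    unfolding Fent_def Fcost_def using ext_integral_dens[of s c] s0 i(1) by simp
qed

lemma dens_in_couplings:
  assumes s: "coupling_density s"
  shows "dens s \<in> couplings M1 M2"
proof -
  have m[measurable]: "case_prod s \<in> borel_measurable MM"
    and sx: "AE x in M1. margin1 s x = 1" and sy: "AE y in M2. margin2 s y = 1"
    using s by (auto simp: coupling_density_def)
  have d1: "distr (dens s) borel fst = M1"
  proof -
    have "distr (dens s) borel fst = density M1 (\<lambda>_. 1)"
      unfolding distr_dens_fst[OF m] by (rule density_cong) (use sx in auto)
    then show ?thesis by (simp add: density_1)
  qed
  have d2: "distr (dens s) borel snd = M2"
  proof -
    have "distr (dens s) borel snd = density M2 (\<lambda>_. 1)"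
      unfolding distr_dens_snd[OF m] by (rule density_cong) (use sy in auto)
    then show ?thesis by (simp add: density_1)
  qed
  have "prob_space (dens s)"
  proof (rule prob_space_distrD)
    show "fst \<in> measurable (dens s) borel" using fst_meas(1) by simp
    show "prob_space (distr (dens s) borel fst)" unfolding d1 by (rule M1.prob_space_axioms)
  qed
  then show ?thesis using d1 d2 by (simp add: couplings_def sets_M)
qed

text \<open>The product coupling has density 1, zero entropy and integrable cost.\<close>

lemma S_ent_finite: "S_ent (case_prod c) M1 M2 < \<infinity>"
proof -
  have s: "coupling_density (\<lambda>_ _. 1)"
    by (simp add: coupling_density_def M1.emeasure_space_1 M2.emeasure_space_1 split_def)
  have "S_ent (case_prod c) M1 M2 \<le> Fent (case_prod c) M1 M2 (dens (\<lambda>_ _. 1))"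
    unfolding S_ent_def by (rule INF_lower[OF dens_in_couplings[OF s]])
  also have "\<dots> = ereal (Fcost (\<lambda>_ _. 1))"
    by (rule Fent_dens) (use c_integrable in \<open>simp_all add: split_def\<close>)
  finally show ?thesis by (meson ereal_infty_less(1) le_less_trans less_ereal.simps(4))
qed

text \<open>A finite optimal value and a nonnegative cost force finite relative entropy, hence
  absolute continuity and an integrable \<open>r * ln r\<close>. Optimality among all couplings then
  contains optimality among densities.\<close>

lemma optimal_coupling_density:
  assumes \<pi>: "\<pi> \<in> couplings M1 M2" and opt: "Fent (case_prod c) M1 M2 \<pi> = S_ent (case_prod c) M1 M2"
  obtains r where "\<pi> = dens r" "optimal_density r" "Fent (case_prod c) M1 M2 \<pi> = ereal (Fcost r)"
proof -
  let ?M = MM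
  interpret \<pi>: prob_space \<pi> using \<pi> by (simp add: couplings_def)
  have sets_\<pi>: "sets \<pi> = sets ?M" using \<pi> by (simp add: couplings_def sets_M)
  have fin: "Fent (case_prod c) M1 M2 \<pi> < \<infinity>" using S_ent_finite opt by simp
  have [measurable]: "case_prod c \<in> borel_measurable \<pi>" by (simp add: measurable_cong_sets[OF sets_\<pi> refl])
  have ec: "ext_integral \<pi> (case_prod c) = enn2ereal (\<integral>\<^sup>+z. ennreal (case_prod c z) \<partial>\<pi>)"
  proof -
    have "max 0 (case_prod c z) = case_prod c z" "max 0 (- case_prod c z) = 0" for z
      using c_nonneg[of "fst z" "snd z"] by (auto simp: case_prod_beta')
    then show ?thesis unfolding ext_integral_def by (simp add: zero_ennreal.rep_eq)
  qed
  have ec0: "0 \<le> ext_integral \<pi> (case_prod c)" unfolding ec by simp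
  have ac: "absolutely_continuous ?M \<pi>"
  proof (rule ccontr)
    assume "\<not> absolutely_continuous ?M \<pi>"
    then have "Fent (case_prod c) M1 M2 \<pi> = \<infinity>" using ec0 by (simp add: Fent_def KL_def)
    then show False using fin by simp
  qed
  define r where "r x y = enn2real (RN_deriv ?M \<pi> (x, y))" for x y
  have rm[measurable]: "case_prod r \<in> borel_measurable ?M"
    unfolding r_def[abs_def] by (simp add: case_prod_beta')
  have r0: "0 \<le> r x y" for x y by (simp add: r_def)
  have "sigma_finite_measure \<pi>" ..
  then have "AE z in ?M. RN_deriv ?M \<pi> z \<noteq> \<infinity>" by (rule RN_deriv_finite[OF _ ac sets_\<pi>])
  then have "AE z in ?M. RN_deriv ?M \<pi> z = ennreal (case_prod r z)"
    by eventually_elim (auto simp: r_def case_prod_beta' less_top)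
  then have "density ?M (RN_deriv ?M \<pi>) = dens r" by (intro density_cong) auto
  then have \<pi>r: "\<pi> = dens r" using density_RN_deriv[OF ac sets_\<pi>] by simp
  have nn\<pi>: "(\<integral>\<^sup>+z. g z \<partial>\<pi>) = (\<integral>\<^sup>+z. ennreal (case_prod r z) * g z \<partial>?M)" if [measurable]: "g \<in> borel_measurable ?M" for g
    unfolding \<pi>r by (rule nn_integral_density) measurable
  let ?l = "\<lambda>z. case z of (x, y) \<Rightarrow> r x y * ln (r x y)"
  have mult_max: "ennreal (case_prod r z) * ennreal (max 0 (ln (case_prod r z))) = ennreal (max 0 (?l z))"
    "ennreal (case_prod r z) * ennreal (max 0 (- ln (case_prod r z))) = ennreal (max 0 (- ?l z))" for z
    using r0[of "fst z" "snd z"]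
    by (auto simp: case_prod_beta' max_def zero_le_mult_iff mult_le_0_iff simp flip: ennreal_mult)
  define A where "A = (\<integral>\<^sup>+z. ennreal (max 0 (?l z)) \<partial>?M)"
  define B where "B = (\<integral>\<^sup>+z. ennreal (max 0 (- ?l z)) \<partial>?M)"
  have KL: "KL \<pi> ?M = enn2ereal A - enn2ereal B"
  proof -
    have "KL \<pi> ?M = ext_integral \<pi> (\<lambda>z. ln (case_prod r z))" unfolding \<pi>r by (rule KL_dens[OF rm r0])
    also have "\<dots> = enn2ereal A - enn2ereal B"
      unfolding ext_integral_def A_def B_def by (subst (1 2) nn\<pi>) (simp_all only: mult_max, measurable)
    finally show ?thesis .
  qed
  \<comment> \<open>The negative part of \<open>r * ln r\<close> is at most 1, so the difference
    defining the entropy is never of the form infinity minus infinity, and a finite value bounds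
    \<open>A\<close>.\<close>
  have "B \<le> (\<integral>\<^sup>+z. 1 \<partial>?M)"
    unfolding B_def
  proof (rule nn_integral_mono)
    fix z :: "'a \<times> 'b"
    have "- ?l z \<le> 1" using xlnx_ge[OF r0[of "fst z" "snd z"]] r0[of "fst z" "snd z"] by (auto simp: case_prod_beta')
    then show "ennreal (max 0 (- ?l z)) \<le> 1" by (simp add: ennreal_le_1)
  qed
  then have B: "B \<le> 1" by (simp add: emeasure_space_1)
  then have Bfin: "B < \<infinity>" using le_less_trans[OF _ ennreal_one_less_top] by simp
  have Bf: "enn2ereal B \<noteq> \<infinity>" using B by (auto simp: less_eq_ennreal.rep_eq one_ennreal.rep_eq)
  have Afin: "A < \<infinity>"
  proof (rule ccontr)
    assume "\<not> A < \<infinity>"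
    then have "A = top" using less_top[of A] by auto
    then have "KL \<pi> ?M = \<infinity>" using Bf unfolding KL by (cases "enn2ereal B") auto
    then show False using fin ec0 by (simp add: Fent_def)
  qed
  have li: "integrable ?M ?l"
  proof (rule integrableI_bounded)
    have "(\<integral>\<^sup>+z. ennreal (norm (?l z)) \<partial>?M) = (\<integral>\<^sup>+z. ennreal (max 0 (?l z)) + ennreal (max 0 (- ?l z)) \<partial>?M)"
      by (intro nn_integral_cong) (simp only: ennreal_plus[symmetric] max.cobounded1, simp add: max_def abs_if)
    also have "\<dots> = A + B" unfolding A_def B_def by (rule nn_integral_add) measurable
    also have "\<dots> < \<infinity>" using Afin Bfin by (simp add: less_top)
    finally show "(\<integral>\<^sup>+z. ennreal (norm (?l z)) \<partial>?M) < \<infinity>" .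
  qed measurable
  have mx: "AE x in M1. margin1 r x = 1"
  proof -
    have "density M1 (\<lambda>x. \<integral>\<^sup>+y. ennreal (r x y) \<partial>M2) = density M1 (\<lambda>_. 1)"
      using \<pi> distr_dens_fst[OF rm] unfolding \<pi>r by (simp add: couplings_def density_1)
    then show ?thesis by (subst (asm) M1.density_unique_iff) auto
  qed
  have my: "AE y in M2. margin2 r y = 1"
  proof -
    have "density M2 (\<lambda>y. \<integral>\<^sup>+x. ennreal (r x y) \<partial>M1) = density M2 (\<lambda>_. 1)"
      using \<pi> distr_dens_snd[OF rm] unfolding \<pi>r by (simp add: couplings_def density_1)
    then show ?thesis by (subst (asm) M2.density_unique_iff) auto
  qed
  have cr: "coupling_density r" using rm r0 mx my li by (simp add: coupling_density_def)
  have F: "Fent (case_prod c) M1 M2 (dens s) = ereal (Fcost s)" if "coupling_density s" for s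
    by (rule Fent_dens) (use that coupling_c_integrable[OF that] in \<open>auto simp: coupling_density_def\<close>)
  have "Fcost r \<le> Fcost s" if s: "coupling_density s" for s
  proof -
    have "ereal (Fcost r) = S_ent (case_prod c) M1 M2" using F[OF cr] opt \<pi>r by simp
    also have "\<dots> \<le> Fent (case_prod c) M1 M2 (dens s)"
      unfolding S_ent_def by (rule INF_lower[OF dens_in_couplings[OF s]])
    finally show ?thesis using F[OF s] by simp
  qed
  then have "optimal_density r" using cr by (simp add: optimal_density_def)
  then show thesis using that \<pi>r F[OF cr] by simp
qed

end

text \<open>The common mass of \<open>p\<close> and \<open>q\<close> stays on the diagonal, where
  \<open>d\<close> vanishes; the two excesses, of equal mass, are coupled independently. Splitting
  \<open>d\<close> by \<open>dG\<close> then charges \<open>G\<close> only to the excesses, whose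
  sum is the distance of \<open>p\<close> and \<open>q\<close>.\<close>

lemma total_variation_coupling:
  fixes M :: "'z::second_countable_topology measure" and p q :: "'z \<Rightarrow> real"
  assumes "prob_space M" and sM: "sets M = sets borel"
    and p[measurable]: "p \<in> borel_measurable M" and q[measurable]: "q \<in> borel_measurable M"
    and p0: "\<And>z. 0 \<le> p z" and q0: "\<And>z. 0 \<le> q z"
    and p1: "(\<integral>\<^sup>+z. ennreal (p z) \<partial>M) = 1" and q1: "(\<integral>\<^sup>+z. ennreal (q z) \<partial>M) = 1"
    and d[measurable]: "d \<in> borel_measurable borel" and G[measurable]: "G \<in> borel_measurable M"
    and d0: "\<And>z. d (z, z) = 0" and dG: "\<And>z w. d (z, w) \<le> G z + (G w :: ennreal)"
  obtains \<gamma> where "\<gamma> \<in> couplings (density M (\<lambda>z. ennreal (p z))) (density M (\<lambda>z. ennreal (q z)))"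
    "(\<integral>\<^sup>+z. d z \<partial>\<gamma>) \<le> (\<integral>\<^sup>+z. G z * ennreal \<bar>p z - q z\<bar> \<partial>M)"
proof -
  interpret prob_space M by fact
  interpret PP: pair_prob_space M M ..
  define A where "A z = max 0 (p z - q z)" for z
  define B where "B z = max 0 (q z - p z)" for z
  define mn where "mn z = min (p z) (q z)" for z
  have [measurable]: "A \<in> borel_measurable M" "B \<in> borel_measurable M" "mn \<in> borel_measurable M"
    unfolding A_def[abs_def] B_def[abs_def] mn_def[abs_def] by measurable
  have A0: "0 \<le> A z" and B0: "0 \<le> B z" and mn0: "0 \<le> mn z" for z using p0 q0 by (auto simp: A_def B_def mn_def)
  have pA: "p z = mn z + A z" and qB: "q z = mn z + B z" and AB: "\<bar>p z - q z\<bar> = A z + B z" for z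
    by (auto simp: A_def B_def mn_def)
  define m where "m = enn2real (\<integral>\<^sup>+z. ennreal (A z) \<partial>M)"
  have sumA: "(\<integral>\<^sup>+z. ennreal (mn z) \<partial>M) + (\<integral>\<^sup>+z. ennreal (A z) \<partial>M) = 1"
    unfolding p1[symmetric] by (subst nn_integral_add[symmetric]) (auto simp: pA ennreal_plus mn0 A0)
  have sumB: "(\<integral>\<^sup>+z. ennreal (mn z) \<partial>M) + (\<integral>\<^sup>+z. ennreal (B z) \<partial>M) = 1"
    unfolding q1[symmetric] by (subst nn_integral_add[symmetric]) (auto simp: qB ennreal_plus mn0 B0)
  have mnfin: "(\<integral>\<^sup>+z. ennreal (mn z) \<partial>M) \<noteq> top" using sumA by auto
  have IA: "(\<integral>\<^sup>+z. ennreal (A z) \<partial>M) = ennreal m"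
  proof -
    have "(\<integral>\<^sup>+z. ennreal (A z) \<partial>M) \<le> 1" unfolding sumA[symmetric] by simp
    then show ?thesis unfolding m_def using le_less_trans[OF _ ennreal_one_less_top] by simp
  qed
  have IB: "(\<integral>\<^sup>+z. ennreal (B z) \<partial>M) = ennreal m"
  proof -
    have "(\<integral>\<^sup>+z. ennreal (mn z) \<partial>M) + (\<integral>\<^sup>+z. ennreal (B z) \<partial>M) = (\<integral>\<^sup>+z. ennreal (mn z) \<partial>M) + ennreal m"
      using sumA sumB IA by simp
    then show ?thesis using mnfin by (simp only: ennreal_add_left_cancel simp_thms infinity_ennreal_def)
  qed
  have m0: "0 \<le> m" by (simp add: m_def)
  \<comment> \<open>Marginals of the product of the excesses, normalised by their common mass
    \<open>m\<close>. For \<open>m = 0\<close> the quotient is 0 by convention and \<open>D\<close>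
    vanishes almost everywhere, so no separate construction is needed.\<close>
  have R: "(\<integral>\<^sup>+x. \<integral>\<^sup>+y. ennreal (D x * E y / m) * g x \<partial>M \<partial>M) = (\<integral>\<^sup>+x. ennreal (D x) * g x \<partial>M)"
    if [measurable]: "D \<in> borel_measurable M" "E \<in> borel_measurable M" "g \<in> borel_measurable M"
      and D0: "\<And>x. 0 \<le> D x" and E0: "\<And>x. 0 \<le> E x"
      and D: "(\<integral>\<^sup>+z. ennreal (D z) \<partial>M) = ennreal m" and E: "(\<integral>\<^sup>+z. ennreal (E z) \<partial>M) = ennreal m"
    for D E :: "'z \<Rightarrow> real" and g
  proof (cases "m = 0")
    case True
    then have "(\<integral>\<^sup>+z. ennreal (D z) \<partial>M) = 0" using D by simp
    then have "AE x in M. ennreal (D x) = 0" by (rule nn_integral_0_iff_AE[THEN iffD1, rotated]) measurable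
    then have "(\<integral>\<^sup>+x. ennreal (D x) * g x \<partial>M) = (\<integral>\<^sup>+x. 0 \<partial>M)"
      by (intro nn_integral_cong_AE) (auto elim!: eventually_mono)
    then show ?thesis using True by simp
  next
    case False
    have "(\<integral>\<^sup>+y. ennreal (D x * E y / m) * g x \<partial>M) = ennreal (D x) * g x" for x
    proof -
      have "(\<integral>\<^sup>+y. ennreal (D x * E y / m) * g x \<partial>M) = (\<integral>\<^sup>+y. (ennreal (D x / m) * g x) * ennreal (E y) \<partial>M)"
        using D0 E0 m0 by (intro nn_integral_cong) (simp add: ennreal_mult[symmetric] mult_ac)
      also have "\<dots> = ennreal (D x / m) * g x * ennreal m" by (simp add: nn_integral_cmult E)
      also have "\<dots> = (ennreal (D x / m) * ennreal m) * g x" by (simp add: mult_ac)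
      also have "ennreal (D x / m) * ennreal m = ennreal (D x)" using False m0 D0 by (simp flip: ennreal_mult)
      finally show ?thesis .
    qed
    then show ?thesis by simp
  qed
  have RB: "(\<integral>\<^sup>+x. \<integral>\<^sup>+y. ennreal (A x * B y / m) * g x \<partial>M \<partial>M) = (\<integral>\<^sup>+x. ennreal (A x) * g x \<partial>M)"
    if "g \<in> borel_measurable M" for g by (rule R[OF _ _ that A0 B0 IA IB]) measurable
  have RA: "(\<integral>\<^sup>+x. \<integral>\<^sup>+y. ennreal (A x * B y / m) * g y \<partial>M \<partial>M) = (\<integral>\<^sup>+y. ennreal (B y) * g y \<partial>M)"
    if [measurable]: "g \<in> borel_measurable M" for g
  proof -
    have "(\<integral>\<^sup>+x. \<integral>\<^sup>+y. ennreal (A x * B y / m) * g y \<partial>M \<partial>M) = (\<integral>\<^sup>+y. \<integral>\<^sup>+x. ennreal (B y * A x / m) * g y \<partial>M \<partial>M)"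
      by (subst PP.Fubini'[symmetric]) (measurable, simp add: mult.commute)
    also have "\<dots> = (\<integral>\<^sup>+y. ennreal (B y) * g y \<partial>M)" by (rule R[OF _ _ that B0 A0 IB IA]) measurable
    finally show ?thesis .
  qed
  \<comment> \<open>The Boolean selects between the diagonal part and the product part of the coupling.\<close>
  let ?N = "(M \<Otimes>\<^sub>M M) \<Otimes>\<^sub>M count_space (UNIV :: bool set)"
  define w where "w u = (if snd u then ennreal (mn (fst (fst u))) else ennreal (A (fst (fst u)) * B (snd (fst u)) / m))" for u :: "('z \<times> 'z) \<times> bool"
  define T where "T u = (fst (fst u), if snd u then fst (fst u) else snd (fst u))" for u :: "('z \<times> 'z) \<times> bool"
  have [measurable]: "w \<in> borel_measurable ?N" unfolding w_def[abs_def] by measurable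
  have sB: "sets (M \<Otimes>\<^sub>M M) = sets (borel :: ('z \<times> 'z) measure)"
    by (metis borel_prod sets_pair_measure_cong sM)
  have "T \<in> measurable ?N (M \<Otimes>\<^sub>M M)" unfolding T_def[abs_def] by measurable
  then have Tm[measurable]: "T \<in> measurable ?N borel" by (simp add: measurable_cong_sets[OF refl sB])
  define \<gamma> where "\<gamma> = distr (density ?N w) borel T"
  interpret CS: sigma_finite_measure "count_space (UNIV :: bool set)"
    by (rule sigma_finite_measure_count_space_finite) simp
  have nn\<gamma>: "(\<integral>\<^sup>+z. h z \<partial>\<gamma>) = (\<integral>\<^sup>+x. ennreal (mn x) * h (x, x) \<partial>M) + (\<integral>\<^sup>+x. \<integral>\<^sup>+y. ennreal (A x * B y / m) * h (x, y) \<partial>M \<partial>M)"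
    if hm[measurable]: "h \<in> borel_measurable borel" for h
  proof -
    have hM[measurable]: "h \<in> borel_measurable (M \<Otimes>\<^sub>M M)" by (simp add: measurable_cong_sets[OF sB refl])
    have hd[measurable]: "(\<lambda>x. h (x, x)) \<in> borel_measurable M" by measurable
    have "(\<integral>\<^sup>+z. h z \<partial>\<gamma>) = (\<integral>\<^sup>+u. h (T u) \<partial>density ?N w)"
      unfolding \<gamma>_def by (rule nn_integral_distr) simp_all
    also have "\<dots> = (\<integral>\<^sup>+u. w u * h (T u) \<partial>?N)" by (rule nn_integral_density) measurable
    also have "\<dots> = (\<integral>\<^sup>+v. \<integral>\<^sup>+b. w (v, b) * h (T (v, b)) \<partial>count_space UNIV \<partial>(M \<Otimes>\<^sub>M M))"
      by (rule CS.nn_integral_fst[symmetric]) measurable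
    also have "\<dots> = (\<integral>\<^sup>+v. ennreal (mn (fst v)) * h (fst v, fst v) + ennreal (A (fst v) * B (snd v) / m) * h v \<partial>(M \<Otimes>\<^sub>M M))"
      by (intro nn_integral_cong, subst nn_integral_count_space_finite) (simp_all add: UNIV_bool w_def T_def add.commute)
    also have "\<dots> = (\<integral>\<^sup>+x. \<integral>\<^sup>+y. ennreal (mn x) * h (x, x) + ennreal (A x * B y / m) * h (x, y) \<partial>M \<partial>M)"
      by (subst nn_integral_fst[symmetric]) simp_all
    also have "\<dots> = (\<integral>\<^sup>+x. ennreal (mn x) * h (x, x) + (\<integral>\<^sup>+y. ennreal (A x * B y / m) * h (x, y) \<partial>M) \<partial>M)"
      by (intro nn_integral_cong, subst nn_integral_add) (simp_all add: emeasure_space_1)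
    also have "\<dots> = (\<integral>\<^sup>+x. ennreal (mn x) * h (x, x) \<partial>M) + (\<integral>\<^sup>+x. \<integral>\<^sup>+y. ennreal (A x * B y / m) * h (x, y) \<partial>M \<partial>M)"
      by (rule nn_integral_add) measurable
    finally show ?thesis .
  qed
  have fsb: "(fst :: 'z \<times> 'z \<Rightarrow> 'z) \<in> borel_measurable borel" "(snd :: 'z \<times> 'z \<Rightarrow> 'z) \<in> borel_measurable borel"
    using measurable_fst[of "borel :: 'z measure" "borel :: 'z measure"] measurable_snd[of "borel :: 'z measure" "borel :: 'z measure"]
    by (simp_all add: borel_prod)
  have sg: "sets \<gamma> = sets borel" by (simp add: \<gamma>_def)
  have d1: "distr \<gamma> borel fst = density M (\<lambda>z. ennreal (p z))"
  proof (rule measure_eqI)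
    show "sets (distr \<gamma> borel fst) = sets (density M (\<lambda>z. ennreal (p z)))" by (simp add: sM)
    fix S assume "S \<in> sets (distr \<gamma> borel fst)"
    then have S[measurable]: "S \<in> sets borel" and SM[measurable]: "S \<in> sets M" by (simp_all add: sM)
    have "emeasure (distr \<gamma> borel fst) S = (\<integral>\<^sup>+z. indicator S z \<partial>distr \<gamma> borel fst)" by simp
    also have "\<dots> = (\<integral>\<^sup>+z. indicator S (fst z) \<partial>\<gamma>)"
      by (rule nn_integral_distr) (simp_all add: measurable_cong_sets[OF sg refl] fsb)
    also have "\<dots> = (\<integral>\<^sup>+x. ennreal (mn x) * indicator S (fst (x, x)) \<partial>M) + (\<integral>\<^sup>+x. \<integral>\<^sup>+y. ennreal (A x * B y / m) * indicator S (fst (x, y)) \<partial>M \<partial>M)"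
      by (rule nn\<gamma>) (rule measurable_compose[OF fsb(1)], simp)
    also have "\<dots> = (\<integral>\<^sup>+x. ennreal (mn x) * indicator S x \<partial>M) + (\<integral>\<^sup>+x. ennreal (A x) * indicator S x \<partial>M)"
      by (simp add: RB)
    also have "\<dots> = (\<integral>\<^sup>+x. ennreal (p x) * indicator S x \<partial>M)"
      by (subst nn_integral_add[symmetric]) (auto simp: pA ennreal_plus mn0 A0 distrib_right)
    also have "\<dots> = emeasure (density M (\<lambda>z. ennreal (p z))) S" by (rule emeasure_density[symmetric]) measurable
    finally show "emeasure (distr \<gamma> borel fst) S = emeasure (density M (\<lambda>z. ennreal (p z))) S" .
  qed
  have d2: "distr \<gamma> borel snd = density M (\<lambda>z. ennreal (q z))"
  proof (rule measure_eqI)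
    show "sets (distr \<gamma> borel snd) = sets (density M (\<lambda>z. ennreal (q z)))" by (simp add: sM)
    fix S assume "S \<in> sets (distr \<gamma> borel snd)"
    then have S[measurable]: "S \<in> sets borel" and SM[measurable]: "S \<in> sets M" by (simp_all add: sM)
    have "emeasure (distr \<gamma> borel snd) S = (\<integral>\<^sup>+z. indicator S z \<partial>distr \<gamma> borel snd)" by simp
    also have "\<dots> = (\<integral>\<^sup>+z. indicator S (snd z) \<partial>\<gamma>)"
      by (rule nn_integral_distr) (simp_all add: measurable_cong_sets[OF sg refl] fsb)
    also have "\<dots> = (\<integral>\<^sup>+x. ennreal (mn x) * indicator S (snd (x, x)) \<partial>M) + (\<integral>\<^sup>+x. \<integral>\<^sup>+y. ennreal (A x * B y / m) * indicator S (snd (x, y)) \<partial>M \<partial>M)"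
      by (rule nn\<gamma>) (rule measurable_compose[OF fsb(2)], simp)
    also have "\<dots> = (\<integral>\<^sup>+x. ennreal (mn x) * indicator S x \<partial>M) + (\<integral>\<^sup>+x. ennreal (B x) * indicator S x \<partial>M)"
      by (simp add: RA)
    also have "\<dots> = (\<integral>\<^sup>+x. ennreal (q x) * indicator S x \<partial>M)"
      by (subst nn_integral_add[symmetric]) (auto simp: qB ennreal_plus mn0 B0 distrib_right)
    also have "\<dots> = emeasure (density M (\<lambda>z. ennreal (q z))) S" by (rule emeasure_density[symmetric]) measurable
    finally show "emeasure (distr \<gamma> borel snd) S = emeasure (density M (\<lambda>z. ennreal (q z))) S" .
  qed
  have "prob_space \<gamma>"
  proof (rule prob_space_distrD)
    show "fst \<in> measurable \<gamma> borel" by (simp add: measurable_cong_sets[OF sg refl] fsb)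
    show "prob_space (distr \<gamma> borel fst)"
      unfolding d1 by (rule prob_spaceI) (simp add: emeasure_density p1)
  qed
  then have \<gamma>c: "\<gamma> \<in> couplings (density M (\<lambda>z. ennreal (p z))) (density M (\<lambda>z. ennreal (q z)))"
    using d1 d2 sg by (simp add: couplings_def)
  have "(\<integral>\<^sup>+z. d z \<partial>\<gamma>) = (\<integral>\<^sup>+x. \<integral>\<^sup>+y. ennreal (A x * B y / m) * d (x, y) \<partial>M \<partial>M)"
    by (subst nn\<gamma>) (simp_all add: d0)
  also have "\<dots> \<le> (\<integral>\<^sup>+x. \<integral>\<^sup>+y. ennreal (A x * B y / m) * G x + ennreal (A x * B y / m) * G y \<partial>M \<partial>M)"
    unfolding distrib_left[symmetric] by (intro nn_integral_mono mult_left_mono dG) simp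
  also have "\<dots> = (\<integral>\<^sup>+x. (\<integral>\<^sup>+y. ennreal (A x * B y / m) * G x \<partial>M) + (\<integral>\<^sup>+y. ennreal (A x * B y / m) * G y \<partial>M) \<partial>M)"
    by (intro nn_integral_cong nn_integral_add) simp_all
  also have "\<dots> = (\<integral>\<^sup>+x. \<integral>\<^sup>+y. ennreal (A x * B y / m) * G x \<partial>M \<partial>M) + (\<integral>\<^sup>+x. \<integral>\<^sup>+y. ennreal (A x * B y / m) * G y \<partial>M \<partial>M)"
    by (rule nn_integral_add) measurable
  also have "\<dots> = (\<integral>\<^sup>+x. ennreal (A x) * G x \<partial>M) + (\<integral>\<^sup>+x. ennreal (B x) * G x \<partial>M)" by (simp only: RA[OF G] RB[OF G])
  also have "\<dots> = (\<integral>\<^sup>+z. G z * ennreal \<bar>p z - q z\<bar> \<partial>M)"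
    by (subst nn_integral_add[symmetric]) (auto simp: AB ennreal_plus A0 B0 distrib_left mult.commute)
  finally show thesis by (rule that[OF \<gamma>c])
qed

section \<open>Wasserstein bounds\<close>

lemma dXr_nonneg: "0 \<le> dXr r x y" by (simp add: dXr_def)

lemma dXr_powr:
  assumes "0 < r"
  shows "dXr r x y powr r = dist (fst x) (fst y) powr r + dist (snd x) (snd y) powr r"
  using assms by (simp add: dXr_def powr_powr)

lemma dXr_le_dist:
  assumes "1 \<le> r"
  shows "dXr r x y \<le> 2 * dist x y"
proof -
  have "dist (fst x) (fst y) powr r \<le> dist x y powr r" "dist (snd x) (snd y) powr r \<le> dist x y powr r"
    using assms dist_fst_le[of x y] dist_snd_le[of x y] by (auto intro!: powr_mono2)
  then have "dXr r x y \<le> (2 * dist x y powr r) powr (1 / r)"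
    unfolding dXr_def using assms by (intro powr_mono2) auto
  also have "\<dots> = 2 powr (1 / r) * dist x y" using assms by (simp add: powr_mult powr_powr)
  also have "\<dots> \<le> 2 powr 1 * dist x y" using assms by (intro mult_right_mono powr_mono) auto
  finally show ?thesis by simp
qed

lemma powr_add_le:
  fixes a b q :: real
  assumes "0 \<le> a" "0 \<le> b" "0 \<le> q"
  shows "(a + b) powr q \<le> 2 powr q * (a powr q + b powr q)"
proof -
  have "(a + b) powr q \<le> (2 * max a b) powr q" using assms by (intro powr_mono2) auto
  also have "\<dots> = 2 powr q * max a b powr q" using assms by (simp add: powr_mult)
  also have "max a b powr q \<le> a powr q + b powr q" by (auto simp: max_def)
  finally show ?thesis by simp
qed

lemma dist_powr_le:
  fixes q :: real
  assumes "0 \<le> q"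
  shows "dist x y powr q \<le> 2 powr q * (dist z x powr q + dist z y powr q)"
proof -
  have "dist x y powr q \<le> (dist z x + dist z y) powr q"
    using assms dist_triangle3[of x y z] by (intro powr_mono2) auto
  also have "\<dots> \<le> 2 powr q * (dist z x powr q + dist z y powr q)" using assms by (intro powr_add_le) auto
  finally show ?thesis .
qed

lemma powr_le_one_plus:
  fixes a q p :: real
  assumes "0 \<le> a" "0 \<le> q" "q \<le> p"
  shows "a powr q \<le> 1 + a powr p"
proof (cases "a \<le> 1")
  case True
  then have "a powr q \<le> 1" using assms by (intro powr_le1) auto
  then show ?thesis by (simp add: add_increasing2)
next
  case False
  then have "a powr q \<le> a powr p" using assms by (intro powr_mono) auto
  then show ?thesis by simp
qed

lemma continuous_on_lipschitzX:
  assumes "1 \<le> p" and f: "lipschitzX p f"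
  shows "continuous_on UNIV f"
proof -
  obtain L where L: "\<And>x y. \<bar>f x - f y\<bar> \<le> L * dXr p x y" using f by (auto simp: lipschitzX_def)
  have "\<bar>f x - f y\<bar> \<le> (2 * \<bar>L\<bar>) * dist x y" for x y
  proof -
    have "\<bar>f x - f y\<bar> \<le> \<bar>L\<bar> * dXr p x y"
      using L[of x y] mult_right_mono[OF abs_ge_self[of L] dXr_nonneg[of p x y]] by linarith
    also have "\<dots> \<le> \<bar>L\<bar> * (2 * dist x y)" by (intro mult_left_mono dXr_le_dist assms) auto
    finally show ?thesis by simp
  qed
  then have "(2 * \<bar>L\<bar>)-lipschitz_on UNIV f" by (auto intro!: lipschitz_onI simp: dist_real_def)
  then show ?thesis by (rule lipschitz_on_continuous_on)
qed

text \<open>Moves the base point from the one in the growth condition to the point (u, v) at which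
  exponential moments are given; the power \<open>2 powr p\<close> is the price of the triangle
  inequality.\<close>

lemma growth_bound:
  fixes c :: "'a::metric_space \<times> 'b::metric_space \<Rightarrow> real"
  assumes p: "1 \<le> p" and c: "growth p p c"
  obtains B0 B1 where "0 \<le> B0" "0 \<le> B1"
    "\<And>x y. c (x, y) \<le> B0 + B1 * (dist u x powr p + dist v y powr p)"
proof -
  obtain C xh where C: "\<And>x. \<bar>c x\<bar> \<le> C * (1 + dXr p x xh powr p)" using c by (auto simp: growth_def)
  let ?B1 = "\<bar>C\<bar> * 2 powr p"
  let ?B0 = "\<bar>C\<bar> + ?B1 * (dist u (fst xh) powr p + dist v (snd xh) powr p)"
  show thesis
  proof (rule that[of ?B0 ?B1])
    show "0 \<le> ?B0" "0 \<le> ?B1" by auto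
    fix x y
    have d: "dXr p (x, y) xh powr p = dist x (fst xh) powr p + dist y (snd xh) powr p"
      using dXr_powr[of p "(x, y)" xh] p by simp
    have "c (x, y) \<le> \<bar>C\<bar> * (1 + dXr p (x, y) xh powr p)"
    proof -
      have "c (x, y) \<le> C * (1 + dXr p (x, y) xh powr p)" using C[of "(x, y)"] by linarith
      also have "\<dots> \<le> \<bar>C\<bar> * (1 + dXr p (x, y) xh powr p)"
        by (intro mult_right_mono) (auto intro: add_nonneg_nonneg)
      finally show ?thesis .
    qed
    also have "\<dots> \<le> \<bar>C\<bar> * (1 + (2 powr p * (dist u x powr p + dist u (fst xh) powr p) + 2 powr p * (dist v y powr p + dist v (snd xh) powr p)))"
      unfolding d using p by (intro mult_left_mono add_left_mono add_mono dist_powr_le) auto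
    also have "\<dots> = ?B0 + ?B1 * (dist u x powr p + dist v y powr p)" by (simp add: algebra_simps)
    finally show "c (x, y) \<le> ?B0 + ?B1 * (dist u x powr p + dist v y powr p)" .
  qed
qed

text \<open>A Lipschitz function grows at most linearly, so the orders add up to 1 + (p - 1) =
  p.\<close>

lemma growth_product:
  assumes p: "1 < p" and f: "lipschitzX p f" and g: "growth p (p - 1) g"
  shows "growth p p (\<lambda>x. f x * g x)"
proof -
  obtain L where L: "\<And>x y. \<bar>f x - f y\<bar> \<le> L * dXr p x y" using f by (auto simp: lipschitzX_def)
  obtain C xh where C: "\<And>x. \<bar>g x\<bar> \<le> C * (1 + dXr p x xh powr (p - 1))" using g by (auto simp: growth_def)
  define F where "F = \<bar>f xh\<bar> + \<bar>L\<bar>"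
  have "\<bar>f x * g x\<bar> \<le> (4 * F * \<bar>C\<bar>) * (1 + dXr p x xh powr p)" for x
  proof -
    let ?D = "dXr p x xh"
    \<comment> \<open>A base of at least 1 lets constants be absorbed into powers and makes the
      exponents add.\<close>
    define m where "m = max 1 ?D"
    have m: "1 \<le> m" "?D \<le> m" by (auto simp: m_def)
    have D0: "0 \<le> ?D" by (rule dXr_nonneg)
    have "\<bar>f x\<bar> \<le> \<bar>f xh\<bar> + L * ?D" using L[of x xh] by linarith
    also have "\<dots> \<le> \<bar>f xh\<bar> * m + \<bar>L\<bar> * m"
      using m D0 mult_mono[OF abs_ge_self[of L] m(2)] mult_left_mono[of 1 m "\<bar>f xh\<bar>"] by simp
    finally have fx: "\<bar>f x\<bar> \<le> F * m" by (simp add: F_def algebra_simps)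
    have "?D powr (p - 1) \<le> m powr (p - 1)" using m D0 p by (intro powr_mono2) auto
    moreover have "1 \<le> m powr (p - 1)" using m p by (intro ge_one_powr_ge_zero) auto
    ultimately have D1: "1 + ?D powr (p - 1) \<le> 2 * m powr (p - 1)" by simp
    have "\<bar>g x\<bar> \<le> C * (1 + ?D powr (p - 1))" by (rule C)
    also have "\<dots> \<le> \<bar>C\<bar> * (2 * m powr (p - 1))"
      using D1 by (intro mult_mono) (auto intro: add_nonneg_nonneg)
    finally have gx: "\<bar>g x\<bar> \<le> \<bar>C\<bar> * (2 * m powr (p - 1))" .
    have "\<bar>f x * g x\<bar> \<le> (F * m) * (\<bar>C\<bar> * (2 * m powr (p - 1)))"
      unfolding abs_mult using m by (intro mult_mono fx gx) (auto simp: F_def)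
    also have "\<dots> = 2 * F * \<bar>C\<bar> * m powr p" using m by (simp add: powr_diff)
    also have "\<dots> \<le> 2 * F * \<bar>C\<bar> * (1 + ?D powr p)"
    proof (rule mult_left_mono)
      show "m powr p \<le> 1 + ?D powr p" by (auto simp: m_def max_def)
    qed (simp add: F_def)
    also have "\<dots> \<le> (4 * F * \<bar>C\<bar>) * (1 + ?D powr p)"
      by (intro mult_right_mono) (auto simp: F_def intro: add_nonneg_nonneg)
    finally show ?thesis .
  qed
  then show ?thesis unfolding growth_def by blast
qed

text \<open>The case p = 1: growth of order 0 is boundedness, since \<open>powr 0\<close> takes
  values at most 1.\<close>

lemma bounded_product:
  assumes f: "growth 1 0 f" and g: "growth 1 0 g"
  obtains B where "0 \<le> B" "\<And>x. f x * g x \<le> B"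
proof -
  have *: "\<exists>C\<ge>0. \<forall>x. \<bar>h x\<bar> \<le> C" if h: "growth 1 0 h" for h :: "'a \<times> 'b \<Rightarrow> real"
  proof -
    obtain C xh where C: "\<And>x. \<bar>h x\<bar> \<le> C * (1 + dXr 1 x xh powr 0)" using h by (auto simp: growth_def)
    have "\<bar>h x\<bar> \<le> \<bar>C\<bar> * 2" for x
    proof -
      have "C * (1 + dXr 1 x xh powr 0) \<le> \<bar>C\<bar> * 2" by (intro mult_mono) auto
      then show ?thesis using C[of x] by linarith
    qed
    then show ?thesis by (intro exI[of _ "\<bar>C\<bar> * 2"]) auto
  qed
  obtain Cf where Cf: "0 \<le> Cf" "\<And>x. \<bar>f x\<bar> \<le> Cf" using *[OF f] by auto
  obtain Cg where Cg: "0 \<le> Cg" "\<And>x. \<bar>g x\<bar> \<le> Cg" using *[OF g] by auto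
  show thesis
  proof (rule that[of "Cf * Cg"])
    show "0 \<le> Cf * Cg" using Cf Cg by simp
    show "f x * g x \<le> Cf * Cg" for x
      using mult_mono[OF Cf(2)[of x] Cg(2)[of x]] Cf(1) by (metis abs_ge_self abs_ge_zero abs_mult order_trans)
  qed
qed

lemma Wass_le:
  assumes \<gamma>: "\<gamma> \<in> couplings P Q" and le: "(\<integral>\<^sup>+z. ennreal (dXr q (fst z) (snd z) powr q) \<partial>\<gamma>) \<le> ennreal X"
    and q: "0 < q"
  shows "Wass q P Q \<le> ennreal (X powr (1 / q))"
proof -
  define I where "I = (INF \<gamma>\<in>couplings P Q. \<integral>\<^sup>+z. ennreal (dXr q (fst z) (snd z) powr q) \<partial>\<gamma>)"
  have I: "I \<le> ennreal X" unfolding I_def using INF_lower[OF \<gamma>] le by (rule order_trans)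
  then have fin: "I \<noteq> \<infinity>" by (auto simp: top_unique)
  show ?thesis
  proof (cases "0 \<le> X")
    case True
    then have "enn2real I \<le> X" using enn2real_mono[OF I] by simp
    then have "enn2real I powr (1 / q) \<le> X powr (1 / q)" using q by (intro powr_mono2) auto
    then show ?thesis using fin unfolding Wass_def Let_def I_def[symmetric] by (simp add: ennreal_leI)
  next
    case False
    then have "I = 0" using I by (simp add: ennreal_neg)
    then show ?thesis unfolding Wass_def Let_def I_def[symmetric] by simp
  qed
qed

text \<open>The cost of order q is dominated by a sum of weights of order p at the two points,
  because a^q is at most 1 + a^p; the total variation coupling then turns it into the weighted
  distance of the densities.\<close>

lemma (in borel_cost_space) Wass_dens_le:
  assumes \<phi>1: "\<And>x. \<phi>1 x = dist u x powr p" and \<phi>2: "\<And>y. \<phi>2 y = dist v y powr p" and q: "1 \<le> q" "q \<le> p"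
    and s1[measurable]: "case_prod s1 \<in> borel_measurable MM" and s10: "\<And>x y. 0 \<le> s1 x y"
    and s11: "(\<integral>\<^sup>+z. ennreal (case_prod s1 z) \<partial>MM) = 1"
    and s2[measurable]: "case_prod s2 \<in> borel_measurable MM" and s20: "\<And>x y. 0 \<le> s2 x y"
    and s21: "(\<integral>\<^sup>+z. ennreal (case_prod s2 z) \<partial>MM) = 1"
    and X: "wtv s1 s2 \<le> ennreal X"
  shows "Wass q (dens s1) (dens s2) \<le> ennreal ((2 * 2 powr q * X) powr (1 / q))"
proof -
  define G where "G z = ennreal (2 * 2 powr q * (1 + (\<phi>1 (fst z) + \<phi>2 (snd z))))" for z
  define d where "d w = ennreal (dXr q (fst w) (snd w) powr q)" for w :: "('a \<times> 'b) \<times> ('a \<times> 'b)"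
  have d_eq: "d w = ennreal (dist (fst (fst w)) (fst (snd w)) powr q + dist (snd (fst w)) (snd (snd w)) powr q)" for w
    using q by (simp add: d_def dXr_powr)
  have "continuous_on UNIV (\<lambda>w :: ('a \<times> 'b) \<times> ('a \<times> 'b). dist (fst (fst w)) (fst (snd w)))"
    "continuous_on UNIV (\<lambda>w :: ('a \<times> 'b) \<times> ('a \<times> 'b). dist (snd (fst w)) (snd (snd w)))"
    by (intro continuous_intros)+
  note [measurable] = this[THEN borel_measurable_continuous_onI]
  have dm: "d \<in> borel_measurable borel" unfolding d_eq[abs_def] by measurable
  have Gm[measurable]: "G \<in> borel_measurable MM" unfolding G_def[abs_def] by measurable
  have d0: "d (z, z) = 0" for z by (simp add: d_eq)
  have pw: "dist x x' powr q \<le> 2 powr q * ((1 + dist z x powr p) + (1 + dist z x' powr p))" for x x' z :: "'c::metric_space"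
  proof -
    have "dist x x' powr q \<le> 2 powr q * (dist z x powr q + dist z x' powr q)" using q by (intro dist_powr_le) auto
    also have "\<dots> \<le> 2 powr q * ((1 + dist z x powr p) + (1 + dist z x' powr p))"
      using q by (intro mult_left_mono add_mono powr_le_one_plus) auto
    finally show ?thesis .
  qed
  have dG: "d (z, w) \<le> G z + G w" for z w
  proof -
    have "dist (fst z) (fst w) powr q + dist (snd z) (snd w) powr q
      \<le> 2 powr q * ((1 + \<phi>1 (fst z)) + (1 + \<phi>1 (fst w))) + 2 powr q * ((1 + \<phi>2 (snd z)) + (1 + \<phi>2 (snd w)))"
      unfolding \<phi>1 \<phi>2 by (intro add_mono pw)
    also have "\<dots> \<le> 2 * 2 powr q * (1 + (\<phi>1 (fst z) + \<phi>2 (snd z))) + 2 * 2 powr q * (1 + (\<phi>1 (fst w) + \<phi>2 (snd w)))"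
      using \<phi>1_nonneg[of "fst z"] \<phi>1_nonneg[of "fst w"] \<phi>2_nonneg[of "snd z"] \<phi>2_nonneg[of "snd w"]
      by (simp add: algebra_simps)
    finally have *: "dist (fst z) (fst w) powr q + dist (snd z) (snd w) powr q
      \<le> 2 * 2 powr q * (1 + (\<phi>1 (fst z) + \<phi>2 (snd z))) + 2 * 2 powr q * (1 + (\<phi>1 (fst w) + \<phi>2 (snd w)))" .
    have nn: "0 \<le> 2 * 2 powr q * (1 + (\<phi>1 (fst z) + \<phi>2 (snd z)))" for z
      using \<phi>1_nonneg[of "fst z"] \<phi>2_nonneg[of "snd z"] by simp
    show ?thesis unfolding d_eq G_def fst_conv snd_conv ennreal_plus[OF nn nn, symmetric] by (rule ennreal_leI[OF *])
  qed
  obtain \<gamma> where \<gamma>: "\<gamma> \<in> couplings (dens s1) (dens s2)"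
    "(\<integral>\<^sup>+z. d z \<partial>\<gamma>) \<le> (\<integral>\<^sup>+z. G z * ennreal \<bar>case_prod s1 z - case_prod s2 z\<bar> \<partial>MM)"
    by (rule total_variation_coupling[OF prob_space_axioms sets_M s1 s2 _ _ s11 s21 dm Gm d0 dG])
       (auto simp: case_prod_beta' s10 s20)
  note \<gamma>(2)
  also have "(\<integral>\<^sup>+z. G z * ennreal \<bar>case_prod s1 z - case_prod s2 z\<bar> \<partial>MM)
    = (\<integral>\<^sup>+z. ennreal (2 * 2 powr q) * (case z of (x, y) \<Rightarrow> ennreal ((1 + (\<phi>1 x + \<phi>2 y)) * \<bar>s1 x y - s2 x y\<bar>)) \<partial>MM)"
    using \<phi>1_nonneg \<phi>2_nonneg
    by (intro nn_integral_cong) (auto simp: G_def mult.assoc simp flip: ennreal_mult)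
  also have "\<dots> = ennreal (2 * 2 powr q) * wtv s1 s2"
    by (rule nn_integral_cmult) measurable
  also have "\<dots> \<le> ennreal (2 * 2 powr q) * ennreal X" by (intro mult_left_mono X) simp
  also have "\<dots> = ennreal (2 * 2 powr q * X)" by (simp add: ennreal_mult')
  finally show ?thesis using q by (intro Wass_le[OF \<gamma>(1)]) (auto simp: d_def)
qed

text \<open>Both orders of the Wasserstein arguments are recorded, since convergence and rate are
  asked for in opposite orders.\<close>

lemma (in borel_cost_space) sinkhorn_convergence:
  assumes \<phi>1: "\<And>x. \<phi>1 x = dist u x powr p" and \<phi>2: "\<And>y. \<phi>2 y = dist v y powr p"
    and \<sigma>: "0 < \<sigma>" "\<sigma> \<le> 1" "\<sigma> < 1 \<or> B1 = 0"
    and \<pi>: "\<pi> \<in> couplings M1 M2" "Fent (case_prod c) M1 M2 \<pi> = S_ent (case_prod c) M1 M2"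
  obtains C F Fn where "0 \<le> C" "Fent (case_prod c) M1 M2 \<pi> = ereal F"
    "\<And>n. 2 \<le> n \<Longrightarrow> Fent (case_prod c) M1 M2 (sinkhorn (case_prod c) M1 M2 n) = ereal (Fn n)"
    "\<And>n. 2 \<le> n \<Longrightarrow> \<bar>F - Fn n\<bar> \<le> C * real n powr (- \<sigma> / 2)"
    "\<And>n q. 2 \<le> n \<Longrightarrow> 1 \<le> q \<Longrightarrow> q \<le> p \<Longrightarrow> Wass q \<pi> (sinkhorn (case_prod c) M1 M2 n)
       \<le> ennreal ((2 * 2 powr q * (C * real n powr (- \<sigma> / 4))) powr (1 / q))"
    "\<And>n q. 2 \<le> n \<Longrightarrow> 1 \<le> q \<Longrightarrow> q \<le> p \<Longrightarrow> Wass q (sinkhorn (case_prod c) M1 M2 n) \<pi>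
       \<le> ennreal ((2 * 2 powr q * (C * real n powr (- \<sigma> / 4))) powr (1 / q))"
proof -
  obtain r where r: "\<pi> = dens r" "optimal_density r" "Fent (case_prod c) M1 M2 \<pi> = ereal (Fcost r)"
    by (rule optimal_coupling_density[OF \<pi>])
  obtain C where C: "0 \<le> C" and H: "\<And>r n. 2 \<le> n \<Longrightarrow> optimal_density r \<Longrightarrow>
    rate_bound C \<sigma> n r (srho n)"
    using sinkhorn_rate[OF \<sigma>] by blast
  have rm: "case_prod r \<in> borel_measurable MM" and r0: "\<And>x y. 0 \<le> r x y"
    using r(2) by (auto simp: optimal_density_def coupling_density_def)
  have r1: "(\<integral>\<^sup>+z. ennreal (case_prod r z) \<partial>MM) = 1"
  proof -
    interpret \<pi>: prob_space \<pi> using \<pi> by (simp add: couplings_def)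
    show ?thesis using \<pi>.emeasure_space_1 rm unfolding r(1) by (simp add: emeasure_density cong: nn_integral_cong)
  qed
  have s0: "0 \<le> srho n x y" for n x y using rho_pos[of "pa n" "pb n" x y] by simp
  have s1: "(\<integral>\<^sup>+z. ennreal (case_prod (srho n) z) \<partial>MM) = 1" for n
    using goodD(5)[OF good_pots, of n] by (simp add: case_prod_beta')
  show thesis
  proof (rule that[OF C r(3), of "\<lambda>n. Fcost (srho n)"])
    fix n :: nat assume n: "2 \<le> n"
    note Hn = H[OF n r(2)]
    show "Fent (case_prod c) M1 M2 (sinkhorn (case_prod c) M1 M2 n) = ereal (Fcost (srho n))"
      unfolding sinkhorn_eq by (rule Fent_dens[OF srho_meas s0]) (use Hn in auto)
    show "\<bar>Fcost r - Fcost (srho n)\<bar> \<le> C * real n powr (- \<sigma> / 2)" using Hn by simp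
    fix q :: real assume q: "1 \<le> q" "q \<le> p"
    have X: "wtv r (srho n)
      \<le> ennreal (C * real n powr (- \<sigma> / 4))" using Hn by simp
    have X': "wtv (srho n) r
      \<le> ennreal (C * real n powr (- \<sigma> / 4))" using X by (subst abs_minus_commute)
    show "Wass q \<pi> (sinkhorn (case_prod c) M1 M2 n)
       \<le> ennreal ((2 * 2 powr q * (C * real n powr (- \<sigma> / 4))) powr (1 / q))"
      unfolding sinkhorn_eq r(1) by (rule Wass_dens_le[OF \<phi>1 \<phi>2 q rm r0 r1 srho_meas s0 s1 X])
    show "Wass q (sinkhorn (case_prod c) M1 M2 n) \<pi>
       \<le> ennreal ((2 * 2 powr q * (C * real n powr (- \<sigma> / 4))) powr (1 / q))"
      unfolding sinkhorn_eq r(1) by (rule Wass_dens_le[OF \<phi>1 \<phi>2 q srho_meas s0 s1 rm r0 r1 X'])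
  qed
qed

section \<open>Specialisation to distances, and the two claims\<close>

lemma borel_cost_spaceI:
  fixes \<mu>1 :: "'a::polish_space measure" and \<mu>2 :: "'b::polish_space measure" and c :: "'a \<times> 'b \<Rightarrow> real"
  assumes P1: "prob_space \<mu>1" "sets \<mu>1 = sets borel" and P2: "prob_space \<mu>2" "sets \<mu>2 = sets borel"
    and c: "continuous_on UNIV c" "\<And>z. 0 \<le> c z" and B: "0 \<le> B0" "0 \<le> B1"
    and cle: "\<And>x y. c (x, y) \<le> B0 + B1 * (dist u x powr p + dist v y powr p)"
    and \<alpha>: "0 < \<alpha>1" "0 < \<alpha>2"
    and e1: "(\<integral>\<^sup>+ x. ennreal (exp (\<alpha>1 * dist u x powr p)) \<partial>\<mu>1) < \<infinity>"
    and e2: "(\<integral>\<^sup>+ x. ennreal (exp (\<alpha>2 * dist v x powr p)) \<partial>\<mu>2) < \<infinity>"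
  shows "borel_cost_space \<mu>1 \<mu>2 (curry c) (\<lambda>x. dist u x powr p) (\<lambda>y. dist v y powr p) (min \<alpha>1 \<alpha>2) B0 B1"
proof -
  interpret M1: prob_space \<mu>1 by fact
  interpret M2: prob_space \<mu>2 by fact
  interpret pair_prob_space \<mu>1 \<mu>2 ..
  have sM: "sets (\<mu>1 \<Otimes>\<^sub>M \<mu>2) = sets (borel :: ('a \<times> 'b) measure)"
    by (metis borel_prod sets_pair_measure_cong P1(2) P2(2))
  have m: "(\<lambda>x. dist z x powr p) \<in> borel_measurable M" if "sets M = sets borel" for z :: "'c::polish_space" and M
  proof -
    have "continuous_on UNIV (\<lambda>x. dist z x)" by (intro continuous_intros)
    then have [measurable]: "(\<lambda>x. dist z x) \<in> borel_measurable borel" by (rule borel_measurable_continuous_onI)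
    have "(\<lambda>x. dist z x powr p) \<in> borel_measurable borel" by measurable
    then show ?thesis by (simp add: measurable_cong_sets[OF that refl])
  qed
  note [measurable] = m[OF P1(2), of u] m[OF P2(2), of v]
  have i1: "integrable \<mu>1 (\<lambda>x. exp (min \<alpha>1 \<alpha>2 * dist u x powr p))"
  proof (rule integrableI_bounded)
    have "(\<integral>\<^sup>+x. ennreal (norm (exp (min \<alpha>1 \<alpha>2 * dist u x powr p))) \<partial>\<mu>1) \<le> (\<integral>\<^sup>+ x. ennreal (exp (\<alpha>1 * dist u x powr p)) \<partial>\<mu>1)"
      by (intro nn_integral_mono ennreal_leI) (auto intro!: mult_right_mono)
    then show "(\<integral>\<^sup>+x. ennreal (norm (exp (min \<alpha>1 \<alpha>2 * dist u x powr p))) \<partial>\<mu>1) < \<infinity>" using e1 by (rule le_less_trans)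
  qed measurable
  have i2: "integrable \<mu>2 (\<lambda>x. exp (min \<alpha>1 \<alpha>2 * dist v x powr p))"
  proof (rule integrableI_bounded)
    have "(\<integral>\<^sup>+x. ennreal (norm (exp (min \<alpha>1 \<alpha>2 * dist v x powr p))) \<partial>\<mu>2) \<le> (\<integral>\<^sup>+ x. ennreal (exp (\<alpha>2 * dist v x powr p)) \<partial>\<mu>2)"
      by (intro nn_integral_mono ennreal_leI) (auto intro!: mult_right_mono)
    then show "(\<integral>\<^sup>+x. ennreal (norm (exp (min \<alpha>1 \<alpha>2 * dist v x powr p))) \<partial>\<mu>2) < \<infinity>" using e2 by (rule le_less_trans)
  qed measurable
  have cm: "c \<in> borel_measurable (\<mu>1 \<Otimes>\<^sub>M \<mu>2)"
    using borel_measurable_continuous_onI[OF c(1)] by (simp add: measurable_cong_sets[OF sM refl])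
  show ?thesis
    by unfold_locales (use cm c B cle \<alpha> i1 i2 P1 P2 in auto)
qed

lemma powr_rate_tendsto_0:
  fixes C s e :: real
  assumes "0 \<le> C" "0 < s" "0 < e"
  shows "(\<lambda>n. (C * real n powr (- s)) powr e) \<longlonglongrightarrow> 0"
proof -
  have "(\<lambda>n. real n powr (- s * e)) \<longlonglongrightarrow> 0"
    using assms by (intro tendsto_neg_powr filterlim_real_sequentially) (simp add: mult_pos_pos)
  from tendsto_mult_left_zero[OF this, of "C powr e"] show ?thesis
    using assms by (simp add: powr_mult powr_powr mult.commute)
qed

theorem mainTheorem10:
  fixes \<mu>1 :: "'a::polish_space measure" and \<mu>2 :: "'b::polish_space measure"
    and p :: real
  assumes p: "1 \<le> p"
    and P1: "prob_space \<mu>1" "sets \<mu>1 = sets borel"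
    and P2: "prob_space \<mu>2" "sets \<mu>2 = sets borel"
    and mom1: "\<exists>\<alpha>>0. \<exists>xh. (\<integral>\<^sup>+ x. ennreal (exp (\<alpha> * dist xh x powr p)) \<partial>\<mu>1) < \<infinity>"
    and mom2: "\<exists>\<alpha>>0. \<exists>xh. (\<integral>\<^sup>+ x. ennreal (exp (\<alpha> * dist xh x powr p)) \<partial>\<mu>2) < \<infinity>"
  shows
    "(\<forall>c \<pi>s. continuous_on UNIV c \<and> (\<forall>x. 0 \<le> c x) \<and> growth p p c
        \<and> \<pi>s \<in> couplings \<mu>1 \<mu>2 \<and> Fent c \<mu>1 \<mu>2 \<pi>s = S_ent c \<mu>1 \<mu>2
      \<longrightarrow> (\<lambda>n. Fent c \<mu>1 \<mu>2 (sinkhorn c \<mu>1 \<mu>2 n)) \<longlonglongrightarrow> Fent c \<mu>1 \<mu>2 \<pi>s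
        \<and> (\<lambda>n. Wass p (sinkhorn c \<mu>1 \<mu>2 n) \<pi>s) \<longlonglongrightarrow> 0)
   \<and> (\<forall>q f g \<pi>s. 1 \<le> q \<and> q \<le> p
        \<and> lipschitzX p f \<and> lipschitzX p g \<and> growth p (p - 1) f \<and> growth p (p - 1) g
        \<and> (\<forall>x. 0 \<le> f x * g x)
        \<and> \<pi>s \<in> couplings \<mu>1 \<mu>2
        \<and> Fent (\<lambda>x. f x * g x) \<mu>1 \<mu>2 \<pi>s = S_ent (\<lambda>x. f x * g x) \<mu>1 \<mu>2
      \<longrightarrow> (\<exists>c0. \<forall>n\<ge>2.
            \<bar>Fent (\<lambda>x. f x * g x) \<mu>1 \<mu>2 \<pi>s - Fent (\<lambda>x. f x * g x) \<mu>1 \<mu>2 (sinkhorn (\<lambda>x. f x * g x) \<mu>1 \<mu>2 n)\<bar>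
               \<le> ereal (c0 * real n powr (- 1 / (2 * p)))
          \<and> Wass q \<pi>s (sinkhorn (\<lambda>x. f x * g x) \<mu>1 \<mu>2 n)
               \<le> ennreal (c0 * real n powr (- 1 / (4 * p * q)))))"
proof -
  obtain \<alpha>1 u where \<alpha>1: "0 < \<alpha>1" "(\<integral>\<^sup>+ x. ennreal (exp (\<alpha>1 * dist u x powr p)) \<partial>\<mu>1) < \<infinity>" using mom1 by auto
  obtain \<alpha>2 v where \<alpha>2: "0 < \<alpha>2" "(\<integral>\<^sup>+ x. ennreal (exp (\<alpha>2 * dist v x powr p)) \<partial>\<mu>2) < \<infinity>" using mom2 by auto
  have part1: "(\<lambda>n. Fent c \<mu>1 \<mu>2 (sinkhorn c \<mu>1 \<mu>2 n)) \<longlonglongrightarrow> Fent c \<mu>1 \<mu>2 \<pi>s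
        \<and> (\<lambda>n. Wass p (sinkhorn c \<mu>1 \<mu>2 n) \<pi>s) \<longlonglongrightarrow> 0"
    if c: "continuous_on UNIV c" "\<And>x. 0 \<le> c x" "growth p p c"
      and \<pi>s: "\<pi>s \<in> couplings \<mu>1 \<mu>2" "Fent c \<mu>1 \<mu>2 \<pi>s = S_ent c \<mu>1 \<mu>2" for c \<pi>s
  proof -
    obtain B0 B1 where B: "0 \<le> B0" "0 \<le> B1" "\<And>x y. c (x, y) \<le> B0 + B1 * (dist u x powr p + dist v y powr p)"
      using growth_bound[OF p c(3), of u v] by blast
    interpret S: borel_cost_space \<mu>1 \<mu>2 "curry c" "\<lambda>x. dist u x powr p" "\<lambda>y. dist v y powr p" "min \<alpha>1 \<alpha>2" B0 B1
      by (rule borel_cost_spaceI[OF P1 P2 c(1,2) B \<alpha>1(1) \<alpha>2(1) \<alpha>1(2) \<alpha>2(2)])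
    \<comment> \<open>Without a rate to attain, any exponent below 1 avoids a condition on
      \<open>B1\<close>; here 1/2 is used.\<close>
    obtain C F Fn where C: "0 \<le> C" "Fent c \<mu>1 \<mu>2 \<pi>s = ereal F"
      "\<And>n. 2 \<le> n \<Longrightarrow> Fent c \<mu>1 \<mu>2 (sinkhorn c \<mu>1 \<mu>2 n) = ereal (Fn n)"
      "\<And>n. 2 \<le> n \<Longrightarrow> \<bar>F - Fn n\<bar> \<le> C * real n powr (- (1 / 2) / 2)"
      "\<And>n q. 2 \<le> n \<Longrightarrow> 1 \<le> q \<Longrightarrow> q \<le> p \<Longrightarrow> Wass q \<pi>s (sinkhorn c \<mu>1 \<mu>2 n)
         \<le> ennreal ((2 * 2 powr q * (C * real n powr (- (1 / 2) / 4))) powr (1 / q))"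
      "\<And>n q. 2 \<le> n \<Longrightarrow> 1 \<le> q \<Longrightarrow> q \<le> p \<Longrightarrow> Wass q (sinkhorn c \<mu>1 \<mu>2 n) \<pi>s
         \<le> ennreal ((2 * 2 powr q * (C * real n powr (- (1 / 2) / 4))) powr (1 / q))"
      by (rule S.sinkhorn_convergence[of u p v "1 / 2" \<pi>s, unfolded case_prod_curry]) (use \<pi>s in simp_all)
    have "(\<lambda>n. Fn n - F) \<longlonglongrightarrow> 0"
    proof (rule Lim_null_comparison)
      show "\<forall>\<^sub>F n in sequentially. norm (Fn n - F) \<le> (C * real n powr (- (1 / 4))) powr 1"
        using eventually_ge_at_top[of 2]
      proof eventually_elim
        case (elim n)
        then show ?case using C(4)[of n] C(1) by (simp add: abs_minus_commute)
      qed
    qed (use powr_rate_tendsto_0[OF C(1), of "1 / 4" 1] in simp)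
    then have "Fn \<longlonglongrightarrow> F" by (simp add: LIM_zero_iff)
    then have "(\<lambda>n. ereal (Fn n)) \<longlonglongrightarrow> ereal F" by simp
    moreover have "\<forall>\<^sub>F n in sequentially. ereal (Fn n) = Fent c \<mu>1 \<mu>2 (sinkhorn c \<mu>1 \<mu>2 n)"
      using eventually_ge_at_top[of 2] by eventually_elim (simp add: C(3))
    ultimately have F: "(\<lambda>n. Fent c \<mu>1 \<mu>2 (sinkhorn c \<mu>1 \<mu>2 n)) \<longlonglongrightarrow> Fent c \<mu>1 \<mu>2 \<pi>s"
      unfolding C(2) by (rule Lim_transform_eventually)
    have "(\<lambda>n. ((2 * 2 powr p * C) * real n powr (- (1 / 8))) powr (1 / p)) \<longlonglongrightarrow> 0"
      using C(1) p by (intro powr_rate_tendsto_0) auto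
    then have lim: "(\<lambda>n. ennreal (((2 * 2 powr p * C) * real n powr (- (1 / 8))) powr (1 / p))) \<longlonglongrightarrow> 0"
      using tendsto_ennrealI by fastforce
    have "(\<lambda>n. Wass p (sinkhorn c \<mu>1 \<mu>2 n) \<pi>s) \<longlonglongrightarrow> 0"
    proof (rule tendsto_sandwich[OF _ _ tendsto_const lim])
      show "\<forall>\<^sub>F n in sequentially. Wass p (sinkhorn c \<mu>1 \<mu>2 n) \<pi>s \<le> ennreal (((2 * 2 powr p * C) * real n powr (- (1 / 8))) powr (1 / p))"
        using eventually_ge_at_top[of 2]
      proof eventually_elim
        case (elim n)
        then show ?case using C(6)[of n p] p by (simp add: mult.assoc)
      qed
    qed simp
    with F show ?thesis by simp
  qed
  have part2: "\<exists>c0. \<forall>n\<ge>2.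
            \<bar>Fent (\<lambda>x. f x * g x) \<mu>1 \<mu>2 \<pi>s - Fent (\<lambda>x. f x * g x) \<mu>1 \<mu>2 (sinkhorn (\<lambda>x. f x * g x) \<mu>1 \<mu>2 n)\<bar>
               \<le> ereal (c0 * real n powr (- 1 / (2 * p)))
          \<and> Wass q \<pi>s (sinkhorn (\<lambda>x. f x * g x) \<mu>1 \<mu>2 n)
               \<le> ennreal (c0 * real n powr (- 1 / (4 * p * q)))"
    if q: "1 \<le> q" "q \<le> p" and f: "lipschitzX p f" "growth p (p - 1) f" and g: "lipschitzX p g" "growth p (p - 1) g"
      and nn: "\<And>x. 0 \<le> f x * g x"
      and \<pi>s: "\<pi>s \<in> couplings \<mu>1 \<mu>2" "Fent (\<lambda>x. f x * g x) \<mu>1 \<mu>2 \<pi>s = S_ent (\<lambda>x. f x * g x) \<mu>1 \<mu>2" for q f g \<pi>s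
  proof -
    define c where "c = (\<lambda>x. f x * g x)"
    have cc: "continuous_on UNIV c"
      unfolding c_def by (intro continuous_on_mult continuous_on_lipschitzX[OF p] f g)
    have c0: "0 \<le> c x" for x using nn by (simp add: c_def)
    \<comment> \<open>The exponent \<sigma> = 1/p produces the claimed rates. It reaches 1 only for
      p = 1, where the cost is bounded and \<open>B1 = 0\<close> is available.\<close>
    obtain B0 B1 where B: "0 \<le> B0" "0 \<le> B1" "\<And>x y. c (x, y) \<le> B0 + B1 * (dist u x powr p + dist v y powr p)"
      and B1: "1 / p < 1 \<or> B1 = 0"
    proof (cases "p = 1")
      case True
      obtain B where "0 \<le> B" "\<And>x. f x * g x \<le> B"
        by (rule bounded_product[of f g]) (use f g True in simp_all)
      then show thesis using that[of B 0] by (simp add: c_def)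
    next
      case False
      then have p1: "1 < p" using p by simp
      have "growth p p c" unfolding c_def by (rule growth_product[OF p1 f(1) g(2)])
      then obtain B0 B1 where "0 \<le> B0" "0 \<le> B1" "\<And>x y. c (x, y) \<le> B0 + B1 * (dist u x powr p + dist v y powr p)"
        using growth_bound[OF p, of c u v] by blast
      then show thesis using that[of B0 B1] p1 by simp
    qed
    interpret S: borel_cost_space \<mu>1 \<mu>2 "curry c" "\<lambda>x. dist u x powr p" "\<lambda>y. dist v y powr p" "min \<alpha>1 \<alpha>2" B0 B1
      by (rule borel_cost_spaceI[OF P1 P2 cc c0 B \<alpha>1(1) \<alpha>2(1) \<alpha>1(2) \<alpha>2(2)])
    obtain C F Fn where C: "0 \<le> C" "Fent c \<mu>1 \<mu>2 \<pi>s = ereal F"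
      "\<And>n. 2 \<le> n \<Longrightarrow> Fent c \<mu>1 \<mu>2 (sinkhorn c \<mu>1 \<mu>2 n) = ereal (Fn n)"
      "\<And>n. 2 \<le> n \<Longrightarrow> \<bar>F - Fn n\<bar> \<le> C * real n powr (- (1 / p) / 2)"
      "\<And>n q. 2 \<le> n \<Longrightarrow> 1 \<le> q \<Longrightarrow> q \<le> p \<Longrightarrow> Wass q \<pi>s (sinkhorn c \<mu>1 \<mu>2 n)
         \<le> ennreal ((2 * 2 powr q * (C * real n powr (- (1 / p) / 4))) powr (1 / q))"
      "\<And>n q. 2 \<le> n \<Longrightarrow> 1 \<le> q \<Longrightarrow> q \<le> p \<Longrightarrow> Wass q (sinkhorn c \<mu>1 \<mu>2 n) \<pi>s
         \<le> ennreal ((2 * 2 powr q * (C * real n powr (- (1 / p) / 4))) powr (1 / q))"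
      by (rule S.sinkhorn_convergence[of u p v "1 / p" \<pi>s, unfolded case_prod_curry])
         (use \<pi>s p B1 in \<open>simp_all add: c_def\<close>)
    \<comment> \<open>The power 1/q applied to the bound for the q-th power of the distance; it also
      turns the exponent 1/(4p) into 1/(4pq).\<close>
    define c1 where "c1 = (2 * 2 powr q * C) powr (1 / q)"
    show ?thesis
      unfolding c_def[symmetric]
    proof (intro exI[of _ "max C c1"] allI impI conjI)
      fix n :: nat assume n: "2 \<le> n"
      have "\<bar>F - Fn n\<bar> \<le> C * real n powr (- 1 / (2 * p))" using C(4)[OF n] by (simp add: mult.commute)
      also have "\<dots> \<le> max C c1 * real n powr (- 1 / (2 * p))" by (intro mult_right_mono) auto
      finally show "\<bar>Fent c \<mu>1 \<mu>2 \<pi>s - Fent c \<mu>1 \<mu>2 (sinkhorn c \<mu>1 \<mu>2 n)\<bar> \<le> ereal (max C c1 * real n powr (- 1 / (2 * p)))"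
        by (simp add: C(2) C(3)[OF n])
      have "(2 * 2 powr q * (C * real n powr (- (1 / p) / 4))) powr (1 / q) = c1 * real n powr (- 1 / (4 * p * q))"
        using C(1) by (simp add: c1_def powr_mult powr_powr mult_ac)
      also have "\<dots> \<le> max C c1 * real n powr (- 1 / (4 * p * q))" by (intro mult_right_mono) auto
      finally show "Wass q \<pi>s (sinkhorn c \<mu>1 \<mu>2 n) \<le> ennreal (max C c1 * real n powr (- 1 / (4 * p * q)))"
        using C(5)[OF n q] by (meson ennreal_leI order_trans)
    qed
  qed
  show ?thesis using part1 part2 by blast
qed

end
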